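(* Let $H$ be a fixed graph with $|V(H)| = r$. There is an algorithm which, given an undirected graph $G=(V,E)$ on $n$ vertices of tree-width at most $t$ together with a nice tree decomposition of $G$ of width at most $t$ having $O(n)$ nodes, decides in time $2^{O(t^r)}\cdot n$ whether $V$ can be partitioned into two non-empty sets $A, B$ such that neither of the induced subgraphs $G[A]$ and $G[B]$ contains $H$ as an induced subgraph.
   Context: A tree decomposition of $G=(V,E)$ is a pair $(T,\{X_i : i\in I\})$ with $T$ a tree on node set $I$ and bags $X_i\subseteq V$ such that every vertex lies in some bag, every edge has both endpoints in some bag, and for each vertex $v$ the nodes whose bags contain $v$ induce a connected subtree of $T$; its width is $\max_i |X_i|-1$, and the tree-width of $G$ is the minimum width over all tree decompositions. A nice tree decomposition is a rooted tree decomposition in which every node is a leaf node (empty bag), an introduce node (one child, bag equals the child's bag plus one vertex), a forget node (one child, bag equals the child's bag minus one vertex), or a join node (two children with bags equal to its own). For $S\subseteq V$, $G[S]$ is the induced subgraph on $S$. *)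

theory Defs
  imports "HOL-Library.Landau_Symbols" "Graph_Theory.Graph_Theory"
begin

section \<open>Graphs and tree decompositions\<close>

text \<open>
  A finite simple undirected graph is a \<^locale>\<open>pair_graph\<close>: a finite, loop-free digraph whose arc set
  is a symmetric relation, so an edge \<open>{u, v}\<close> is present as both \<open>(u, v)\<close> and \<open>(v, u)\<close>.
\<close>

definition contains_induced :: "('a, 'b) pre_digraph \<Rightarrow> ('c, 'd) pre_digraph \<Rightarrow> bool" where
  "contains_induced G H \<longleftrightarrow> (\<exists>S \<subseteq> verts G. digraph_iso H (G \<restriction> S))"

text \<open>
  The constant \<^const>\<open>Digraph_Component.tree\<close> of the library is not usable here, because in a symmetric
  digraph every edge yields a directed cycle \<open>u, v, u\<close>. A \<^const>\<open>pre_digraph.cycle\<close> repeats no vertex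
  except for its end points, so the cycles with at least three arcs are exactly the cycles of the
  undirected graph. Connectedness includes that there is at least one vertex.
\<close>

definition undirected_tree :: "'i pair_pre_digraph \<Rightarrow> bool" where
  "undirected_tree T \<longleftrightarrow> pair_graph T \<and> Digraph_Component.connected (with_proj T) \<and>
     (\<nexists>p. pre_digraph.cycle (with_proj T) p \<and> length p \<ge> 3)"

definition tree_decomposition ::
  "'a pair_pre_digraph \<Rightarrow> 'i pair_pre_digraph \<Rightarrow> ('i \<Rightarrow> 'a set) \<Rightarrow> bool" where
  "tree_decomposition G T X \<longleftrightarrow>
     undirected_tree T \<and>
     (\<forall>i \<in> pverts T. X i \<subseteq> pverts G) \<and>
     (\<forall>v \<in> pverts G. \<exists>i \<in> pverts T. v \<in> X i) \<and>
     (\<forall>(u, v) \<in> parcs G. \<exists>i \<in> pverts T. u \<in> X i \<and> v \<in> X i) \<and>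
     (\<forall>v \<in> pverts G. Digraph_Component.connected (with_proj T \<restriction> {i \<in> pverts T. v \<in> X i}))"

text \<open>An integer, since a decomposition all of whose bags are empty has width \<open>-1\<close>.\<close>

definition width :: "'i pair_pre_digraph \<Rightarrow> ('i \<Rightarrow> 'a set) \<Rightarrow> int" where
  "width T X = Max ((\<lambda>i. int (card (X i))) ` pverts T) - 1"

text \<open>Decomposition trees are finite, so nothing is lost by taking their nodes to be numbers.\<close>

definition treewidth :: "'a pair_pre_digraph \<Rightarrow> int" where
  "treewidth G = (LEAST k. \<exists>(T :: nat pair_pre_digraph) X. tree_decomposition G T X \<and> width T X = k)"

text \<open>\<open>j\<close> is a child of \<open>i\<close> iff \<open>i\<close> is the last node before \<open>j\<close> on the path from the root \<open>\<rho>\<close> to \<open>j\<close>.\<close>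

definition children :: "'i pair_pre_digraph \<Rightarrow> 'i \<Rightarrow> 'i \<Rightarrow> 'i set" where
  "children T \<rho> i = {j. \<exists>p. pre_digraph.apath (with_proj T) \<rho> (p @ [(i, j)]) j}"

definition leaf_node where
  "leaf_node T \<rho> X i \<longleftrightarrow> children T \<rho> i = {} \<and> X i = {}"

definition introduce_node where
  "introduce_node T \<rho> X i \<longleftrightarrow> (\<exists>j v. children T \<rho> i = {j} \<and> v \<notin> X j \<and> X i = insert v (X j))"

definition forget_node where
  "forget_node T \<rho> X i \<longleftrightarrow> (\<exists>j v. children T \<rho> i = {j} \<and> v \<in> X j \<and> X i = X j - {v})"

definition join_node where
  "join_node T \<rho> X i \<longleftrightarrow>
     (\<exists>j k. j \<noteq> k \<and> children T \<rho> i = {j, k} \<and> X j = X i \<and> X k = X i)"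

definition nice_tree_decomposition ::
  "'a pair_pre_digraph \<Rightarrow> 'i pair_pre_digraph \<Rightarrow> 'i \<Rightarrow> ('i \<Rightarrow> 'a set) \<Rightarrow> bool" where
  "nice_tree_decomposition G T \<rho> X \<longleftrightarrow>
     tree_decomposition G T X \<and> \<rho> \<in> pverts T \<and>
     (\<forall>i \<in> pverts T. leaf_node T \<rho> X i \<or> introduce_node T \<rho> X i \<or>
        forget_node T \<rho> X i \<or> join_node T \<rho> X i)"

definition has_induced_free_bipartition ::
  "('a, 'b) pre_digraph \<Rightarrow> ('c, 'd) pre_digraph \<Rightarrow> bool" where
  "has_induced_free_bipartition G H \<longleftrightarrow>
     (\<exists>A B. A \<union> B = verts G \<and> A \<inter> B = {} \<and> A \<noteq> {} \<and> B \<noteq> {} \<and>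
        \<not> contains_induced (G \<restriction> A) H \<and> \<not> contains_induced (G \<restriction> B) H)"


section \<open>The machine model\<close>

text \<open>
  Algorithms are structured programs for a random access machine with unit costs. A program uses
  finitely many registers and finitely many arrays, both named by numbers. The only arithmetic
  operations are increment and decrement: after \<open>k\<close> steps no stored number exceeds the largest
  initial number or program constant by more than \<open>k\<close>, so unit costs cannot be exploited by
  computing with long numbers.
\<close>

type_synonym state = "(nat \<Rightarrow> nat) \<times> (nat \<Rightarrow> nat \<Rightarrow> nat)"

datatype test =
    EQ nat nat
  | LESS nat nat

datatype com =
    SET nat nat        \<comment> \<open>register, constant\<close>
  | COPY nat nat       \<comment> \<open>target register, source register\<close>
  | INC nat
  | DEC nat
  | LOAD nat nat nat   \<comment> \<open>target register, array, index register\<close>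
  | STORE nat nat nat  \<comment> \<open>array, index register, source register\<close>
  | SEQ com com
  | IF test com com
  | WHILE test com

fun holds :: "test \<Rightarrow> state \<Rightarrow> bool" where
  "holds (EQ x y) (R, M) \<longleftrightarrow> R x = R y"
| "holds (LESS x y) (R, M) \<longleftrightarrow> R x < R y"

text \<open>\<open>exec c s k s'\<close>: started in \<open>s\<close>, \<open>c\<close> halts in \<open>s'\<close> after exactly \<open>k\<close> elementary steps.\<close>

inductive exec :: "com \<Rightarrow> state \<Rightarrow> nat \<Rightarrow> state \<Rightarrow> bool" where
  Set: "exec (SET x a) (R, M) 1 (R(x := a), M)"
| Copy: "exec (COPY x y) (R, M) 1 (R(x := R y), M)"
| Inc: "exec (INC x) (R, M) 1 (R(x := R x + 1), M)"
| Dec: "exec (DEC x) (R, M) 1 (R(x := R x - 1), M)"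
| Load: "exec (LOAD x a y) (R, M) 1 (R(x := M a (R y)), M)"
| Store: "exec (STORE a y x) (R, M) 1 (R, M(a := (M a)(R y := R x)))"
| Seq: "exec c1 s k1 s' \<Longrightarrow> exec c2 s' k2 s'' \<Longrightarrow> exec (SEQ c1 c2) s (k1 + k2) s''"
| IfTrue: "holds b s \<Longrightarrow> exec c1 s k s' \<Longrightarrow> exec (IF b c1 c2) s (k + 1) s'"
| IfFalse: "\<not> holds b s \<Longrightarrow> exec c2 s k s' \<Longrightarrow> exec (IF b c1 c2) s (k + 1) s'"
| WhileFalse: "\<not> holds b s \<Longrightarrow> exec (WHILE b c) s 1 s"
| WhileTrue: "holds b s \<Longrightarrow> exec c s k1 s' \<Longrightarrow> exec (WHILE b c) s' k2 s'' \<Longrightarrow>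
    exec (WHILE b c) s (k1 + k2 + 1) s''"

inductive_cases exec_SeqE: "exec (SEQ c1 c2) s k s'"
inductive_cases exec_IfE: "exec (IF b c1 c2) s k s'"
inductive_cases exec_WhileE: "exec (WHILE b c) s k s'"
inductive_cases exec_atomE:
  "exec (SET x a) s k s'" "exec (COPY x y) s k s'" "exec (INC x) s k s'" "exec (DEC x) s k s'"
  "exec (LOAD x a y) s k s'" "exec (STORE a y x) s k s'"

lemma exec_deterministic: "exec c s k s' \<Longrightarrow> exec c s l t' \<Longrightarrow> l = k \<and> t' = s'"
proof (induction arbitrary: l t' rule: exec.induct)
  case (Seq c1 s k1 s' c2 k2 s'')
  from Seq.prems show ?case
    by (rule exec_SeqE) (metis Seq.IH)
next
  case (IfTrue b s c1 k s' c2)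
  from IfTrue.prems show ?case
    by (rule exec_IfE) (metis IfTrue.IH IfTrue.hyps(1) Suc_eq_plus1)+
next
  case (IfFalse b s c2 k s' c1)
  from IfFalse.prems show ?case
    by (rule exec_IfE) (metis IfFalse.IH IfFalse.hyps(1) Suc_eq_plus1)+
next
  case (WhileFalse b s c)
  from WhileFalse.prems show ?case
    by (rule exec_WhileE) (simp_all add: WhileFalse.hyps(1))
next
  case (WhileTrue b s c k1 s' k2 s'')
  from WhileTrue.prems show ?case
    by (rule exec_WhileE) (metis WhileTrue.IH WhileTrue.hyps(1) Suc_eq_plus1)+
qed (erule exec_atomE, simp)+


section \<open>Input representation\<close>

text \<open>
  A list of lists is stored in two arrays: the concatenation of its members, and the list of the
  offsets at which the members start, followed by the total length. Unused cells are zero.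
\<close>

definition cells :: "nat list \<Rightarrow> nat \<Rightarrow> nat" where
  "cells xs i = (if i < length xs then xs ! i else 0)"

definition offsets :: "nat list list \<Rightarrow> nat list" where
  "offsets xss = map (\<lambda>i. length (concat (take i xss))) [0..<Suc (length xss)]"

text \<open>
  Vertices and nodes are numbered from \<open>0\<close>. The graph is given by adjacency lists, the rooted tree by
  child lists, and the bags by lists of vertices, each list being in arbitrary order.
\<close>

definition encodes ::
  "nat pair_pre_digraph \<Rightarrow> nat pair_pre_digraph \<Rightarrow> nat \<Rightarrow> (nat \<Rightarrow> nat set) \<Rightarrow> state \<Rightarrow> bool" where
  "encodes G T \<rho> X s \<longleftrightarrow>
     (\<exists>adj ch bag.
        pverts G = {..<length adj} \<and>
        (\<forall>v < length adj. distinct (adj ! v) \<and> set (adj ! v) = {u. (v, u) \<in> parcs G}) \<and>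
        pverts T = {..<length ch} \<and>
        (\<forall>i < length ch. distinct (ch ! i) \<and> set (ch ! i) = children T \<rho> i) \<and>
        length bag = length ch \<and>
        (\<forall>i < length bag. distinct (bag ! i) \<and> set (bag ! i) = X i) \<and>
        s = ((\<lambda>_. 0)(0 := length adj, 1 := length ch, 2 := \<rho>),
             (\<lambda>_ _. 0)(0 := cells (offsets adj), 1 := cells (concat adj),
                       2 := cells (offsets ch), 3 := cells (concat ch),
                       4 := cells (offsets bag), 5 := cells (concat bag))))"

end

theory Submission
  imports Defs
begin

text \<open>
  A dynamic program runs over the rooted tree from the leaves to the root. For a 2-coloured part of
  \<open>G\<close> below a node, only the set of pairs (colour, partial embedding of \<open>H\<close> into that colour class)
  matters, where an image outside the bag is just recorded as forgotten. If the bags have at most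
  \<open>K - 2\<close> elements, there are at most \<open>2 K^r\<close> such pairs, hence at most \<open>N = 2^(2 K^r)\<close> such sets,
  which are the numbers below \<open>N\<close> in binary. Both colour classes are free of \<open>H\<close> iff no pair at the
  root is a total embedding. The states possible at a node are determined by those at its at most two
  children through a formula with a fixed number of quantifiers, each ranging over numbers below \<open>N\<close>;
  evaluating it takes time polynomial in \<open>N\<close>, that is \<open>2^O(t^r)\<close>. Leaf, introduce, forget and join
  nodes need no distinction: a missing child is replaced by a dummy node with an empty bag.

  In order that adjacency can be tested in time \<open>O(N)\<close> as well, each vertex first gets a short list of
  neighbours, namely those whose topmost node does not come after its own in breadth-first order.
  They all lie in the bag of its topmost node, and every edge is found from one of its ends.
\<close>

section \<open>Dynamic programming over partial embeddings\<close>

text \<open>Linear time in \<open>n\<close> rules out work that grows with degrees: an adjacency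
  list can have length about \<open>n\<close>, and scanning such lists at every node would be
  quadratic. This is the reason for the short neighbour lists. The other obstacle is the machine,
  which can only count up and down. Since the budget at a node is polynomial in \<open>N\<close>,
  brute force is affordable: arithmetic is done by counting loops bounded by \<open>N\<close>, a
  state is checked rather than computed, and one generic estimate covers the running time of every
  formula. The size of the formula depends on the pattern alone, so the exponent of \<open>N\<close>
  does not depend on the width; with \<open>K\<close> at most \<open>t + 3\<close>, a fixed power of
  \<open>N\<close> is still 2^O(t^r). \<open>K\<close> is the largest bag size plus two, the two
  extra digits standing for a vertex without image and for a forgotten image. The program determines
  \<open>K\<close> itself, because the width is not part of the input. A state is the exact set of
  pairs, since in the end the absence of total embeddings is read off from it.\<close>

text \<open>
  The pattern has vertices \<open>0, \<dots>, r - 1\<close> and adjacency \<open>F\<close>, the host graph has adjacency \<open>E\<close>.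
  A partial embedding of the pattern into the part \<open>V\<close> of the host below a node with bag \<open>B\<close> is
  abstracted to a list of \<open>r\<close> digits: \<open>0\<close> for a vertex without image, \<open>1\<close> for an image outside
  the bag, and \<open>p + 2\<close> for the image \<open>B ! p\<close>.
\<close>

definition keeps :: "nat list \<Rightarrow> nat list \<Rightarrow> nat \<Rightarrow> nat \<Rightarrow> bool" where
  "keeps B B' d e \<longleftrightarrow> 2 \<le> e \<and> e < length B' + 2 \<and> B' ! (e - 2) = B ! (d - 2) \<or> e = 0 \<and> B ! (d - 2) \<notin> set B'"

definition forgets :: "nat list \<Rightarrow> nat list \<Rightarrow> nat \<Rightarrow> bool" where
  "forgets B B' e \<longleftrightarrow> e = 1 \<or> 2 \<le> e \<and> e < length B' + 2 \<and> B' ! (e - 2) \<notin> set B"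

text \<open>\<open>d\<close>, \<open>e\<close>, \<open>f\<close> are the digits of one pattern
  vertex at the node and at its two children. An image in the bag must be recorded as the same
  vertex by each child whose bag contains it, and is unknown to a child whose bag does not
  (\<open>keeps\<close>). A forgotten image lies below exactly one child, because the two parts meet
  only inside the bag; that child has forgotten it already, or has it in its bag while the parent
  drops it (\<open>forgets\<close>).\<close>

definition digit_join :: "nat list \<Rightarrow> nat list \<Rightarrow> nat list \<Rightarrow> nat \<Rightarrow> nat \<Rightarrow> nat \<Rightarrow> bool" where
  "digit_join B B1 B2 d e f \<longleftrightarrow>
     (d = 0 \<and> e = 0 \<and> f = 0) \<or>
     (d = 1 \<and> (forgets B B1 e \<and> f = 0 \<or> e = 0 \<and> forgets B B2 f)) \<or>
     (2 \<le> d \<and> keeps B B1 d e \<and> keeps B B2 d f)"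

locale pattern =
  fixes F :: "nat \<Rightarrow> nat \<Rightarrow> bool" and E :: "nat \<Rightarrow> nat \<Rightarrow> bool" and r :: nat
  assumes r_pos: "0 < r"
begin

definition occurs :: "nat set \<Rightarrow> nat list \<Rightarrow> (nat \<Rightarrow> nat) \<Rightarrow> nat \<Rightarrow> nat list \<Rightarrow> bool" where
  "occurs V B \<chi> c d \<longleftrightarrow> length d = r \<and> (\<exists>\<psi>.
     (\<forall>h<r. d ! h \<noteq> 0 \<longrightarrow> \<psi> h \<in> V \<and> \<chi> (\<psi> h) = c \<and>
        (if d ! h = 1 then \<psi> h \<notin> set B else d ! h < length B + 2 \<and> B ! (d ! h - 2) = \<psi> h)) \<and>
     (\<forall>h<r. \<forall>h'<r. h \<noteq> h' \<and> d ! h \<noteq> 0 \<and> d ! h' \<noteq> 0 \<longrightarrow>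
        \<psi> h \<noteq> \<psi> h' \<and> (F h h' \<longleftrightarrow> E (\<psi> h) (\<psi> h'))))"

text \<open>The part of the test that concerns the bag alone and can be read off from the host graph
  without the children. Comparing digits decides distinctness of images when the bag has no
  repetitions.\<close>

definition bag_ok :: "nat list \<Rightarrow> nat list \<Rightarrow> bool" where
  "bag_ok B d \<longleftrightarrow> (\<forall>h<r. d ! h < length B + 2) \<and>
     (\<forall>h<r. \<forall>h'<r. h \<noteq> h' \<and> 2 \<le> d ! h \<and> 2 \<le> d ! h' \<longrightarrow>
        d ! h \<noteq> d ! h' \<and> (F h h' \<longleftrightarrow> E (B ! (d ! h - 2)) (B ! (d ! h' - 2))))"

text \<open>The second condition asks that a pattern edge be witnessed inside one part or inside the
  bag, because the host has no other edges. There is no clause for pattern non-edges: adjacent host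
  vertices always share a part or the bag, and non-adjacency is tested there.\<close>

definition joins :: "nat list \<Rightarrow> nat list \<Rightarrow> nat list \<Rightarrow> nat list \<Rightarrow> nat list \<Rightarrow> nat list \<Rightarrow> bool" where
  "joins B B1 B2 d e f \<longleftrightarrow> (\<forall>h<r. digit_join B B1 B2 (d ! h) (e ! h) (f ! h)) \<and>
     (\<forall>h<r. \<forall>h'<r. h \<noteq> h' \<and> F h h' \<and> d ! h \<noteq> 0 \<and> d ! h' \<noteq> 0 \<longrightarrow>
        e ! h \<noteq> 0 \<and> e ! h' \<noteq> 0 \<or> f ! h \<noteq> 0 \<and> f ! h' \<noteq> 0 \<or> 2 \<le> d ! h \<and> 2 \<le> d ! h')"

lemma occurs_cong:
  assumes "\<And>x. x \<in> V \<Longrightarrow> \<chi> x = \<chi>' x"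
  shows "occurs V B \<chi> c d \<longleftrightarrow> occurs V B \<chi>' c d"
proof -
  have "(x \<in> V \<and> \<chi> x = c \<and> Q) = (x \<in> V \<and> \<chi>' x = c \<and> Q)" for x Q
    using assms by (simp cong: conj_cong)
  then show ?thesis by (simp only: occurs_def)
qed

lemma occurs_digit_less:
  assumes "occurs V B \<chi> c d" "x \<in> set d"
  shows "x < length B + 2"
  using assms unfolding occurs_def by (metis One_nat_def add_2_eq_Suc' in_set_conv_nth less_Suc_eq_0_disj)

text \<open>The restriction of the embedding \<open>\<psi>\<close> to the part \<open>V1\<close>,
  written in digits relative to the bag \<open>B1\<close>. \<open>LEAST\<close> picks one position,
  as \<open>B1\<close> may contain repetitions here.\<close>

definition child_digit :: "nat set \<Rightarrow> nat list \<Rightarrow> nat list \<Rightarrow> (nat \<Rightarrow> nat) \<Rightarrow> nat \<Rightarrow> nat" where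
  "child_digit V1 B1 d \<psi> h = (if d ! h = 0 \<or> \<psi> h \<notin> V1 then 0
     else if \<psi> h \<in> set B1 then (LEAST p. p < length B1 \<and> B1 ! p = \<psi> h) + 2 else 1)"

lemma least_index:
  assumes "x \<in> set xs"
  shows "(LEAST p. p < length xs \<and> xs ! p = x) < length xs"
    "xs ! (LEAST p. p < length xs \<and> xs ! p = x) = x"
proof -
  obtain p where "p < length xs \<and> xs ! p = x" using assms by (auto simp: in_set_conv_nth)
  from LeastI[of "\<lambda>p. p < length xs \<and> xs ! p = x", OF this]
  show "(LEAST p. p < length xs \<and> xs ! p = x) < length xs"
    "xs ! (LEAST p. p < length xs \<and> xs ! p = x) = x" by auto
qed

lemma child_digit_cases:
  shows "0 < child_digit V1 B1 d \<psi> h \<longleftrightarrow> 0 < d ! h \<and> \<psi> h \<in> V1"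
    "child_digit V1 B1 d \<psi> h = Suc 0 \<longleftrightarrow> d ! h \<noteq> 0 \<and> \<psi> h \<in> V1 \<and> \<psi> h \<notin> set B1"
    "2 \<le> child_digit V1 B1 d \<psi> h \<longleftrightarrow> d ! h \<noteq> 0 \<and> \<psi> h \<in> V1 \<and> \<psi> h \<in> set B1"
    "2 \<le> child_digit V1 B1 d \<psi> h \<Longrightarrow> child_digit V1 B1 d \<psi> h < length B1 + 2"
    "2 \<le> child_digit V1 B1 d \<psi> h \<Longrightarrow> B1 ! (child_digit V1 B1 d \<psi> h - 2) = \<psi> h"
  unfolding child_digit_def using least_index[of "\<psi> h" B1] by (auto split: if_splits)

text \<open>Discarding images outside \<open>V1\<close> cannot violate a condition on pairs of
  images, so one \<open>\<psi>\<close> serves for both children.\<close>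

lemma occurs_child:
  assumes emb: "\<forall>h<r. d ! h \<noteq> 0 \<longrightarrow> \<chi> (\<psi> h) = c"
    "\<forall>h<r. \<forall>h'<r. h \<noteq> h' \<and> d ! h \<noteq> 0 \<and> d ! h' \<noteq> 0 \<longrightarrow>
        \<psi> h \<noteq> \<psi> h' \<and> (F h h' \<longleftrightarrow> E (\<psi> h) (\<psi> h'))"
  shows "occurs V1 B1 \<chi> c (map (child_digit V1 B1 d \<psi>) [0..<r])"
  unfolding occurs_def
proof (intro conjI exI[of _ \<psi>] allI impI)
  fix h assume h: "h < r" "map (child_digit V1 B1 d \<psi>) [0..<r] ! h \<noteq> 0"
  let ?e = "child_digit V1 B1 d \<psi> h"
  have e: "map (child_digit V1 B1 d \<psi>) [0..<r] ! h = ?e" using h by simp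
  have nz: "?e \<noteq> 0" using h by simp
  then show "\<psi> h \<in> V1" "\<chi> (\<psi> h) = c" using emb(1) h(1) by (auto simp: child_digit_cases)
  show "if map (child_digit V1 B1 d \<psi>) [0..<r] ! h = 1 then \<psi> h \<notin> set B1
     else map (child_digit V1 B1 d \<psi>) [0..<r] ! h < length B1 + 2 \<and>
       B1 ! (map (child_digit V1 B1 d \<psi>) [0..<r] ! h - 2) = \<psi> h"
    unfolding e
  proof (cases "?e = 1")
    case True
    then show "if ?e = 1 then \<psi> h \<notin> set B1 else ?e < length B1 + 2 \<and> B1 ! (?e - 2) = \<psi> h"
      using child_digit_cases(2)[of V1 B1 d \<psi> h] by simp
  next
    case False
    then have "2 \<le> ?e" using nz by linarith
    then show "if ?e = 1 then \<psi> h \<notin> set B1 else ?e < length B1 + 2 \<and> B1 ! (?e - 2) = \<psi> h"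
      using child_digit_cases(4,5)[of V1 B1 d \<psi> h] by simp
  qed
next
  fix h h' assume "h < r" "h' < r" "h \<noteq> h' \<and> map (child_digit V1 B1 d \<psi>) [0..<r] ! h \<noteq> 0 \<and>
    map (child_digit V1 B1 d \<psi>) [0..<r] ! h' \<noteq> 0"
  then show "\<psi> h \<noteq> \<psi> h'" "F h h' = E (\<psi> h) (\<psi> h')"
    using emb(2) by (auto simp: child_digit_cases)
qed simp

end

section \<open>Splitting and gluing partial embeddings at one node\<close>

text \<open>What a tree decomposition guarantees at a node with bag \<open>B\<close>:
  \<open>V\<close> is the part of the graph below it, \<open>V1\<close> and \<open>V2\<close> are
  the parts below its children. A missing child has an empty part and an empty bag.\<close>

locale node_step = pattern +
  fixes V V1 V2 :: "nat set" and B B1 B2 :: "nat list"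
  assumes V_eq: "V = set B \<union> V1 \<union> V2"
    and bags: "set B1 \<subseteq> V1" "set B2 \<subseteq> V2" "distinct B"
    and sep: "V1 \<inter> set B \<subseteq> set B1" "V2 \<inter> set B \<subseteq> set B2" "V1 \<inter> V2 \<subseteq> set B"
    and edges: "\<And>x y. E x y \<Longrightarrow> x \<in> V \<Longrightarrow> y \<in> V \<Longrightarrow>
      x \<in> V1 \<and> y \<in> V1 \<or> x \<in> V2 \<and> y \<in> V2 \<or> x \<in> set B \<and> y \<in> set B"
begin

text \<open>\<open>e\<close> and \<open>f\<close> are the restrictions of the embedding to the two
  parts. By \<open>sep\<close>, an image in the bag lies in a part only if it is in the bag of that
  child, and an image outside the bag lies in exactly one part.\<close>

lemma occurs_decompose:
  assumes "occurs V B \<chi> c d"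
  shows "bag_ok B d" "\<And>h. h < r \<Longrightarrow> 2 \<le> d ! h \<Longrightarrow> \<chi> (B ! (d ! h - 2)) = c"
    "\<exists>e f. occurs V1 B1 \<chi> c e \<and> occurs V2 B2 \<chi> c f \<and> joins B B1 B2 d e f"
proof -
  from assms obtain \<psi> where len: "length d = r" and
    p1: "\<forall>h<r. d ! h \<noteq> 0 \<longrightarrow> \<psi> h \<in> V \<and> \<chi> (\<psi> h) = c \<and>
        (if d ! h = 1 then \<psi> h \<notin> set B else d ! h < length B + 2 \<and> B ! (d ! h - 2) = \<psi> h)" and
    p2: "\<forall>h<r. \<forall>h'<r. h \<noteq> h' \<and> d ! h \<noteq> 0 \<and> d ! h' \<noteq> 0 \<longrightarrow>
        \<psi> h \<noteq> \<psi> h' \<and> (F h h' \<longleftrightarrow> E (\<psi> h) (\<psi> h'))"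
    unfolding occurs_def by blast
  have big: "\<psi> h \<in> set B \<and> B ! (d ! h - 2) = \<psi> h \<and> d ! h < length B + 2 \<and> \<psi> h \<in> V \<and> \<chi> (\<psi> h) = c"
    if "h < r" "2 \<le> d ! h" for h
  proof -
    have "d ! h \<noteq> 0" "d ! h \<noteq> 1" using that by auto
    then have "d ! h < length B + 2" "B ! (d ! h - 2) = \<psi> h" "\<psi> h \<in> V" "\<chi> (\<psi> h) = c"
      using p1 that(1) by (metis (full_types))+
    moreover have "d ! h - 2 < length B" using that \<open>d ! h < length B + 2\<close> by auto
    ultimately show ?thesis by (metis nth_mem)
  qed
  have one: "\<psi> h \<notin> set B \<and> \<psi> h \<in> V" if "h < r" "d ! h = 1" for h
    using p1 that by auto
  show "\<chi> (B ! (d ! h - 2)) = c" if "h < r" "2 \<le> d ! h" for h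
    using big[OF that] by simp
  show "bag_ok B d" unfolding bag_ok_def
  proof (intro conjI allI impI)
    fix h assume h: "h < r"
    show "d ! h < length B + 2" using big[OF h] by (cases "2 \<le> d ! h") auto
  next
    fix h h' assume a: "h < r" "h' < r" "h \<noteq> h' \<and> 2 \<le> d ! h \<and> 2 \<le> d ! h'"
    have n: "\<psi> h \<noteq> \<psi> h'" "F h h' \<longleftrightarrow> E (\<psi> h) (\<psi> h')" using p2 a by auto
    show "d ! h \<noteq> d ! h'" using n(1) big[of h] big[of h'] a by metis
    show "F h h' \<longleftrightarrow> E (B ! (d ! h - 2)) (B ! (d ! h' - 2))"
      using n(2) big[of h] big[of h'] a by metis
  qed
  define e where "e = map (child_digit V1 B1 d \<psi>) [0..<r]"
  define f where "f = map (child_digit V2 B2 d \<psi>) [0..<r]"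
  have "occurs V1 B1 \<chi> c e" "occurs V2 B2 \<chi> c f" unfolding e_def f_def
    using p1 p2 by (auto intro!: occurs_child)
  moreover have "joins B B1 B2 d e f" unfolding joins_def
  proof (intro conjI allI impI)
    fix h assume h: "h < r"
    have eh: "e ! h = child_digit V1 B1 d \<psi> h" "f ! h = child_digit V2 B2 d \<psi> h"
      using h by (auto simp: e_def f_def)
    consider "d ! h = 0" | "d ! h = 1" | "2 \<le> d ! h" by linarith
    then show "digit_join B B1 B2 (d ! h) (e ! h) (f ! h)"
    proof cases
      case 1 then show ?thesis by (simp add: eh digit_join_def child_digit_def)
    next
      case 2
      have o: "\<psi> h \<notin> set B" "\<psi> h \<in> V" using one[OF h 2] by auto
      have fg: "forgets B B' (child_digit V' B' d \<psi> h)" if "\<psi> h \<in> V'" for V' B'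
      proof (cases "\<psi> h \<in> set B'")
        case True
        then have "2 \<le> child_digit V' B' d \<psi> h" using 2 that by (simp add: child_digit_cases)
        then show ?thesis using child_digit_cases(4,5)[of V' B' d \<psi> h] o by (simp add: forgets_def)
      next
        case False
        then show ?thesis using 2 that by (simp add: forgets_def child_digit_def)
      qed
      show ?thesis
      proof (cases "\<psi> h \<in> V1")
        case True
        then have "\<psi> h \<notin> V2" using sep o by blast
        then show ?thesis using fg[OF True] 2 by (simp add: eh digit_join_def child_digit_def)
      next
        case False
        then have "\<psi> h \<in> V2" using V_eq o by blast
        then show ?thesis using fg[of V2] False 2 by (simp add: eh digit_join_def child_digit_def)
      qed
    next
      case 3
      note b = big[OF h 3]
      have kp: "keeps B B' (d ! h) (child_digit V' B' d \<psi> h)"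
        if "V' \<inter> set B \<subseteq> set B'" "set B' \<subseteq> V'" for V' B'
      proof (cases "\<psi> h \<in> V'")
        case True
        then have "\<psi> h \<in> set B'" using that b by blast
        then have "2 \<le> child_digit V' B' d \<psi> h" using 3 True by (simp add: child_digit_cases)
        then show ?thesis using child_digit_cases(4,5)[of V' B' d \<psi> h] b by (simp add: keeps_def)
      next
        case False
        then show ?thesis using b that by (auto simp: keeps_def child_digit_def)
      qed
      show ?thesis using kp[OF sep(1) bags(1)] kp[OF sep(2) bags(2)] 3
        by (simp add: eh digit_join_def)
    qed
  next
    fix h h' assume a: "h < r" "h' < r" "h \<noteq> h' \<and> F h h' \<and> d ! h \<noteq> 0 \<and> d ! h' \<noteq> 0"
    have E: "E (\<psi> h) (\<psi> h')" "\<psi> h \<in> V" "\<psi> h' \<in> V" using p1 p2 a by auto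
    have inB: "2 \<le> d ! x" if "\<psi> x \<in> set B" "x < r" "d ! x \<noteq> 0" for x
      using one[of x] that by (cases "d ! x = 1") auto
    from edges[OF E] show "e ! h \<noteq> 0 \<and> e ! h' \<noteq> 0 \<or> f ! h \<noteq> 0 \<and> f ! h' \<noteq> 0 \<or> 2 \<le> d ! h \<and> 2 \<le> d ! h'"
      using a inB by (auto simp: e_def f_def child_digit_cases)
  qed
  ultimately show "\<exists>e f. occurs V1 B1 \<chi> c e \<and> occurs V2 B2 \<chi> c f \<and> joins B B1 B2 d e f" by blast
qed

text \<open>The embeddings below the two children are independent witnesses, but they agree where
  both are defined: such a pattern vertex has its image in the bag, and \<open>keeps\<close> fixes
  this image. So they can be glued.\<close>

lemma occurs_compose:
  assumes len: "length d = r" and bo: "bag_ok B d"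
    and col: "\<And>h. h < r \<Longrightarrow> 2 \<le> d ! h \<Longrightarrow> \<chi> (B ! (d ! h - 2)) = c"
    and e: "occurs V1 B1 \<chi> c e" and f: "occurs V2 B2 \<chi> c f" and j: "joins B B1 B2 d e f"
  shows "occurs V B \<chi> c d"
proof -
  from e obtain \<psi>1 where
    e1: "\<And>h. h < r \<Longrightarrow> e ! h \<noteq> 0 \<Longrightarrow> \<psi>1 h \<in> V1 \<and> \<chi> (\<psi>1 h) = c \<and>
        (if e ! h = 1 then \<psi>1 h \<notin> set B1 else e ! h < length B1 + 2 \<and> B1 ! (e ! h - 2) = \<psi>1 h)" and
    e2: "\<And>h h'. h < r \<Longrightarrow> h' < r \<Longrightarrow> h \<noteq> h' \<Longrightarrow> e ! h \<noteq> 0 \<Longrightarrow> e ! h' \<noteq> 0 \<Longrightarrow>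
        \<psi>1 h \<noteq> \<psi>1 h' \<and> (F h h' \<longleftrightarrow> E (\<psi>1 h) (\<psi>1 h'))"
    unfolding occurs_def by blast
  from f obtain \<psi>2 where
    f1: "\<And>h. h < r \<Longrightarrow> f ! h \<noteq> 0 \<Longrightarrow> \<psi>2 h \<in> V2 \<and> \<chi> (\<psi>2 h) = c \<and>
        (if f ! h = 1 then \<psi>2 h \<notin> set B2 else f ! h < length B2 + 2 \<and> B2 ! (f ! h - 2) = \<psi>2 h)" and
    f2: "\<And>h h'. h < r \<Longrightarrow> h' < r \<Longrightarrow> h \<noteq> h' \<Longrightarrow> f ! h \<noteq> 0 \<Longrightarrow> f ! h' \<noteq> 0 \<Longrightarrow>
        \<psi>2 h \<noteq> \<psi>2 h' \<and> (F h h' \<longleftrightarrow> E (\<psi>2 h) (\<psi>2 h'))"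
    unfolding occurs_def by blast
  define \<psi> where "\<psi> h = (if 2 \<le> d ! h then B ! (d ! h - 2) else if e ! h \<noteq> 0 then \<psi>1 h else \<psi>2 h)" for h
  have dj: "digit_join B B1 B2 (d ! h) (e ! h) (f ! h)" if "h < r" for h
    using j that by (auto simp: joins_def)
  have bagD: "B ! (d ! h - 2) \<in> set B \<and> d ! h < length B + 2" if "h < r" "2 \<le> d ! h" for h
  proof -
    have "d ! h < length B + 2" using bo that by (auto simp: bag_ok_def)
    moreover from this have "d ! h - 2 < length B" using that by auto
    ultimately show ?thesis by simp
  qed
  have \<psi>e: "\<psi> h = \<psi>1 h" if h: "h < r" and nz: "e ! h \<noteq> 0" for h
  proof (cases "2 \<le> d ! h")
    case True
    then have "keeps B B1 (d ! h) (e ! h)" using dj[OF h] by (auto simp: digit_join_def)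
    then have "2 \<le> e ! h" "B1 ! (e ! h - 2) = B ! (d ! h - 2)" using nz by (auto simp: keeps_def)
    moreover have "B1 ! (e ! h - 2) = \<psi>1 h" using e1[OF h nz] \<open>2 \<le> e ! h\<close> by (auto split: if_splits)
    ultimately show ?thesis using True by (simp add: \<psi>_def)
  qed (use nz in \<open>auto simp: \<psi>_def\<close>)
  have \<psi>f: "\<psi> h = \<psi>2 h" if h: "h < r" and nz: "f ! h \<noteq> 0" for h
  proof (cases "2 \<le> d ! h")
    case True
    then have "keeps B B2 (d ! h) (f ! h)" using dj[OF h] by (auto simp: digit_join_def)
    then have "2 \<le> f ! h" "B2 ! (f ! h - 2) = B ! (d ! h - 2)" using nz by (auto simp: keeps_def)
    moreover have "B2 ! (f ! h - 2) = \<psi>2 h" using f1[OF h nz] \<open>2 \<le> f ! h\<close> by (auto split: if_splits)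
    ultimately show ?thesis using True by (simp add: \<psi>_def)
  next
    case False
    then have "e ! h = 0" using dj[OF h] nz by (auto simp: digit_join_def)
    then show ?thesis using False by (simp add: \<psi>_def)
  qed
  have out: "\<psi> h \<notin> set B \<and> (e ! h \<noteq> 0 \<or> f ! h \<noteq> 0)" if h: "h < r" and d1: "d ! h = 1" for h
  proof -
    consider "forgets B B1 (e ! h)" | "forgets B B2 (f ! h)"
      using dj[OF h] d1 by (auto simp: digit_join_def)
    then show ?thesis
    proof cases
      case 1
      then have nz: "e ! h \<noteq> 0" by (auto simp: forgets_def)
      have "\<psi>1 h \<notin> set B"
        using 1 e1[OF h nz] sep(1) by (auto simp: forgets_def split: if_splits)
      then show ?thesis using \<psi>e[OF h nz] nz by simp
    next
      case 2
      then have nz: "f ! h \<noteq> 0" by (auto simp: forgets_def)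
      have "\<psi>2 h \<notin> set B"
        using 2 f1[OF h nz] sep(2) by (auto simp: forgets_def split: if_splits)
      then show ?thesis using \<psi>f[OF h nz] nz by simp
    qed
  qed
  \<comment> \<open>Whatever lies in \<open>V1\<close> is recorded by the first child. Together with
    its analogues for \<open>V2\<close> and the bag, this shows that two images in a common part
    were also examined together.\<close>
  have inV1: "e ! h \<noteq> 0" if h: "h < r" and d: "d ! h \<noteq> 0" and v: "\<psi> h \<in> V1" for h
  proof (cases "d ! h = 1")
    case True
    show ?thesis
    proof
      assume "e ! h = 0"
      then have nz: "f ! h \<noteq> 0" using out[OF h True] by simp
      then have "\<psi> h \<in> V2" using \<psi>f[OF h nz] f1[OF h nz] by simp
      then show False using v sep(3) out[OF h True] by blast
    qed
  next
    case False
    then have 2: "2 \<le> d ! h" using d by linarith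
    have "\<psi> h \<in> set B1" "\<psi> h = B ! (d ! h - 2)"
      using bagD[OF h 2] sep(1) v 2 by (auto simp: \<psi>_def)
    then show ?thesis using dj[OF h] 2 by (auto simp: digit_join_def keeps_def)
  qed
  have inV2: "f ! h \<noteq> 0" if h: "h < r" and d: "d ! h \<noteq> 0" and v: "\<psi> h \<in> V2" for h
  proof (cases "d ! h = 1")
    case True
    show ?thesis
    proof
      assume "f ! h = 0"
      then have nz: "e ! h \<noteq> 0" using out[OF h True] by simp
      then have "\<psi> h \<in> V1" using \<psi>e[OF h nz] e1[OF h nz] by simp
      then show False using v sep(3) out[OF h True] by blast
    qed
  next
    case False
    then have 2: "2 \<le> d ! h" using d by linarith
    have "\<psi> h \<in> set B2" "\<psi> h = B ! (d ! h - 2)"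
      using bagD[OF h 2] sep(2) v 2 by (auto simp: \<psi>_def)
    then show ?thesis using dj[OF h] 2 by (auto simp: digit_join_def keeps_def)
  qed
  have inB: "2 \<le> d ! h" if "h < r" "d ! h \<noteq> 0" "\<psi> h \<in> set B" for h
    using out[of h] that by (cases "d ! h = 1") auto
  have mem: "\<psi> h \<in> V \<and> \<chi> (\<psi> h) = c" if h: "h < r" and d: "d ! h \<noteq> 0" for h
  proof (cases "d ! h = 1")
    case True
    then consider "e ! h \<noteq> 0" | "f ! h \<noteq> 0" using out[OF h] by blast
    then show ?thesis using \<psi>e[OF h] e1[OF h] \<psi>f[OF h] f1[OF h] V_eq by cases auto
  next
    case False
    then have "2 \<le> d ! h" using d by linarith
    then show ?thesis using bagD[OF h] col[OF h] V_eq by (auto simp: \<psi>_def)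
  qed
  show ?thesis unfolding occurs_def
  proof (intro conjI exI[of _ \<psi>] allI impI)
    fix h assume h: "h < r" "d ! h \<noteq> 0"
    show "\<psi> h \<in> V" "\<chi> (\<psi> h) = c" using mem[OF h] by auto
    show "if d ! h = 1 then \<psi> h \<notin> set B else d ! h < length B + 2 \<and> B ! (d ! h - 2) = \<psi> h"
    proof (cases "d ! h = 1")
      case True then show ?thesis using out[OF h(1)] by simp
    next
      case False
      then have "2 \<le> d ! h" using h by linarith
      then show ?thesis using bagD[OF h(1)] by (auto simp: \<psi>_def)
    qed
  next
    fix h h' assume h: "h < r" "h' < r" and n: "h \<noteq> h' \<and> d ! h \<noteq> 0 \<and> d ! h' \<noteq> 0"
    \<comment> \<open>\<open>P\<close> says that the two pattern vertices are seen together by one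
      child or by the bag, where their distinctness and adjacency have been tested already.\<close>
    define P where "P \<longleftrightarrow> e ! h \<noteq> 0 \<and> e ! h' \<noteq> 0 \<or> f ! h \<noteq> 0 \<and> f ! h' \<noteq> 0 \<or> 2 \<le> d ! h \<and> 2 \<le> d ! h'"
    have P: "\<psi> h \<noteq> \<psi> h' \<and> (F h h' \<longleftrightarrow> E (\<psi> h) (\<psi> h'))" if p: P
    proof -
      consider (e) "e ! h \<noteq> 0" "e ! h' \<noteq> 0" | (f) "f ! h \<noteq> 0" "f ! h' \<noteq> 0" | (B) "2 \<le> d ! h" "2 \<le> d ! h'"
        using p unfolding P_def by blast
      then show ?thesis
      proof cases
        case e then show ?thesis using e2[OF h] n \<psi>e h by auto
      next
        case f then show ?thesis using f2[OF h] n \<psi>f h by auto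
      next
        case B
        have "d ! h \<noteq> d ! h'" "F h h' \<longleftrightarrow> E (B ! (d ! h - 2)) (B ! (d ! h' - 2))"
          using bo h n B by (auto simp: bag_ok_def)
        moreover have "B ! (d ! h - 2) \<noteq> B ! (d ! h' - 2)"
        proof
          assume "B ! (d ! h - 2) = B ! (d ! h' - 2)"
          moreover have "d ! h - 2 < length B" "d ! h' - 2 < length B"
            using bagD[OF h(1) B(1)] bagD[OF h(2) B(2)] B by auto
          ultimately have "d ! h - 2 = d ! h' - 2" using bags(3) nth_eq_iff_index_eq by blast
          then show False using B \<open>d ! h \<noteq> d ! h'\<close> by auto
        qed
        ultimately show ?thesis using B by (simp add: \<psi>_def)
      qed
    qed
    have tgt: P if "\<psi> h \<in> V1 \<and> \<psi> h' \<in> V1 \<or> \<psi> h \<in> V2 \<and> \<psi> h' \<in> V2 \<or> \<psi> h \<in> set B \<and> \<psi> h' \<in> set B"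
      using that inV1 inV2 inB h n unfolding P_def by metis
    \<comment> \<open>Equal images would trivially lie in a common part, so \<open>P\<close> would
      hold and separate them.\<close>
    show "\<psi> h \<noteq> \<psi> h'"
    proof
      assume eq: "\<psi> h = \<psi> h'"
      have "\<psi> h \<in> V" using mem h n by blast
      then have P using tgt eq V_eq by auto
      then show False using P eq by blast
    qed
    \<comment> \<open>\<open>P\<close> follows from \<open>joins\<close> for a pattern edge and from
      \<open>edges\<close> for a host edge.\<close>
    show "F h h' \<longleftrightarrow> E (\<psi> h) (\<psi> h')"
    proof
      assume "F h h'"
      then have P using j h n unfolding joins_def P_def by metis
      then show "E (\<psi> h) (\<psi> h')" using P \<open>F h h'\<close> by blast
    next
      assume "E (\<psi> h) (\<psi> h')"
      then have P using edges mem h n tgt by blast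
      then show "F h h'" using P \<open>E (\<psi> h) (\<psi> h')\<close> by blast
    qed
  qed (fact len)
qed

end

section \<open>Copies of the pattern, and states as numbers\<close>

definition has_copy ::
  "(nat \<Rightarrow> nat \<Rightarrow> bool) \<Rightarrow> ('a \<Rightarrow> 'a \<Rightarrow> bool) \<Rightarrow> nat \<Rightarrow> 'a set \<Rightarrow> bool" where
  "has_copy F E r S \<longleftrightarrow> (\<exists>\<psi>. (\<forall>h<r. \<psi> h \<in> S) \<and> inj_on \<psi> {..<r} \<and>
     (\<forall>h<r. \<forall>h'<r. h \<noteq> h' \<longrightarrow> (F h h' \<longleftrightarrow> E (\<psi> h) (\<psi> h'))))"

lemma has_copy_mono: "has_copy F E r A \<Longrightarrow> A \<subseteq> B \<Longrightarrow> has_copy F E r B"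
  unfolding has_copy_def by blast

primrec code :: "nat \<Rightarrow> nat list \<Rightarrow> nat" where
  "code K [] = 0"
| "code K (x # xs) = x + K * code K xs"

lemma code_less:
  assumes "\<forall>x\<in>set d. x < K"
  shows "code K d < (K::nat) ^ length d"
  using assms
proof (induction d)
  case (Cons x d)
  then have "code K d + 1 \<le> K ^ length d" by auto
  then have "K * (code K d + 1) \<le> K * K ^ length d" by (rule mult_le_mono2)
  then show ?case using Cons.prems by simp
qed simp

lemma code_inj:
  assumes "length d = length e" "\<forall>x\<in>set d. x < K" "\<forall>x\<in>set e. x < K"
    "code K d = code K e"
  shows "d = e"
  using assms
proof (induction d e rule: list_induct2)
  case (Cons x d y e)
  then have xy: "x < K" "y < K" and eq: "x + K * code K d = y + K * code K e"
    by auto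
  have "x = y" using arg_cong[OF eq, of "\<lambda>z. z mod K"] xy by simp
  moreover have "code K d = code K e"
    using arg_cong[OF eq, of "\<lambda>z. z div K"] xy by simp
  ultimately show ?case using Cons by simp
qed simp

lemma code_zeros: "code K (replicate n 0) = (0::nat)"
  by (induction n) auto

context pattern begin

definition digit_lists :: "nat \<Rightarrow> nat list set" where
  "digit_lists K = {d. length d = r \<and> (\<forall>x\<in>set d. x < K)}"

definition represents :: "nat \<Rightarrow> nat set \<Rightarrow> nat list \<Rightarrow> (nat \<Rightarrow> nat) \<Rightarrow> nat \<Rightarrow> bool" where
  "represents K V B \<chi> w \<longleftrightarrow>
     (\<forall>c<2. \<forall>d\<in>digit_lists K. bit w (2 * code K d + c) \<longleftrightarrow> occurs V B \<chi> c d)"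

text \<open>Colourings are total functions, so that the same colouring can be considered at several
  nodes; their values outside \<open>V\<close> have no influence on
  \<open>represents\<close>.\<close>

definition table_ok :: "nat \<Rightarrow> nat \<Rightarrow> nat set \<Rightarrow> nat list \<Rightarrow> (nat \<Rightarrow> bool) \<Rightarrow> bool" where
  "table_ok K N V B T \<longleftrightarrow>
     (\<forall>w<N. T w \<longrightarrow> (\<exists>\<chi>. (\<forall>x. \<chi> x < 2) \<and> represents K V B \<chi> w)) \<and>
     (\<forall>\<chi>. (\<forall>x. \<chi> x < 2) \<longrightarrow> (\<exists>w<N. T w \<and> represents K V B \<chi> w))"

text \<open>
  The bit with number \<open>2 * (p + 2) + c\<close> belongs to the embedding of pattern vertex \<open>0\<close> alone, as
  \<open>B ! p\<close>, and so tells whether \<open>B ! p\<close> has colour \<open>c\<close>.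
\<close>

definition entry ::
  "nat \<Rightarrow> nat list \<Rightarrow> nat list \<Rightarrow> nat list \<Rightarrow> nat \<Rightarrow> nat \<Rightarrow> nat \<Rightarrow> nat \<Rightarrow> nat list \<Rightarrow> bool" where
  "entry K B B1 B2 w w1 w2 c d \<longleftrightarrow>
     bag_ok B d \<and> (\<forall>h<r. 2 \<le> d ! h \<longrightarrow> bit w (2 * (d ! h) + c)) \<and>
     (\<exists>e\<in>digit_lists K. \<exists>f\<in>digit_lists K. bit w1 (2 * code K e + c) \<and>
        bit w2 (2 * code K f + c) \<and> joins B B1 B2 d e f)"

text \<open>A check of \<open>w\<close> rather than a computation: \<open>entry\<close> reads the
  colours of the bag vertices from \<open>w\<close> itself. The first condition gives each bag
  vertex exactly one colour, the second ties all bits to the states of the children.\<close>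

definition transition ::
  "nat \<Rightarrow> nat list \<Rightarrow> nat list \<Rightarrow> nat list \<Rightarrow> nat \<Rightarrow> nat \<Rightarrow> nat \<Rightarrow> bool" where
  "transition K B B1 B2 w w1 w2 \<longleftrightarrow>
     (\<forall>x<K. 2 \<le> x \<and> x < length B + 2 \<longrightarrow> bit w (2 * x) \<noteq> bit w (2 * x + 1)) \<and>
     (\<forall>c<2. \<forall>d\<in>digit_lists K. bit w (2 * code K d + c) \<longleftrightarrow> entry K B B1 B2 w w1 w2 c d)"

definition single :: "nat \<Rightarrow> nat list" where
  "single x = x # replicate (r - 1) 0"

lemma single_simps:
  "length (single x) = r" "h < r \<Longrightarrow> single x ! h = (if h = 0 then x else 0)"
  "code K (single x) = x"
  "x < K \<Longrightarrow> single x \<in> digit_lists K"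
  using r_pos by (auto simp: single_def nth_Cons' code_zeros digit_lists_def)

lemma occurs_single:
  assumes "set B \<subseteq> V" "2 \<le> x" "x < length B + 2"
  shows "occurs V B \<chi> c (single x) \<longleftrightarrow> \<chi> (B ! (x - 2)) = c"
proof
  assume "occurs V B \<chi> c (single x)"
  then obtain \<psi> where "\<forall>h<r. single x ! h \<noteq> 0 \<longrightarrow> \<psi> h \<in> V \<and> \<chi> (\<psi> h) = c \<and>
     (if single x ! h = 1 then \<psi> h \<notin> set B else single x ! h < length B + 2 \<and> B ! (single x ! h - 2) = \<psi> h)"
    unfolding occurs_def by blast
  from this[rule_format, of 0] show "\<chi> (B ! (x - 2)) = c"
    using r_pos assms by (auto simp: single_simps)
next
  assume "\<chi> (B ! (x - 2)) = c"
  moreover have "x - 2 < length B" using assms by auto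
  then have "B ! (x - 2) \<in> V" using assms by force
  ultimately show "occurs V B \<chi> c (single x)" unfolding occurs_def
    using assms by (intro conjI exI[of _ "\<lambda>_. B ! (x - 2)"]) (auto simp: single_simps split: if_splits)
qed

text \<open>One bit is used for each pair of a colour and a digit list. Codes are below
  \<open>K ^ r\<close>, so \<open>2 * K ^ r\<close> bits suffice.\<close>

lemma represents_exists:
  "\<exists>w < 2 ^ (2 * K ^ r). represents K V B \<chi> w"
proof -
  let ?L = "2 * K ^ r"
  \<comment> \<open>\<open>Q\<close> decodes the bit number \<open>m\<close>; by
    \<open>code_inj\<close> at most one pair belongs to it.\<close>
  define Q where "Q m \<longleftrightarrow> (\<exists>c<2. \<exists>d\<in>digit_lists K. m = 2 * code K d + c \<and> occurs V B \<chi> c d)" for m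
  define w :: nat where "w = horner_sum of_bool 2 (map Q [0..<?L])"
  have "w < 2 ^ ?L" using horner_sum_bound[of "map Q [0..<?L]"] by (simp add: w_def)
  moreover have "bit w (2 * code K d + c) \<longleftrightarrow> occurs V B \<chi> c d"
    if c: "c < 2" and d: "d \<in> digit_lists K" for c d
  proof -
    have "code K d < K ^ r" using d code_less[of d K] by (auto simp: digit_lists_def)
    then have "2 * code K d + c < ?L" using c by linarith
    then have "bit w (2 * code K d + c) \<longleftrightarrow> Q (2 * code K d + c)"
      by (simp add: w_def bit_horner_sum_bit_iff del: upt_Suc)
    also have "\<dots> \<longleftrightarrow> occurs V B \<chi> c d"
    proof
      assume "Q (2 * code K d + c)"
      then obtain c' d' where q: "c' < 2" "d' \<in> digit_lists K"
        "2 * code K d + c = 2 * code K d' + c'" "occurs V B \<chi> c' d'"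
        unfolding Q_def by blast
      have "c = c'" "code K d = code K d'" using q(1,3) c by presburger+
      then show "occurs V B \<chi> c d"
        using code_inj[of d d' K] q d by (auto simp: digit_lists_def)
    qed (use c d in \<open>auto simp: Q_def\<close>)
    finally show ?thesis .
  qed
  ultimately show ?thesis unfolding represents_def by blast
qed

text \<open>In the empty part only the list of zeros occurs, for either colour. Its code is
  \<open>0\<close>, which accounts for the bits \<open>0\<close> and \<open>1\<close>.\<close>

lemma table_ok_empty:
  assumes "0 < K" "3 < N"
  shows "table_ok K N {} [] (\<lambda>w. w = 3)"
proof -
  have "represents K {} [] \<chi> 3" for \<chi>
    unfolding represents_def
  proof (intro allI impI ballI)
    fix c d assume c: "c < (2::nat)" and d: "d \<in> digit_lists K"
    have "(3::nat) = mask 2" by (simp add: mask_eq_exp_minus_1)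
    then have b: "bit (3::nat) m \<longleftrightarrow> m < 2" for m by (simp only: bit_mask_iff) simp
    have "code K d = 0 \<longleftrightarrow> (\<forall>x\<in>set d. x = 0)"
      using assms(1) by (induction d) auto
    also have "\<dots> \<longleftrightarrow> (\<forall>h<r. d ! h = 0)" using d by (auto simp: digit_lists_def all_set_conv_all_nth)
    also have "\<dots> \<longleftrightarrow> occurs {} [] \<chi> c d" using d by (auto simp: digit_lists_def occurs_def)
    finally show "bit (3::nat) (2 * code K d + c) \<longleftrightarrow> occurs {} [] \<chi> c d"
      unfolding b using c by linarith
  qed
  then show ?thesis using assms unfolding table_ok_def by (auto intro!: exI[of _ "\<lambda>_. 0"])
qed

end

section \<open>Transitions between states\<close>

context node_step begin

lemma represents_transition:
  assumes K: "length B + 2 \<le> K" "length B1 + 2 \<le> K" "length B2 + 2 \<le> K" and \<chi>: "\<And>x. \<chi> x < 2"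
    and w: "represents K V B \<chi> w" "represents K V1 B1 \<chi> w1" "represents K V2 B2 \<chi> w2"
  shows "transition K B B1 B2 w w1 w2"
proof -
  \<comment> \<open>The code of \<open>single x\<close> is \<open>x\<close>, so this bit is just the
    colour bit of the bag vertex at position \<open>x - 2\<close>.\<close>
  have col: "bit w (2 * x + c) \<longleftrightarrow> \<chi> (B ! (x - 2)) = c" if "2 \<le> x" "x < length B + 2" "c < 2" for x c
  proof -
    have "bit w (2 * code K (single x) + c) \<longleftrightarrow> occurs V B \<chi> c (single x)"
      using w(1) that K single_simps(4)[of x K] unfolding represents_def by auto
    moreover have "set B \<subseteq> V" using V_eq by blast
    ultimately show ?thesis using that by (simp add: occurs_single single_simps)
  qed
  \<comment> \<open>Lists that occur have digits below the bag size plus two, so restricting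
    \<open>e\<close> and \<open>f\<close> to \<open>digit_lists K\<close> loses nothing.\<close>
  have dl: "e \<in> digit_lists K" if "occurs V' B' \<chi> c e" "length B' + 2 \<le> K" for V' B' c e
    using that occurs_digit_less[OF that(1)] by (fastforce simp: digit_lists_def occurs_def)
  show ?thesis unfolding transition_def
  proof (intro conjI allI impI ballI)
    fix x assume "x < K" "2 \<le> x \<and> x < length B + 2"
    then have "bit w (2 * x + 0) \<longleftrightarrow> \<chi> (B ! (x - 2)) = 0" "bit w (2 * x + 1) \<longleftrightarrow> \<chi> (B ! (x - 2)) = 1"
      using col[of x 0] col[of x 1] by auto
    then show "bit w (2 * x) \<noteq> bit w (2 * x + 1)" using \<chi>[of "B ! (x - 2)"] by auto
  next
    fix c d assume c: "c < (2::nat)" and d: "d \<in> digit_lists K"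
    have len: "length d = r" using d by (simp add: digit_lists_def)
    have "bit w (2 * code K d + c) \<longleftrightarrow> occurs V B \<chi> c d"
      using w(1) c d by (auto simp: represents_def)
    also have "\<dots> \<longleftrightarrow> bag_ok B d \<and> (\<forall>h<r. 2 \<le> d ! h \<longrightarrow> \<chi> (B ! (d ! h - 2)) = c) \<and>
      (\<exists>e f. occurs V1 B1 \<chi> c e \<and> occurs V2 B2 \<chi> c f \<and> joins B B1 B2 d e f)"
      using occurs_decompose[of \<chi> c d] occurs_compose[OF len, of \<chi> c] by blast
    also have "\<dots> \<longleftrightarrow> bag_ok B d \<and> (\<forall>h<r. 2 \<le> d ! h \<longrightarrow> bit w (2 * (d ! h) + c)) \<and>
      (\<exists>e f. occurs V1 B1 \<chi> c e \<and> occurs V2 B2 \<chi> c f \<and> joins B B1 B2 d e f)"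
      using col c by (auto simp: bag_ok_def)
    also have "(\<exists>e f. occurs V1 B1 \<chi> c e \<and> occurs V2 B2 \<chi> c f \<and> joins B B1 B2 d e f) \<longleftrightarrow>
      (\<exists>e\<in>digit_lists K. \<exists>f\<in>digit_lists K. bit w1 (2 * code K e + c) \<and>
           bit w2 (2 * code K f + c) \<and> joins B B1 B2 d e f)"
      using w(2,3) c dl K unfolding represents_def by blast
    finally show "bit w (2 * code K d + c) \<longleftrightarrow> entry K B B1 B2 w w1 w2 c d" unfolding entry_def .
  qed
qed

text \<open>The states of the children may stem from different colourings, which must be glued. They
  agree on the bag: if \<open>w\<close> gives \<open>x\<close> the colour \<open>c\<close>, then the
  entry for the list that places only pattern vertex \<open>0\<close>, at \<open>x\<close>, requires
  an embedding of colour \<open>c\<close> below each child having \<open>x\<close> in its bag, so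
  the colouring of that child gives \<open>x\<close> the colour \<open>c\<close> too. Outside the
  bag the two parts are disjoint.\<close>

lemma transition_represents:
  assumes K: "length B + 2 \<le> K" "length B1 + 2 \<le> K" "length B2 + 2 \<le> K"
    and \<chi>: "\<And>x. \<chi>1 x < 2" "\<And>x. \<chi>2 x < 2"
    and w: "represents K V1 B1 \<chi>1 w1" "represents K V2 B2 \<chi>2 w2"
    and tr: "transition K B B1 B2 w w1 w2"
  shows "\<exists>\<chi>. (\<forall>x. \<chi> x < 2) \<and> represents K V B \<chi> w"
proof -
  define idx where "idx x = (LEAST p. p < length B \<and> B ! p = x)" for x
  have idx: "idx x < length B" "B ! idx x = x" if "x \<in> set B" for x
    using least_index[OF that] by (auto simp: idx_def)
  define \<chi> where "\<chi> x = (if x \<in> set B then (if bit w (2 * (idx x + 2) + 1) then 1 else 0)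
    else if x \<in> V1 then \<chi>1 x else \<chi>2 x)" for x
  have two: "\<chi> x < 2" for x using assms by (auto simp: \<chi>_def)
  have col: "bit w (2 * x + c) \<longleftrightarrow> \<chi> (B ! (x - 2)) = c" if x: "2 \<le> x" "x < length B + 2" and c: "c < 2" for x c
  proof -
    have p: "x - 2 < length B" using x by auto
    have "idx (B ! (x - 2)) + 2 = x"
      using x idx[of "B ! (x - 2)"] p nth_eq_iff_index_eq[OF bags(3)] by fastforce
    then have "\<chi> (B ! (x - 2)) = (if bit w (2 * x + 1) then 1 else 0)"
      using p x by (simp add: \<chi>_def)
    moreover have "bit w (2 * x) \<noteq> bit w (2 * x + 1)"
      using tr x K(1) unfolding transition_def by (meson less_le_trans)
    ultimately show ?thesis using c by (auto simp: less_2_cases_iff)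
  qed
  have joined: "\<exists>e\<in>digit_lists K. \<exists>f\<in>digit_lists K. bit w1 (2 * code K e + \<chi> x) \<and>
           bit w2 (2 * code K f + \<chi> x) \<and> joins B B1 B2 (single (idx x + 2)) e f" if "x \<in> set B" for x
  proof -
    have s: "single (idx x + 2) \<in> digit_lists K"
      using idx[OF that] K by (intro single_simps) auto
    have "bit w (2 * code K (single (idx x + 2)) + \<chi> x)"
      using col[of "idx x + 2" "\<chi> x"] two[of x] idx[OF that] by (simp add: single_simps)
    then show ?thesis using tr s two[of x] unfolding transition_def entry_def by blast
  qed
  have eq1: "\<chi>1 x = \<chi> x" if x: "x \<in> V1" for x
  proof (cases "x \<in> set B")
    case True
    then have B1: "x \<in> set B1" using x sep by blast
    from joined[OF True] obtain e f where ef: "e \<in> digit_lists K"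
      "bit w1 (2 * code K e + \<chi> x)" "joins B B1 B2 (single (idx x + 2)) e f" by blast
    have "digit_join B B1 B2 (single (idx x + 2) ! 0) (e ! 0) (f ! 0)"
      using ef(3) r_pos by (auto simp: joins_def)
    then have "keeps B B1 (idx x + 2) (e ! 0)"
      using r_pos by (auto simp: single_simps digit_join_def)
    then have k: "2 \<le> e ! 0" "B1 ! (e ! 0 - 2) = x" using B1 idx[OF True] by (auto simp: keeps_def)
    have "occurs V1 B1 \<chi>1 (\<chi> x) e" using w(1) ef two[of x] by (auto simp: represents_def)
    then obtain \<psi> where "\<forall>h<r. e ! h \<noteq> 0 \<longrightarrow> \<psi> h \<in> V1 \<and> \<chi>1 (\<psi> h) = \<chi> x \<and>
        (if e ! h = 1 then \<psi> h \<notin> set B1 else e ! h < length B1 + 2 \<and> B1 ! (e ! h - 2) = \<psi> h)"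
      unfolding occurs_def by blast
    from this[rule_format, of 0] k r_pos show ?thesis by (auto split: if_splits)
  qed (use x in \<open>auto simp: \<chi>_def\<close>)
  have eq2: "\<chi>2 x = \<chi> x" if x: "x \<in> V2" for x
  proof (cases "x \<in> set B")
    case True
    then have B2: "x \<in> set B2" using x sep by blast
    from joined[OF True] obtain e f where ef: "f \<in> digit_lists K"
      "bit w2 (2 * code K f + \<chi> x)" "joins B B1 B2 (single (idx x + 2)) e f" by blast
    have "digit_join B B1 B2 (single (idx x + 2) ! 0) (e ! 0) (f ! 0)"
      using ef(3) r_pos by (auto simp: joins_def)
    then have "keeps B B2 (idx x + 2) (f ! 0)"
      using r_pos by (auto simp: single_simps digit_join_def)
    then have k: "2 \<le> f ! 0" "B2 ! (f ! 0 - 2) = x" using B2 idx[OF True] by (auto simp: keeps_def)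
    have "occurs V2 B2 \<chi>2 (\<chi> x) f" using w(2) ef two[of x] by (auto simp: represents_def)
    then obtain \<psi> where "\<forall>h<r. f ! h \<noteq> 0 \<longrightarrow> \<psi> h \<in> V2 \<and> \<chi>2 (\<psi> h) = \<chi> x \<and>
        (if f ! h = 1 then \<psi> h \<notin> set B2 else f ! h < length B2 + 2 \<and> B2 ! (f ! h - 2) = \<psi> h)"
      unfolding occurs_def by blast
    from this[rule_format, of 0] k r_pos show ?thesis by (auto split: if_splits)
  next
    case False
    then have "x \<notin> V1" using sep x by blast
    then show ?thesis using False by (simp add: \<chi>_def)
  qed
  have w': "represents K V1 B1 \<chi> w1" "represents K V2 B2 \<chi> w2"
    using w occurs_cong[of V1 \<chi>1 \<chi>] occurs_cong[of V2 \<chi>2 \<chi>] eq1 eq2 by (auto simp: represents_def)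
  have dl: "e \<in> digit_lists K" if "occurs V' B' \<chi> c e" "length B' + 2 \<le> K" for V' B' c e
    using that occurs_digit_less[OF that(1)] by (fastforce simp: digit_lists_def occurs_def)
  have "represents K V B \<chi> w" unfolding represents_def
  proof (intro allI impI ballI)
    fix c d assume c: "c < (2::nat)" and d: "d \<in> digit_lists K"
    have len: "length d = r" using d by (simp add: digit_lists_def)
    have "bit w (2 * code K d + c) \<longleftrightarrow>
        bag_ok B d \<and> (\<forall>h<r. 2 \<le> d ! h \<longrightarrow> bit w (2 * (d ! h) + c)) \<and>
        (\<exists>e\<in>digit_lists K. \<exists>f\<in>digit_lists K. bit w1 (2 * code K e + c) \<and>
           bit w2 (2 * code K f + c) \<and> joins B B1 B2 d e f)"
      using tr c d unfolding transition_def entry_def by blast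
    also have "(\<exists>e\<in>digit_lists K. \<exists>f\<in>digit_lists K. bit w1 (2 * code K e + c) \<and>
           bit w2 (2 * code K f + c) \<and> joins B B1 B2 d e f) \<longleftrightarrow>
      (\<exists>e f. occurs V1 B1 \<chi> c e \<and> occurs V2 B2 \<chi> c f \<and> joins B B1 B2 d e f)"
      using w' c dl K unfolding represents_def by blast
    also have "bag_ok B d \<and> (\<forall>h<r. 2 \<le> d ! h \<longrightarrow> bit w (2 * (d ! h) + c)) \<and>
      (\<exists>e f. occurs V1 B1 \<chi> c e \<and> occurs V2 B2 \<chi> c f \<and> joins B B1 B2 d e f) \<longleftrightarrow>
      bag_ok B d \<and> (\<forall>h<r. 2 \<le> d ! h \<longrightarrow> \<chi> (B ! (d ! h - 2)) = c) \<and>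
      (\<exists>e f. occurs V1 B1 \<chi> c e \<and> occurs V2 B2 \<chi> c f \<and> joins B B1 B2 d e f)"
      using col c by (auto simp: bag_ok_def)
    also have "\<dots> \<longleftrightarrow> occurs V B \<chi> c d"
      using occurs_decompose[of \<chi> c d] occurs_compose[OF len, of \<chi> c] by blast
    finally show "bit w (2 * code K d + c) \<longleftrightarrow> occurs V B \<chi> c d" .
  qed
  then show ?thesis using two by blast
qed

text \<open>Soundness glues the colourings of the two children; completeness uses one colouring at
  all three nodes.\<close>

lemma table_ok_step:
  assumes K: "length B + 2 \<le> K" "length B1 + 2 \<le> K" "length B2 + 2 \<le> K"
    and N: "N = 2 ^ (2 * K ^ r)"
    and T: "table_ok K N V1 B1 T1" "table_ok K N V2 B2 T2"
    and step: "\<And>w. w < N \<Longrightarrow> T w \<longleftrightarrow> (\<exists>w1<N. \<exists>w2<N. T1 w1 \<and> T2 w2 \<and> transition K B B1 B2 w w1 w2)"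
  shows "table_ok K N V B T"
  unfolding table_ok_def
proof (intro conjI allI impI)
  fix w assume "w < N" "T w"
  then obtain w1 w2 where w: "w1 < N" "w2 < N" "T1 w1" "T2 w2" "transition K B B1 B2 w w1 w2"
    using step by blast
  then obtain \<chi>1 \<chi>2 where "\<forall>x. \<chi>1 x < 2" "represents K V1 B1 \<chi>1 w1" "\<forall>x. \<chi>2 x < 2" "represents K V2 B2 \<chi>2 w2"
    using T unfolding table_ok_def by meson
  then show "\<exists>\<chi>. (\<forall>x. \<chi> x < 2) \<and> represents K V B \<chi> w"
    using transition_represents[OF K] w(5) by blast
next
  fix \<chi> :: "nat \<Rightarrow> nat" assume \<chi>: "\<forall>x. \<chi> x < 2"
  obtain w where w: "w < N" "represents K V B \<chi> w" using represents_exists N by blast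
  obtain w1 where "w1 < N" "T1 w1" "represents K V1 B1 \<chi> w1" using T(1) \<chi> unfolding table_ok_def by blast
  moreover obtain w2 where "w2 < N" "T2 w2" "represents K V2 B2 \<chi> w2" using T(2) \<chi> unfolding table_ok_def by blast
  ultimately show "\<exists>w<N. T w \<and> represents K V B \<chi> w"
    using represents_transition[OF K] \<chi> w step by blast
qed

end

section \<open>Acceptance at the root\<close>

context pattern begin

definition accepts :: "nat \<Rightarrow> nat \<Rightarrow> bool" where
  "accepts K w \<longleftrightarrow> (\<forall>c<2. \<forall>d\<in>digit_lists K. (\<forall>h<r. d ! h \<noteq> 0) \<longrightarrow> \<not> bit w (2 * code K d + c))"

lemma accepts_iff:
  assumes K: "length B + 2 \<le> K" and w: "represents K V B \<chi> w"
  shows "accepts K w \<longleftrightarrow> (\<forall>c<2. \<not> has_copy F E r {x \<in> V. \<chi> x = c})"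
proof -
  have "(\<exists>d\<in>digit_lists K. (\<forall>h<r. d ! h \<noteq> 0) \<and> occurs V B \<chi> c d) \<longleftrightarrow>
    has_copy F E r {x \<in> V. \<chi> x = c}" (is "?l \<longleftrightarrow> ?r") for c
  proof
    assume ?l
    then obtain d where "\<forall>h<r. d ! h \<noteq> 0" "occurs V B \<chi> c d" by blast
    then obtain \<psi> where "\<forall>h<r. \<psi> h \<in> V \<and> \<chi> (\<psi> h) = c"
      "\<forall>h<r. \<forall>h'<r. h \<noteq> h' \<longrightarrow> \<psi> h \<noteq> \<psi> h' \<and> (F h h' \<longleftrightarrow> E (\<psi> h) (\<psi> h'))"
      unfolding occurs_def by blast
    moreover from this(2) have "inj_on \<psi> {..<r}" unfolding inj_on_def by blast
    ultimately show ?r unfolding has_copy_def by blast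
  next
    assume ?r
    then obtain \<psi> where \<psi>: "\<forall>h<r. \<psi> h \<in> V \<and> \<chi> (\<psi> h) = c" "inj_on \<psi> {..<r}"
      "\<forall>h<r. \<forall>h'<r. h \<noteq> h' \<longrightarrow> (F h h' \<longleftrightarrow> E (\<psi> h) (\<psi> h'))"
      unfolding has_copy_def by blast
    \<comment> \<open>As no entry of \<open>replicate r 1\<close> is \<open>0\<close>, no image is
      discarded and these are the digits of \<open>\<psi>\<close> itself relative to
      \<open>B\<close>.\<close>
    let ?d = "map (child_digit V B (replicate r 1) \<psi>) [0..<r]"
    have "occurs V B \<chi> c ?d"
      using \<psi> by (intro occurs_child) (auto simp: inj_on_def)
    moreover have "?d \<in> digit_lists K"
      using occurs_digit_less[OF calculation] K by (fastforce simp: digit_lists_def)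
    moreover have "\<forall>h<r. ?d ! h \<noteq> 0" using \<psi> by (auto simp: child_digit_cases)
    ultimately show ?l by blast
  qed
  moreover have "accepts K w \<longleftrightarrow>
      \<not> (\<exists>c<2. \<exists>d\<in>digit_lists K. (\<forall>h<r. d ! h \<noteq> 0) \<and> occurs V B \<chi> c d)"
    using w unfolding accepts_def represents_def by meson
  ultimately show ?thesis by simp
qed

lemma table_ok_accepts:
  assumes K: "length B + 2 \<le> K" and T: "table_ok K N V B T"
  shows "(\<exists>w<N. T w \<and> accepts K w) \<longleftrightarrow>
    (\<exists>\<chi>::nat \<Rightarrow> nat. (\<forall>x. \<chi> x < 2) \<and> (\<forall>c<2. \<not> has_copy F E r {x \<in> V. \<chi> x = c}))" (is "?l \<longleftrightarrow> ?r")
proof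
  assume ?l
  then obtain w \<chi> where "accepts K w" "\<forall>x. \<chi> x < 2" "represents K V B \<chi> w"
    using T unfolding table_ok_def by blast
  then show ?r using accepts_iff[OF K] by blast
next
  assume ?r
  then obtain \<chi> :: "nat \<Rightarrow> nat" where \<chi>: "\<forall>x. \<chi> x < 2" "\<forall>c<2. \<not> has_copy F E r {x \<in> V. \<chi> x = c}"
    by blast
  then obtain w where "w < N" "T w" "represents K V B \<chi> w" using T unfolding table_ok_def by blast
  then show ?l using accepts_iff[OF K] \<chi>(2) by blast
qed

end

section \<open>Rooted trees and tree decompositions\<close>

locale rooted_tree = pair_graph T for T :: "'i pair_pre_digraph" +
  fixes \<rho> :: 'i
  assumes tree: "undirected_tree T" and root: "\<rho> \<in> pverts T"
begin

definition child :: "('i \<times> 'i) set" where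
  "child = {(i, j). j \<in> children T \<rho> i}"

lemma arc_sym: "(i, j) \<in> parcs T \<Longrightarrow> (j, i) \<in> parcs T"
  using pair_sym_arcs by (auto simp: symmetric_def elim: symE)

lemma arc_verts: "(i, j) \<in> parcs T \<Longrightarrow> i \<in> pverts T \<and> j \<in> pverts T"
  using arc_fst_in_verts arc_snd_in_verts by force

lemma awalk_snoc:
  "awalk u (p @ [(i, j)]) v \<longleftrightarrow> awalk u p i \<and> (i, j) \<in> parcs T \<and> v = j"
proof -
  have "awalk u (p @ [(i, j)]) v \<longleftrightarrow> awalk u p (last (pawalk_verts u p)) \<and>
      (i, j) \<in> parcs T \<and> last (pawalk_verts u p) = i \<and> v = j"
    using arc_verts by (auto simp: awalk_simps)
  also have "\<dots> \<longleftrightarrow> awalk u p i \<and> (i, j) \<in> parcs T \<and> v = j" by auto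
  finally show ?thesis .
qed

lemma verts_snoc: "awalk u p i \<Longrightarrow> pawalk_verts u (p @ [(i, j)]) = pawalk_verts u p @ [j]"
proof (induction p arbitrary: u)
  case (Cons e p)
  then show ?case by (simp add: awalk_Cons_iff)
qed (simp add: awalk_Nil_iff)

lemma apath_snoc:
  "apath u (p @ [(i, j)]) v \<longleftrightarrow> apath u p i \<and> (i, j) \<in> parcs T \<and> v = j \<and> j \<notin> set (pawalk_verts u p)"
  unfolding apath_def awalk_snoc using verts_snoc[of u p i j] by auto

lemma child_iff:
  "(i, j) \<in> child \<longleftrightarrow> (\<exists>p. apath \<rho> p i \<and> (i, j) \<in> parcs T \<and> j \<notin> set (pawalk_verts \<rho> p))"
  by (simp add: child_def children_def apath_snoc)

lemma child_arc: "(i, j) \<in> child \<Longrightarrow> (i, j) \<in> parcs T"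
  by (auto simp: child_iff)

text \<open>Any other path from \<open>i\<close> to \<open>j\<close> has at least two arcs; closed
  by the arc back to \<open>i\<close>, it would be a cycle of length at least three.\<close>

lemma bridge:
  assumes "(i, j) \<in> parcs T" "apath i p j"
  shows "p = [(i, j)]"
proof (rule ccontr)
  assume ne: "p \<noteq> [(i, j)]"
  have ij: "i \<noteq> j" using assms(1) pair_no_loops by fastforce
  have aw: "awalk i p j" and d: "distinct (pawalk_verts i p)" using assms(2) by (auto simp: apath_def)
  have "p \<noteq> []" using aw ij by (auto simp: awalk_Nil_iff)
  moreover have "length p \<noteq> 1"
  proof
    assume "length p = 1"
    then obtain e where "p = [e]" by (cases p) auto
    then show False using aw ne by (cases e) (auto simp: awalk_simps)
  qed
  ultimately have len: "length p \<ge> 2" by (cases p) (auto simp: Suc_le_eq)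
  have aw': "awalk i (p @ [(j, i)]) i" unfolding awalk_snoc using aw assms(1) arc_sym by blast
  obtain xs where xs: "pawalk_verts i p = i # xs"
    using aw \<open>p \<noteq> []\<close> by (cases p) (auto simp: awalk_Cons_iff)
  have "distinct (tl (pawalk_verts i (p @ [(j, i)])))"
    using verts_snoc[OF aw, of i] d xs by simp
  then have "cycle (p @ [(j, i)])" unfolding cycle_def using aw' by blast
  then show False using tree len unfolding undirected_tree_def by force
qed

lemma reachable_apath:
  assumes "i \<in> pverts T"
  obtains p where "apath \<rho> p i"
proof -
  have "strongly_connected (with_proj T)"
    using symmetric_connected_imp_strongly_connected pair_sym_arcs tree
    by (auto simp: undirected_tree_def)
  then have "\<rho> \<rightarrow>\<^sup>*\<^bsub>with_proj T\<^esub> i" using assms root by (auto simp: strongly_connected_def)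
  then show ?thesis using that reachable_awalk apath_awalk_to_apath by blast
qed

lemma awalk_reverse:
  assumes "awalk u p v"
  shows "\<exists>q. awalk v q u \<and> set (pawalk_verts v q) = set (pawalk_verts u p)"
  using assms
proof (induction p arbitrary: v rule: rev_induct)
  case (snoc e p)
  obtain i j where e: "e = (i, j)" by (cases e)
  then have w: "awalk u p i" "(i, j) \<in> parcs T" "v = j" using snoc.prems by (auto simp: awalk_snoc)
  from snoc.IH[OF w(1)] obtain q where q: "awalk i q u" "set (pawalk_verts i q) = set (pawalk_verts u p)" by blast
  have "awalk v ((j, i) # q) u" using q w arc_sym by (simp add: awalk_Cons_iff)
  then show ?case using q w verts_snoc[OF w(1), of j] e by (intro exI[of _ "(j, i) # q"]) auto
qed (auto simp: awalk_Nil_iff intro!: exI[of _ "[]"])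

text \<open>Cutting cycles out of a walk adds no vertices. This turns a walk that avoids a vertex
  into a path that avoids it.\<close>

lemma awalk_avoiding_to_apath:
  assumes "awalk u p v"
  shows "\<exists>q. apath u q v \<and> set (pawalk_verts u q) \<subseteq> set (pawalk_verts u p)"
proof -
  have "set (pawalk_verts u (awalk_to_apath p)) \<subseteq> set (pawalk_verts u p)"
    using assms
  proof (induct rule: awalk_to_apath_induct)
    case (path p)
    then have "awalk_to_apath p = p" by (auto simp: awalk_to_apath.simps)
    then show ?case by simp
  next
    case (decomp p q r s)
    then have "awalk_to_apath p = awalk_to_apath (q @ s)" using step_awalk_to_apath by blast
    moreover obtain w where "p = q @ r @ s" "awalk u q w" "awalk w r w" "awalk w s v"
      using awalk_cyc_decompE[OF decomp(2,1,3)] by metis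
    then have "set (pawalk_verts u (q @ s)) \<subseteq> set (pawalk_verts u p)"
      using set_awalk_verts_append[of u q w s v] set_awalk_verts_append[of u q w "r @ s" v]
        set_awalk_verts_append[of w r w s v] by auto
    ultimately show ?case using decomp by auto
  qed
  then show ?thesis using apath_awalk_to_apath[OF assms] by blast
qed

text \<open>Going from \<open>i\<close> back to the root and on to \<open>i'\<close> avoids
  \<open>j\<close>. Shortened to a path and followed by the arc to \<open>j\<close>, this is a
  second path from \<open>i\<close> to \<open>j\<close>, contrary to \<open>bridge\<close>.\<close>

lemma unique_parent:
  assumes "(i, j) \<in> child" "(i', j) \<in> child"
  shows "i = i'"
proof (rule ccontr)
  assume ne: "i \<noteq> i'"
  from assms obtain p p' where p: "awalk \<rho> p i" "(i, j) \<in> parcs T" "j \<notin> set (pawalk_verts \<rho> p)"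
    and p': "awalk \<rho> p' i'" "(i', j) \<in> parcs T" "j \<notin> set (pawalk_verts \<rho> p')"
    by (auto simp: child_iff apath_def)
  obtain q where q: "awalk i q \<rho>" "set (pawalk_verts i q) = set (pawalk_verts \<rho> p)"
    using awalk_reverse[OF p(1)] by blast
  have "awalk i (q @ p') i'" using q p' by auto
  moreover have "j \<notin> set (pawalk_verts i (q @ p'))"
    using set_awalk_verts_append[OF q(1) p'(1)] q(2) p p' by auto
  ultimately obtain s where s: "apath i s i'" "j \<notin> set (pawalk_verts i s)"
    using awalk_avoiding_to_apath by blast
  then have "apath i (s @ [(i', j)]) j" using p' by (simp add: apath_snoc)
  then have "s @ [(i', j)] = [(i, j)]" by (rule bridge[OF p(2)])
  then show False using ne by auto
qed

lemma root_no_parent: "(i, \<rho>) \<notin> child"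
  using hd_in_awalk_verts(2) by (auto simp: child_iff)

text \<open>If \<open>b\<close> lies on the root path of \<open>a\<close>, then by
  \<open>bridge\<close> the rest of that path is the arc \<open>(b, a)\<close>; otherwise the path
  can be prolonged to \<open>b\<close>.\<close>

lemma arc_child:
  assumes "(a, b) \<in> parcs T"
  shows "(a, b) \<in> child \<or> (b, a) \<in> child"
proof -
  obtain p where p: "apath \<rho> p a" using reachable_apath arc_verts assms by blast
  show ?thesis
  proof (cases "b \<in> set (pawalk_verts \<rho> p)")
    case False
    then show ?thesis using p assms by (auto simp: child_iff)
  next
    case True
    then obtain q s where qs: "p = q @ s" "awalk \<rho> q b" "awalk b s a"
      using awalk_decomp p by (metis awalkI_apath)
    then have "apath \<rho> q b" "apath b s a" using p by (auto simp: apath_append_iff)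
    then have "s = [(b, a)]" using bridge arc_sym assms by blast
    then have "apath \<rho> (q @ [(b, a)]) a" using p qs by simp
    then have "(b, a) \<in> child" unfolding apath_snoc child_iff by blast
    then show ?thesis by blast
  qed
qed

lemma root_descends:
  assumes "i \<in> pverts T"
  shows "(\<rho>, i) \<in> child\<^sup>*"
proof -
  obtain p where "apath \<rho> p i" using reachable_apath assms by blast
  then show ?thesis
  proof (induction p arbitrary: i rule: rev_induct)
    case (snoc e p)
    obtain a b where e: "e = (a, b)" by (cases e)
    then have "apath \<rho> p a" "(a, i) \<in> child" using snoc.prems by (auto simp: apath_snoc child_iff)
    then show ?case using snoc.IH by (meson rtrancl.rtrancl_into_rtrancl)
  qed (simp add: apath_Nil_iff)
qed

lemma descendant_verts: "(i, j) \<in> child\<^sup>* \<Longrightarrow> i \<in> pverts T \<Longrightarrow> j \<in> pverts T"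
  by (induction rule: rtrancl_induct) (auto dest: child_arc arc_verts)

lemma comparable:
  assumes "(a, m) \<in> child\<^sup>*" "(b, m) \<in> child\<^sup>*"
  shows "(a, b) \<in> child\<^sup>* \<or> (b, a) \<in> child\<^sup>*"
proof -
  have "single_valued (child\<inverse>)" using unique_parent by (auto simp: single_valued_def)
  moreover have "(m, a) \<in> (child\<inverse>)\<^sup>*" "(m, b) \<in> (child\<inverse>)\<^sup>*" using assms by (auto simp: rtrancl_converse)
  ultimately have "(a, b) \<in> (child\<inverse>)\<^sup>* \<or> (b, a) \<in> (child\<inverse>)\<^sup>*"
    by (rule single_valued_confluent)
  then show ?thesis by (auto simp: rtrancl_converse)
qed

text \<open>A cycle through a node also passes through its unique parent, so it could be moved up to
  the root, which has no parent.\<close>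

lemma child_acyclic:
  assumes "i \<in> pverts T"
  shows "(i, i) \<notin> child\<^sup>+"
proof -
  have "(\<rho>, i) \<in> child\<^sup>*" using root_descends assms .
  then show ?thesis
  proof (induction rule: rtrancl_induct)
    case base
    then show ?case using root_no_parent by (meson tranclE)
  next
    case (step y z)
    show ?case
    proof
      assume "(z, z) \<in> child\<^sup>+"
      then obtain u where "(z, u) \<in> child\<^sup>*" "(u, z) \<in> child" by (meson tranclD2)
      then have "(z, y) \<in> child\<^sup>*" using unique_parent step(2) by blast
      then show False using step by (meson rtrancl_into_trancl2)
    qed
  qed
qed

text \<open>The arc between \<open>j\<close> and its parent is the only connection of the subtree of
  \<open>j\<close> to the rest of the tree, so a connected set meeting both sides contains both ends
  of this arc.\<close>

lemma separation:
  assumes S: "Digraph_Component.connected (with_proj T \<restriction> S)"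
    and m: "m \<in> S" "(j, m) \<in> child\<^sup>*" and x: "x \<in> S" "(j, x) \<notin> child\<^sup>*"
  shows "j \<in> S \<and> (\<exists>i. (i, j) \<in> child \<and> i \<in> S)"
proof (rule ccontr)
  assume con: "\<not> ?thesis"
  have "(m, x) \<in> rtrancl_on S ((arcs_ends (with_proj T \<restriction> S))\<^sup>s)"
    using S m x by (auto simp: connected_conv)
  then have "(j, x) \<in> child\<^sup>*"
  proof (induction rule: rtrancl_on_induct)
    case (step y z)
    then have "(y, z) \<in> parcs T \<or> (z, y) \<in> parcs T"
      by (auto simp: symcl_def arcs_ends_conv)
    then consider "(y, z) \<in> child" | "(z, y) \<in> child" using arc_child by blast
    then show ?case
    proof cases
      case 1 then show ?thesis using step by (meson rtrancl.rtrancl_into_rtrancl)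
    next
      case 2
      then have "y \<noteq> j" using con step by blast
      moreover have "(j, y) \<in> child\<^sup>*" using step by blast
      ultimately obtain u where "(j, u) \<in> child\<^sup>*" "(u, y) \<in> child" by (metis rtranclE)
      then show ?thesis using unique_parent 2 by blast
    qed
  qed (use m in blast)
  then show False using x by blast
qed

end

section \<open>The part of the graph below a node\<close>

locale rooted_decomposition = rooted_tree T \<rho> for T :: "'i pair_pre_digraph" and \<rho> +
  fixes G :: "'a pair_pre_digraph" and X :: "'i \<Rightarrow> 'a set"
  assumes decomposition: "tree_decomposition G T X" and G: "pair_graph G"
begin

definition below :: "'i \<Rightarrow> 'a set" where
  "below i = (\<Union>m \<in> {m. (i, m) \<in> child\<^sup>*}. X m)"

lemma below_unfold: "below i = X i \<union> (\<Union>j \<in> children T \<rho> i. below j)"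
proof -
  have "(i, m) \<in> child\<^sup>* \<longleftrightarrow> m = i \<or> (\<exists>j. (i, j) \<in> child \<and> (j, m) \<in> child\<^sup>*)" for m
    by (metis converse_rtranclE converse_rtrancl_into_rtrancl rtrancl.rtrancl_refl)
  then have "{m. (i, m) \<in> child\<^sup>*} = insert i (\<Union>j \<in> children T \<rho> i. {m. (j, m) \<in> child\<^sup>*})"
    by (auto simp: child_def)
  then show ?thesis by (auto simp: below_def)
qed

lemma bag_below: "X i \<subseteq> below i"
  using below_unfold by blast

lemma below_root: "below \<rho> = pverts G"
proof
  have "\<And>i. i \<in> pverts T \<Longrightarrow> X i \<subseteq> pverts G" using decomposition by (simp add: tree_decomposition_def)
  then show "below \<rho> \<subseteq> pverts G" using descendant_verts[OF _ root] unfolding below_def by blast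
  have "\<And>v. v \<in> pverts G \<Longrightarrow> \<exists>i\<in>pverts T. v \<in> X i" using decomposition by (simp add: tree_decomposition_def)
  then show "pverts G \<subseteq> below \<rho>" using root_descends unfolding below_def by blast
qed

lemma bag_verts: "i \<in> pverts T \<Longrightarrow> X i \<subseteq> pverts G"
  using decomposition by (simp add: tree_decomposition_def)

lemma occurrences_separation:
  assumes "m \<in> pverts T" "v \<in> X m" "(j, m) \<in> child\<^sup>*" "x \<in> pverts T" "v \<in> X x" "(j, x) \<notin> child\<^sup>*"
  shows "v \<in> X j \<and> (\<exists>i. (i, j) \<in> child \<and> v \<in> X i)"
proof -
  have "v \<in> pverts G" using bag_verts assms by blast
  then have "Digraph_Component.connected (with_proj T \<restriction> {i \<in> pverts T. v \<in> X i})"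
    using decomposition by (simp add: tree_decomposition_def)
  from separation[OF this, of m j x] show ?thesis using assms by blast
qed

lemma child_verts: "(i, j) \<in> child \<Longrightarrow> i \<in> pverts T \<and> j \<in> pverts T"
  using child_arc arc_verts by blast

lemma not_descendant_parent: "(i, j) \<in> child \<Longrightarrow> (j, i) \<notin> child\<^sup>*"
  using child_acyclic child_verts by (meson rtrancl_into_trancl2)

lemma below_inter_bag:
  assumes "(i, j) \<in> child" shows "below j \<inter> X i \<subseteq> X j"
  using occurrences_separation[of _ _ j i] not_descendant_parent[OF assms] child_verts[OF assms]
    descendant_verts by (fastforce simp: below_def)

text \<open>The subtrees of siblings are disjoint. So a common vertex occurs inside and outside the
  subtree of \<open>j\<close>, hence also in the bag of the parent.\<close>

lemma below_inter_below:
  assumes "(i, j) \<in> child" "(i, k) \<in> child" "j \<noteq> k"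
  shows "below j \<inter> below k \<subseteq> X i"
proof
  fix v assume "v \<in> below j \<inter> below k"
  then obtain m m' where m: "(j, m) \<in> child\<^sup>*" "v \<in> X m" "(k, m') \<in> child\<^sup>*" "v \<in> X m'"
    by (auto simp: below_def)
  have "(j, m') \<notin> child\<^sup>*"
  proof
    assume "(j, m') \<in> child\<^sup>*"
    then consider "(j, k) \<in> child\<^sup>*" | "(k, j) \<in> child\<^sup>*" using comparable m by blast
    then show False
    proof cases
      case 1
      then obtain u where "(j, u) \<in> child\<^sup>*" "(u, k) \<in> child" using assms(3) by (meson rtranclE)
      then show False using unique_parent assms not_descendant_parent by blast
    next
      case 2
      then obtain u where "(k, u) \<in> child\<^sup>*" "(u, j) \<in> child" using assms(3) by (metis rtranclE)
      then show False using unique_parent assms not_descendant_parent by blast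
    qed
  qed
  then obtain i' where "(i', j) \<in> child" "v \<in> X i'"
    using occurrences_separation[of m v j m'] m descendant_verts child_verts assms by metis
  then show "v \<in> X i" using unique_parent assms by blast
qed

lemma edge_bag:
  assumes "(x, y) \<in> parcs G"
  obtains m where "m \<in> pverts T" "x \<in> X m" "y \<in> X m"
  using decomposition assms unfolding tree_decomposition_def by blast

text \<open>A bag with both ends of the edge must be in the subtree of \<open>j\<close>, since
  otherwise \<open>x\<close> would occur on both sides and therefore in \<open>X i\<close>.\<close>

lemma edge_below:
  assumes "(i, j) \<in> child" "(x, y) \<in> parcs G" "x \<in> below j" "x \<notin> X i"
  shows "y \<in> below j"
proof -
  obtain m where m: "m \<in> pverts T" "x \<in> X m" "y \<in> X m" using edge_bag[OF assms(2)] by blast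
  obtain m' where m': "(j, m') \<in> child\<^sup>*" "x \<in> X m'" using assms(3) by (auto simp: below_def)
  have "(j, m) \<in> child\<^sup>*"
  proof (rule ccontr)
    assume "(j, m) \<notin> child\<^sup>*"
    then obtain i' where "(i', j) \<in> child" "x \<in> X i'"
      using occurrences_separation[of m' x j m] m m' descendant_verts child_verts assms by metis
    then show False using assms(1,4) unique_parent by blast
  qed
  then show ?thesis using m by (auto simp: below_def)
qed

text \<open>An end outside \<open>X i\<close> lies below some child and takes the other end along by
  \<open>edge_below\<close>; by symmetry this applies to either end.\<close>

lemma edge_inside_part:
  assumes "(x, y) \<in> parcs G" "x \<in> below i" "y \<in> below i"
  shows "(\<exists>j. (i, j) \<in> child \<and> x \<in> below j \<and> y \<in> below j) \<or> x \<in> X i \<and> y \<in> X i"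
proof -
  have "(y, x) \<in> parcs G" using assms(1) G
    by (auto simp: pair_graph_def pair_pseudo_graph_def pair_sym_digraph_def pair_sym_digraph_axioms_def symmetric_def elim: symE)
  then show ?thesis using assms edge_below below_unfold[of i] unfolding child_def by blast
qed

text \<open>The basis of the short neighbour lists, with \<open>pos\<close> as breadth-first number.
  A node \<open>m\<close> whose bag contains the edge is a descendant of both topmost nodes. If
  these differ, then \<open>a\<close> is not below \<open>b\<close> as it does not come later. So
  \<open>x\<close> occurs at \<open>m\<close>, inside the subtree of \<open>b\<close>, and at
  \<open>a\<close>, outside of it, hence at \<open>b\<close>.\<close>

lemma edge_in_top_bag:
  fixes pos :: "'i \<Rightarrow> nat"
  assumes pos: "\<And>i j. (i, j) \<in> child \<Longrightarrow> pos i < pos j"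
    and e: "(x, y) \<in> parcs G"
    and a: "a \<in> pverts T" "x \<in> X a" "\<And>i. i \<in> pverts T \<Longrightarrow> x \<in> X i \<Longrightarrow> pos a \<le> pos i"
    and b: "b \<in> pverts T" "y \<in> X b" "\<And>i. i \<in> pverts T \<Longrightarrow> y \<in> X i \<Longrightarrow> pos b \<le> pos i"
    and le: "pos a \<le> pos b"
  shows "x \<in> X b"
proof -
  obtain m where m: "m \<in> pverts T" "x \<in> X m" "y \<in> X m" using edge_bag[OF e] by blast
  have top: "(a', m) \<in> child\<^sup>*" if h: "a' \<in> pverts T" "z \<in> X a'" "z \<in> X m"
    "\<And>i. i \<in> pverts T \<Longrightarrow> z \<in> X i \<Longrightarrow> pos a' \<le> pos i" for a' z
  proof (rule ccontr)
    assume "(a', m) \<notin> child\<^sup>*"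
    then obtain i where "(i, a') \<in> child" "z \<in> X i"
      using occurrences_separation[of a' z a' m] h(1-3) m(1) by blast
    then show False using pos[of i a'] h(4)[of i] child_verts[of i a'] by linarith
  qed
  have am: "(a, m) \<in> child\<^sup>*" "(b, m) \<in> child\<^sup>*" using top a b m by blast+
  have mono: "pos i < pos j" if "(i, j) \<in> child\<^sup>+" for i j
    using that by (induction rule: trancl_induct) (auto dest: pos)
  have "(b, a) \<notin> child\<^sup>+" using mono le by fastforce
  show ?thesis
  proof (cases "a = b")
    case False
    then have "(b, a) \<notin> child\<^sup>*" using \<open>(b, a) \<notin> child\<^sup>+\<close> by (metis rtranclD)
    then show ?thesis using occurrences_separation[of m x b a] am m a by blast
  qed (use a in blast)
qed

end

section \<open>Programs with a time budget\<close>

notation SEQ (infixr ";;" 60)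

text \<open>
  \<open>n\<close> is the number of steps made before \<open>c\<close>, and \<open>Q\<close> speaks about the total number. So \<open>run\<close> acts as a
  weakest precondition: straight-line programs are executed by rewriting.
\<close>

definition run ::
  "com \<Rightarrow> (nat \<Rightarrow> (nat \<Rightarrow> nat) \<Rightarrow> (nat \<Rightarrow> nat \<Rightarrow> nat) \<Rightarrow> bool) \<Rightarrow> nat \<Rightarrow> (nat \<Rightarrow> nat) \<Rightarrow> (nat \<Rightarrow> nat \<Rightarrow> nat) \<Rightarrow> bool"
  where "run c Q n R M \<longleftrightarrow> (\<exists>k R' M'. exec c (R, M) k (R', M') \<and> Q (n + k) R' M')"

lemma runI: "exec c (R, M) k (R', M') \<Longrightarrow> Q (n + k) R' M' \<Longrightarrow> run c Q n R M"
  by (auto simp: run_def)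

lemma run_mono:
  "run c Q n R M \<Longrightarrow> (\<And>n R M. Q n R M \<Longrightarrow> Q' n R M) \<Longrightarrow> run c Q' n R M"
  unfolding run_def by blast

text \<open>Determinism makes this an equivalence, so the rules for single commands can serve as
  rewrite rules.\<close>

lemma run_exec: "exec c (R, M) k (R', M') \<Longrightarrow> run c Q n R M \<longleftrightarrow> Q (n + k) R' M'"
  unfolding run_def using exec_deterministic by blast

lemma run_atom [simp]:
  "run (SET x a) Q n R M \<longleftrightarrow> Q (Suc n) (R(x := a)) M"
  "run (COPY x y) Q n R M \<longleftrightarrow> Q (Suc n) (R(x := R y)) M"
  "run (INC x) Q n R M \<longleftrightarrow> Q (Suc n) (R(x := Suc (R x))) M"
  "run (DEC x) Q n R M \<longleftrightarrow> Q (Suc n) (R(x := R x - 1)) M"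
  "run (LOAD x b y) Q n R M \<longleftrightarrow> Q (Suc n) (R(x := M b (R y))) M"
  "run (STORE b y x) Q n R M \<longleftrightarrow> Q (Suc n) R (M(b := (M b)(R y := R x)))"
  by (simp_all add: run_exec[OF exec.Set] run_exec[OF exec.Copy] run_exec[OF exec.Inc]
      run_exec[OF exec.Dec] run_exec[OF exec.Load] run_exec[OF exec.Store])

lemma run_SEQ [simp]: "run (c1 ;; c2) Q n R M \<longleftrightarrow> run c1 (run c2 Q) n R M"
proof
  assume "run (c1 ;; c2) Q n R M"
  then obtain k R' M' where "exec (c1 ;; c2) (R, M) k (R', M')" "Q (n + k) R' M'"
    by (auto simp: run_def)
  then obtain k1 s k2 where "exec c1 (R, M) k1 s" "exec c2 s k2 (R', M')" "Q (n + k1 + k2) R' M'"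
    by (elim exec_SeqE) (simp add: add.assoc)
  then show "run c1 (run c2 Q) n R M"
    by (cases s) (auto intro: runI)
next
  assume "run c1 (run c2 Q) n R M"
  then obtain k1 R1 M1 k2 R2 M2 where "exec c1 (R, M) k1 (R1, M1)" "exec c2 (R1, M1) k2 (R2, M2)"
    "Q (n + (k1 + k2)) R2 M2" by (auto simp: run_def add.assoc)
  then show "run (c1 ;; c2) Q n R M" by (auto intro: runI exec.Seq)
qed

lemma run_IF [simp]:
  "run (IF t c1 c2) Q n R M \<longleftrightarrow>
     (if holds t (R, M) then run c1 Q (Suc n) R M else run c2 Q (Suc n) R M)"
proof
  assume "run (IF t c1 c2) Q n R M"
  then obtain k R' M' where "exec (IF t c1 c2) (R, M) k (R', M')" "Q (n + k) R' M'"
    by (auto simp: run_def)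
  then show "if holds t (R, M) then run c1 Q (Suc n) R M else run c2 Q (Suc n) R M"
    by (elim exec_IfE) (auto simp: run_def)
next
  assume "if holds t (R, M) then run c1 Q (Suc n) R M else run c2 Q (Suc n) R M"
  then show "run (IF t c1 c2) Q n R M"
    by (auto simp: run_def split: if_splits) (metis add_Suc_right Suc_eq_plus1 exec.IfTrue exec.IfFalse)+
qed

definition LOOP :: "nat \<Rightarrow> nat \<Rightarrow> com \<Rightarrow> com" where
  "LOOP v u c = WHILE (LESS v u) (c ;; INC v)"

text \<open>Each round costs two steps besides the body, for the test and the increment; the final
  failing test costs one. The body has to establish the invariant for the state after the
  increment.\<close>

lemma run_LOOP:
  assumes "R v = lo" "R u = hi" "lo \<le> hi" "I lo R M"
    and body: "\<And>i n R M. lo \<le> i \<Longrightarrow> i < hi \<Longrightarrow> R v = i \<Longrightarrow> R u = hi \<Longrightarrow> I i R M \<Longrightarrow>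
      run c (\<lambda>n' R' M'. n' \<le> n + b i \<and> R' v = i \<and> R' u = hi \<and> I (Suc i) (R'(v := Suc i)) M') n R M"
    and vu: "v \<noteq> u"
    and post: "\<And>n' R M. n' \<le> n + (\<Sum>i=lo..<hi. b i + 2) + 1 \<Longrightarrow> R v = hi \<Longrightarrow> R u = hi \<Longrightarrow> I hi R M \<Longrightarrow> Q n' R M"
  shows "run (LOOP v u c) Q n R M"
proof -
  have "\<exists>k R' M'. exec (LOOP v u c) (R, M) k (R', M') \<and> k \<le> (\<Sum>i=j..<hi. b i + 2) + 1 \<and>
      R' v = hi \<and> R' u = hi \<and> I hi R' M'"
    if "lo \<le> j" "j \<le> hi" "R v = j" "R u = hi" "I j R M" for j R M
    using that
  proof (induction "hi - j" arbitrary: j R M)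
    case 0
    then have "j = hi" by simp
    then show ?case using 0 exec.WhileFalse[of "LESS v u" "(R, M)" "c ;; INC v"]
      unfolding LOOP_def by (intro exI[of _ 1] exI[of _ R] exI[of _ M]) auto
  next
    case (Suc m)
    then have lt: "j < hi" by simp
    obtain k1 R1 M1 where 1: "exec c (R, M) k1 (R1, M1)" "k1 \<le> b j" "R1 v = j" "R1 u = hi"
      "I (Suc j) (R1(v := Suc j)) M1"
      using body[OF Suc.prems(1) lt Suc.prems(3-5), of 0] unfolding run_def by auto
    have "\<exists>k R' M'. exec (LOOP v u c) (R1(v := Suc j), M1) k (R', M') \<and>
      k \<le> (\<Sum>i=Suc j..<hi. b i + 2) + 1 \<and> R' v = hi \<and> R' u = hi \<and> I hi R' M'"
      using Suc.hyps(2) Suc.prems(1) lt 1 vu by (intro Suc.hyps(1)) auto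
    then obtain k2 R2 M2 where 2: "exec (LOOP v u c) (R1(v := Suc j), M1) k2 (R2, M2)"
      "k2 \<le> (\<Sum>i=Suc j..<hi. b i + 2) + 1" "R2 v = hi" "R2 u = hi" "I hi R2 M2" by blast
    have "exec (c ;; INC v) (R, M) (k1 + 1) (R1(v := R1 v + 1), M1)"
      by (rule exec.Seq[OF 1(1) exec.Inc])
    then have "exec (LOOP v u c) (R, M) (k1 + 1 + k2 + 1) (R2, M2)"
      unfolding LOOP_def using 1(3) 2(1) lt Suc.prems
      by (intro exec.WhileTrue) (auto simp: LOOP_def)
    moreover have "k1 + 1 + k2 + 1 \<le> (\<Sum>i=j..<hi. b i + 2) + 1"
      using 1(2) 2(2) lt by (simp add: sum.atLeast_Suc_lessThan)
    ultimately show ?case using 2 by blast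
  qed
  from this[OF order_refl assms(3,1,2,4)] obtain k R' M' where "exec (LOOP v u c) (R, M) k (R', M')"
    "k \<le> (\<Sum>i=lo..<hi. b i + 2) + 1" "R' v = hi" "R' u = hi" "I hi R' M'" by blast
  then show ?thesis using post[of "n + k" R' M'] by (auto simp: run_def)
qed

lemma run_LOOP_const:
  assumes "R v = lo" "R u = hi" "lo \<le> hi" "I lo R M"
    and body: "\<And>i n R M. lo \<le> i \<Longrightarrow> i < hi \<Longrightarrow> R v = i \<Longrightarrow> R u = hi \<Longrightarrow> I i R M \<Longrightarrow>
      run c (\<lambda>n' R' M'. n' \<le> n + b \<and> R' v = i \<and> R' u = hi \<and> I (Suc i) (R'(v := Suc i)) M') n R M"
    and vu: "v \<noteq> u"
    and post: "\<And>n' R M. n' \<le> n + (hi - lo) * (b + 2) + 1 \<Longrightarrow> R v = hi \<Longrightarrow> R u = hi \<Longrightarrow> I hi R M \<Longrightarrow> Q n' R M"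
  shows "run (LOOP v u c) Q n R M"
  by (rule run_LOOP[where I=I and b="\<lambda>_. b", OF assms(1-4) body vu]) (auto intro: post)

section \<open>Formulas with bounded quantifiers\<close>

text \<open>
  Registers: \<open>0\<close> number of vertices; \<open>1\<close> number of nodes; \<open>2\<close> root; \<open>3\<close> \<open>N\<close>; \<open>4\<close> \<open>K\<close>; \<open>5\<close>--\<open>7\<close> a node and its
  two children; \<open>8\<close>--\<open>10\<close> their states; \<open>11\<close> a colour; \<open>12\<close>--\<open>15\<close> auxiliary bound variables; \<open>16\<close>--\<open>22\<close>
  loop variables; from \<open>30\<close> the digits of three embeddings; from \<open>30 + 3 * r\<close> intermediate results.

  Arrays: \<open>0\<close>--\<open>5\<close> the input; \<open>6\<close> nodes in breadth-first order; \<open>7\<close> for each vertex the position of its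
  topmost node in that order; \<open>8\<close>, \<open>9\<close> the short neighbour lists; \<open>10\<close> powers of two; \<open>11\<close> the addresses
  of the tables of the nodes; \<open>12\<close> these tables.
\<close>

text \<open>
  Register \<open>3\<close> holds a bound \<open>N\<close>. Quantifiers range over the numbers below \<open>N\<close>, and the second
  argument of addition and both arguments of multiplication are capped at \<open>N\<close>. So the evaluation
  time is bounded by a polynomial in \<open>N\<close>, whatever the contents of the arrays.
\<close>

datatype expr =
    Reg nat
  | Num nat
  | Cell nat expr
  | Pred expr
  | Plus expr expr
  | Times expr expr
  | Less expr expr
  | Equal expr expr
  | Neg expr
  | Conj expr expr
  | Exists nat expr

primrec val :: "expr \<Rightarrow> (nat \<Rightarrow> nat) \<Rightarrow> (nat \<Rightarrow> nat \<Rightarrow> nat) \<Rightarrow> nat" where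
  "val (Reg x) R M = R x"
| "val (Num a) R M = a"
| "val (Cell a e) R M = M a (val e R M)"
| "val (Pred e) R M = val e R M - 1"
| "val (Plus e f) R M = val e R M + min (val f R M) (R 3)"
| "val (Times e f) R M = min (val e R M) (R 3) * min (val f R M) (R 3)"
| "val (Less e f) R M = (if val e R M < val f R M then 1 else 0)"
| "val (Equal e f) R M = (if val e R M = val f R M then 1 else 0)"
| "val (Neg e) R M = (if val e R M = 0 then 1 else 0)"
| "val (Conj e f) R M = (if val e R M = 0 \<or> val f R M = 0 then 0 else 1)"
| "val (Exists v e) R M = (if \<exists>x < R 3. val e (R(v := x)) M \<noteq> 0 then 1 else 0)"

text \<open>Registers from \<open>d\<close> on are free for intermediate results. A quantifier must
  not bind register \<open>3\<close>, because its own range is stored there.\<close>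

primrec uses_below :: "expr \<Rightarrow> nat \<Rightarrow> bool" where
  "uses_below (Reg x) d \<longleftrightarrow> x < d"
| "uses_below (Num a) d \<longleftrightarrow> True"
| "uses_below (Cell a e) d \<longleftrightarrow> uses_below e d"
| "uses_below (Pred e) d \<longleftrightarrow> uses_below e d"
| "uses_below (Plus e f) d \<longleftrightarrow> uses_below e d \<and> uses_below f d"
| "uses_below (Times e f) d \<longleftrightarrow> uses_below e d \<and> uses_below f d"
| "uses_below (Less e f) d \<longleftrightarrow> uses_below e d \<and> uses_below f d"
| "uses_below (Equal e f) d \<longleftrightarrow> uses_below e d \<and> uses_below f d"
| "uses_below (Neg e) d \<longleftrightarrow> uses_below e d"
| "uses_below (Conj e f) d \<longleftrightarrow> uses_below e d \<and> uses_below f d"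
| "uses_below (Exists v e) d \<longleftrightarrow> v < d \<and> v \<noteq> 3 \<and> uses_below e d"

primrec compile :: "expr \<Rightarrow> nat \<Rightarrow> com" where
  "compile (Reg x) d = COPY d x"
| "compile (Num a) d = SET d a"
| "compile (Cell a e) d = compile e d ;; LOAD d a d"
| "compile (Pred e) d = compile e d ;; DEC d"
| "compile (Plus e f) d = compile e (d + 1) ;; compile f (d + 2) ;; COPY d (d + 1) ;; SET (d + 3) 0 ;;
     LOOP (d + 3) 3 (IF (LESS (d + 3) (d + 2)) (INC d) (SET (d + 4) 0))"
| "compile (Times e f) d = compile e (d + 1) ;; compile f (d + 2) ;; SET d 0 ;; SET (d + 3) 0 ;;
     LOOP (d + 3) 3 (IF (LESS (d + 3) (d + 2))
       (SET (d + 4) 0 ;; LOOP (d + 4) 3 (IF (LESS (d + 4) (d + 1)) (INC d) (SET (d + 5) 0)))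
       (SET (d + 5) 0))"
| "compile (Less e f) d = compile e (d + 1) ;; compile f (d + 2) ;; IF (LESS (d + 1) (d + 2)) (SET d 1) (SET d 0)"
| "compile (Equal e f) d = compile e (d + 1) ;; compile f (d + 2) ;; IF (EQ (d + 1) (d + 2)) (SET d 1) (SET d 0)"
| "compile (Neg e) d = compile e (d + 1) ;; SET (d + 2) 0 ;; IF (EQ (d + 1) (d + 2)) (SET d 1) (SET d 0)"
| "compile (Conj e f) d = compile e (d + 1) ;; compile f (d + 2) ;; SET (d + 3) 0 ;;
     IF (EQ (d + 1) (d + 3)) (SET d 0) (IF (EQ (d + 2) (d + 3)) (SET d 0) (SET d 1))"
| "compile (Exists v e) d = SET d 0 ;; COPY (d + 1) v ;; SET v 0 ;;
     LOOP v 3 (compile e (d + 2) ;; SET (d + 3) 0 ;; IF (EQ (d + 2) (d + 3)) (SET (d + 4) 0) (SET d 1)) ;;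
     COPY v (d + 1)"

primrec cost :: "expr \<Rightarrow> nat \<Rightarrow> nat" where
  "cost (Reg x) N = 1"
| "cost (Num a) N = 1"
| "cost (Cell a e) N = cost e N + 1"
| "cost (Pred e) N = cost e N + 1"
| "cost (Plus e f) N = cost e N + cost f N + 4 * N + 3"
| "cost (Times e f) N = cost e N + cost f N + N * (5 + 4 * N) + 3"
| "cost (Less e f) N = cost e N + cost f N + 2"
| "cost (Equal e f) N = cost e N + cost f N + 2"
| "cost (Neg e) N = cost e N + 3"
| "cost (Conj e f) N = cost e N + cost f N + 4"
| "cost (Exists v e) N = N * (5 + cost e N) + 5"

lemma uses_below_mono: "uses_below e d \<Longrightarrow> d \<le> d' \<Longrightarrow> uses_below e d'"
  by (induction e) auto

lemma val_cong:
  assumes "uses_below e d" "3 < d" "\<And>y. y < d \<Longrightarrow> R y = R' y"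
  shows "val e R M = val e R' M"
  using assms
proof (induction e arbitrary: R R')
  case (Exists v e)
  have "val e (R(v := x)) M = val e (R'(v := x)) M" for x
    using Exists.prems by (intro Exists.IH) auto
  then show ?case using Exists.prems(2,3) by simp
next
  case (Plus e f)
  have "val e R M = val e R' M" "val f R M = val f R' M" using Plus.prems by (auto intro!: Plus.IH)
  then show ?case using Plus.prems(2,3) by simp
next
  case (Times e f)
  have "val e R M = val e R' M" "val f R M = val f R' M" using Times.prems by (auto intro!: Times.IH)
  then show ?case using Times.prems(2,3) by simp
next
  case (Less e f)
  have "val e R M = val e R' M" "val f R M = val f R' M" using Less.prems by (auto intro!: Less.IH)
  then show ?case using Less.prems(2,3) by simp
next
  case (Equal e f)
  have "val e R M = val e R' M" "val f R M = val f R' M" using Equal.prems by (auto intro!: Equal.IH)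
  then show ?case using Equal.prems(2,3) by simp
next
  case (Conj e f)
  have "val e R M = val e R' M" "val f R M = val f R' M" using Conj.prems by (auto intro!: Conj.IH)
  then show ?case using Conj.prems(2,3) by simp
next
  case (Cell a e)
  have "val e R M = val e R' M" using Cell.prems by (auto intro!: Cell.IH)
  then show ?case by simp
next
  case (Pred e)
  have "val e R M = val e R' M" using Pred.prems by (auto intro!: Pred.IH)
  then show ?case by simp
next
  case (Neg e)
  have "val e R M = val e R' M" using Neg.prems by (auto intro!: Neg.IH)
  then show ?case by simp
qed auto

lemma run_operands:
  assumes e: "uses_below e d" and f: "uses_below f d" and d: "3 < d"
    and IH: "\<And>n R M. run (compile e (d + 1)) (\<lambda>n' R' M'. n' \<le> n + cost e (R 3) \<and> M' = M \<and>
        R' (d + 1) = val e R M \<and> (\<forall>y<d + 1. R' y = R y)) n R M"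
      "\<And>n R M. run (compile f (d + 2)) (\<lambda>n' R' M'. n' \<le> n + cost f (R 3) \<and> M' = M \<and>
        R' (d + 2) = val f R M \<and> (\<forall>y<d + 2. R' y = R y)) n R M"
    and c: "\<And>n' R'. n' \<le> n + cost e (R 3) + cost f (R 3) \<Longrightarrow> R' (d + 1) = val e R M \<Longrightarrow>
      R' (d + 2) = val f R M \<Longrightarrow> (\<And>y. y < d \<Longrightarrow> R' y = R y) \<Longrightarrow> run c Q n' R' M"
  shows "run (compile e (d + 1) ;; compile f (d + 2) ;; c) Q n R M"
  unfolding run_SEQ
proof (rule run_mono[OF IH(1)])
  fix n1 R1 M1 assume 1: "n1 \<le> n + cost e (R 3) \<and> M1 = M \<and> R1 (d + 1) = val e R M \<and> (\<forall>y<d + 1. R1 y = R y)"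
  have v: "val f R1 M = val f R M" using 1 d by (intro val_cong[OF f d]) auto
  show "run (compile f (d + 2)) (run c Q) n1 R1 M1"
  proof (rule run_mono[OF IH(2)])
    fix n2 R2 M2 assume 2: "n2 \<le> n1 + cost f (R1 3) \<and> M2 = M1 \<and> R2 (d + 2) = val f R1 M1 \<and> (\<forall>y<d + 2. R2 y = R1 y)"
    then have "M2 = M" using 1 by simp
    then show "run c Q n2 R2 M2" using 1 2 v d by (simp, intro c) auto
  qed
qed

lemma run_compile:
  assumes "uses_below e d" "3 < d"
  shows "run (compile e d) (\<lambda>n' R' M'. n' \<le> n + cost e (R 3) \<and> M' = M \<and> R' d = val e R M \<and>
     (\<forall>y<d. R' y = R y)) n R M"
  using assms
proof (induction e arbitrary: d n R M)
  case (Cell a e)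
  show ?case unfolding compile.simps run_SEQ
    by (rule run_mono[OF Cell.IH]) (use Cell.prems in auto)
next
  case (Pred e)
  show ?case unfolding compile.simps run_SEQ
    by (rule run_mono[OF Pred.IH]) (use Pred.prems in auto)
next
  case (Plus e f)
  then have ef: "uses_below e d" "uses_below f d" and d: "3 < d" by auto
  show ?case unfolding compile.simps
  proof (rule run_operands[OF ef d])
    fix n' R' assume 1: "n' \<le> n + cost e (R 3) + cost f (R 3)" "R' (d + 1) = val e R M" "R' (d + 2) = val f R M"
      "\<And>y. y < d \<Longrightarrow> R' y = R y"
    show "run (COPY d (d + 1) ;; SET (d + 3) 0 ;; LOOP (d + 3) 3 (IF (LESS (d + 3) (d + 2)) (INC d) (SET (d + 4) 0)))
      (\<lambda>n' R' M'. n' \<le> n + cost (Plus e f) (R 3) \<and> M' = M \<and> R' d = val (Plus e f) R M \<and>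
        (\<forall>y<d. R' y = R y)) n' R' M"
      unfolding run_SEQ run_atom
      by (rule run_LOOP_const[where lo=0 and hi="R 3" and b=2 and
          I="\<lambda>i R' M'. M' = M \<and> R' d = val e R M + min (val f R M) i \<and> R' (d + 2) = val f R M \<and> (\<forall>y<d. R' y = R y)"])
        (use 1 d in auto)
  qed (use Plus.IH ef d uses_below_mono in auto)
next
  case (Times e f)
  then have ef: "uses_below e d" "uses_below f d" and d: "3 < d" by auto
  let ?inner = "SET (d + 4) 0 ;; LOOP (d + 4) 3 (IF (LESS (d + 4) (d + 1)) (INC d) (SET (d + 5) 0))"
  let ?I = "\<lambda>i R' M'. M' = M \<and> R' d = min (val e R M) (R 3) * min (val f R M) i \<and>
          R' (d + 1) = val e R M \<and> R' (d + 2) = val f R M \<and> (\<forall>y<d. R' y = R y)"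
  show ?case unfolding compile.simps
  proof (rule run_operands[OF ef d])
    fix n' R' assume 1: "n' \<le> n + cost e (R 3) + cost f (R 3)" "R' (d + 1) = val e R M" "R' (d + 2) = val f R M"
      "\<And>y. y < d \<Longrightarrow> R' y = R y"
    show "run (SET d 0 ;; SET (d + 3) 0 ;; LOOP (d + 3) 3 (IF (LESS (d + 3) (d + 2)) ?inner (SET (d + 5) 0)))
      (\<lambda>n' R' M'. n' \<le> n + cost (Times e f) (R 3) \<and> M' = M \<and> R' d = val (Times e f) R M \<and>
        (\<forall>y<d. R' y = R y)) n' R' M"
      unfolding run_SEQ run_atom
    proof (rule run_LOOP_const[where lo=0 and hi="R 3" and b="4 * R 3 + 3" and I="?I"])
      fix i n' R' M' assume i: "i < R 3" "R' (d + 3) = i" "R' 3 = R 3" "?I i R' M'"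
      let ?Q = "\<lambda>n'' R'' M''. n'' \<le> n' + (4 * R 3 + 3) \<and> R'' (d + 3) = i \<and> R'' 3 = R 3 \<and>
             ?I (Suc i) (R''(d + 3 := Suc i)) M''"
      show "run (IF (LESS (d + 3) (d + 2)) ?inner (SET (d + 5) 0)) ?Q n' R' M'"
      proof (cases "i < val f R M")
        case False
        then show ?thesis using i d by auto
      next
        case True
        have m: "val f R M = Suc i \<or> Suc i < val f R M" using True by linarith
        have "run (LOOP (d + 4) 3 (IF (LESS (d + 4) (d + 1)) (INC d) (SET (d + 5) 0)))
            ?Q (Suc (Suc n')) (R'(d + 4 := 0)) M'"
          by (rule run_LOOP_const[where lo=0 and hi="R 3" and b=2 and
             I="\<lambda>j R'' M''. M'' = M \<and> R'' d = min (val e R M) (R 3) * i + min (val e R M) j \<and>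
              R'' (d + 1) = val e R M \<and> R'' (d + 2) = val f R M \<and> R'' (d + 3) = i \<and> (\<forall>y<d. R'' y = R y)"])
            (use i True d m in \<open>auto simp: min_def\<close>)
        then show ?thesis using True i by simp
      qed
    qed (use 1 d in auto)
  qed (use Times.IH ef d uses_below_mono in auto)
next
  case (Less e f)
  then have ef: "uses_below e d" "uses_below f d" and d: "3 < d" by auto
  show ?case unfolding compile.simps
    by (rule run_operands[OF ef d]) (use Less.IH ef d uses_below_mono in auto)
next
  case (Equal e f)
  then have ef: "uses_below e d" "uses_below f d" and d: "3 < d" by auto
  show ?case unfolding compile.simps
    by (rule run_operands[OF ef d]) (use Equal.IH ef d uses_below_mono in auto)
next
  case (Conj e f)
  then have ef: "uses_below e d" "uses_below f d" and d: "3 < d" by auto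
  show ?case unfolding compile.simps
    by (rule run_operands[OF ef d]) (use Conj.IH ef d uses_below_mono in auto)
next
  case (Neg e)
  show ?case unfolding compile.simps run_SEQ
    by (rule run_mono[OF Neg.IH]) (use Neg.prems uses_below_mono in auto)
next
  case (Exists v e)
  then have v: "v < d" "v \<noteq> 3" and e: "uses_below e d" by auto
  let ?I = "\<lambda>i R' M'. M' = M \<and> R' d = (if \<exists>x<i. val e (R(v := x)) M \<noteq> 0 then 1 else 0) \<and>
      R' (d + 1) = R v \<and> (\<forall>y<d. y \<noteq> v \<longrightarrow> R' y = R y)"
  show ?case unfolding compile.simps run_SEQ run_atom
  proof (rule run_LOOP_const[where lo=0 and hi="R 3" and b="cost e (R 3) + 3" and I="?I"])
    fix i n' R' M' assume i: "i < R 3" "R' v = i" "R' 3 = R 3" "?I i R' M'"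
    \<comment> \<open>Up to now only \<open>v\<close> and scratch registers have changed, so round
      \<open>i\<close> evaluates the body as if \<open>v\<close> had just been assigned
      \<open>i\<close>.\<close>
    have ve: "val e R' M = val e (R(v := i)) M"
      using i e Exists.prems v by (intro val_cong[of e d]) auto
    show "run (compile e (d + 2) ;; SET (d + 3) 0 ;; IF (EQ (d + 2) (d + 3)) (SET (d + 4) 0) (SET d 1))
      (\<lambda>n'' R'' M''. n'' \<le> n' + (cost e (R 3) + 3) \<and> R'' v = i \<and> R'' 3 = R 3 \<and>
        ?I (Suc i) (R''(v := Suc i)) M'') n' R' M'"
      unfolding run_SEQ
      by (rule run_mono[OF Exists.IH])
        (use i e v ve Exists.prems uses_below_mono in \<open>auto simp: less_Suc_eq\<close>)
  qed (use Exists.prems in auto)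
qed auto

text \<open>Nested quantifiers and products raise the degree, but it depends on the formula only.
  The formulas used later are built from the pattern, so their degree is independent of the
  width.\<close>

lemma cost_polynomial: "\<exists>A D. \<forall>N. cost e N \<le> A * (N + 1) ^ D"
proof (induction e)
  have comb: "\<exists>A D. \<forall>N. f N + g N + h N \<le> A * (N + 1) ^ D"
    if h: "\<exists>A D. \<forall>N. f N \<le> A * (N + 1) ^ D" "\<exists>A D. \<forall>N. g N \<le> A * (N + 1) ^ D"
      "\<exists>A D. \<forall>N. h N \<le> A * (N + 1) ^ D" for f g h :: "nat \<Rightarrow> nat"
  proof -
    obtain A1 D1 where a1: "\<And>N. f N \<le> A1 * (N + 1) ^ D1" using h(1) by blast
    obtain A2 D2 where a2: "\<And>N. g N \<le> A2 * (N + 1) ^ D2" using h(2) by blast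
    obtain A3 D3 where a3: "\<And>N. h N \<le> A3 * (N + 1) ^ D3" using h(3) by blast
    note a = a1 a2 a3
    have p: "A * (N + 1) ^ D \<le> A * (N + 1) ^ (D1 + D2 + D3)" if "D \<le> D1 + D2 + D3" for A D N :: nat
      using that by (intro mult_le_mono2 power_increasing) auto
    have "f N + g N + h N \<le> (A1 + A2 + A3) * (N + 1) ^ (D1 + D2 + D3)" for N
      unfolding add_mult_distrib
      by (intro add_mono order_trans[OF a(1) p] order_trans[OF a(2) p] order_trans[OF a(3) p]) auto
    then show ?thesis by blast
  qed
  have base: "\<exists>A D. \<forall>N. a * N * N + b * N + c \<le> A * (N + 1) ^ D" for a b c :: nat
    by (intro exI[of _ "a + b + c"] exI[of _ 2]) (auto simp: power2_eq_square algebra_simps)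
  have basic: "\<exists>A D. \<forall>N. c \<le> A * (N + 1) ^ D" for c :: nat
    using base[of 0 0 c] by simp
  {
    case (Reg x) then show ?case using basic[of 1] by simp
  next
    case (Num x) then show ?case using basic[of 1] by simp
  next
    case (Cell x e) then show ?case using comb[OF _ basic[of 1] basic[of 0]] by simp
  next
    case (Pred e) then show ?case using comb[OF _ basic[of 1] basic[of 0]] by simp
  next
    case (Plus e f) then show ?case using comb[OF _ _ base[of 0 4 3], of "cost e" "cost f"] by (simp add: algebra_simps)
  next
    case (Times e f) then show ?case using comb[OF _ _ base[of 4 5 3], of "cost e" "cost f"] by (simp add: algebra_simps)
  next
    case (Less e f) then show ?case using comb[OF _ _ basic[of 2]] by simp
  next
    case (Equal e f) then show ?case using comb[OF _ _ basic[of 2]] by simp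
  next
    case (Neg e) then show ?case using comb[OF _ basic[of 3] basic[of 0]] by simp
  next
    case (Conj e f) then show ?case using comb[OF _ _ basic[of 4]] by simp
  next
    case (Exists x e)
    then obtain A D where a: "\<And>N. cost e N \<le> A * (N + 1) ^ D" by blast
    have "N * cost e N \<le> A * (N + 1) ^ Suc D" for N
    proof -
      have "N * cost e N \<le> (N + 1) * (A * (N + 1) ^ D)" by (intro mult_le_mono a) simp
      then show ?thesis by (simp add: algebra_simps)
    qed
    then have "\<exists>A D. \<forall>N. N * cost e N \<le> A * (N + 1) ^ D" by blast
    then show ?case using comb[OF _ base[of 0 5 5] basic[of 0], of "\<lambda>N. N * cost e N"]
      by (simp add: algebra_simps)
  }
qed

section \<open>Derived connectives and quantifiers over digit lists\<close>

definition sat :: "expr \<Rightarrow> (nat \<Rightarrow> nat) \<Rightarrow> (nat \<Rightarrow> nat \<Rightarrow> nat) \<Rightarrow> bool" where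
  "sat e R M \<longleftrightarrow> val e R M \<noteq> 0"

definition Disj :: "expr \<Rightarrow> expr \<Rightarrow> expr" where "Disj e f = Neg (Conj (Neg e) (Neg f))"

definition Iff :: "expr \<Rightarrow> expr \<Rightarrow> expr" where "Iff e f = Disj (Conj e f) (Conj (Neg e) (Neg f))"

definition Conjs :: "nat \<Rightarrow> (nat \<Rightarrow> expr) \<Rightarrow> expr" where
  "Conjs m f = foldr (\<lambda>h. Conj (f h)) [0..<m] (Num 1)"

primrec Exists_digits :: "nat \<Rightarrow> nat \<Rightarrow> expr \<Rightarrow> expr" where
  "Exists_digits 0 b e = e"
| "Exists_digits (Suc m) b e = Exists b (Conj (Less (Reg b) (Reg 4)) (Exists_digits m (Suc b) e))"

primrec writes :: "(nat \<Rightarrow> nat) \<Rightarrow> nat \<Rightarrow> nat list \<Rightarrow> nat \<Rightarrow> nat" where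
  "writes R b [] = R"
| "writes R b (x # xs) = writes (R(b := x)) (Suc b) xs"

lemma writes_apply: "writes R b xs y = (if b \<le> y \<and> y < b + length xs then xs ! (y - b) else R y)"
proof (induction xs arbitrary: R b)
  case (Cons x xs)
  then show ?case by (auto simp: nth_Cons' Suc_diff_Suc not_less le_less_Suc_eq)
qed simp

lemma sat_simps [simp]:
  "sat (Num a) R M \<longleftrightarrow> a \<noteq> 0"
  "sat (Less e f) R M \<longleftrightarrow> val e R M < val f R M"
  "sat (Equal e f) R M \<longleftrightarrow> val e R M = val f R M"
  "sat (Neg e) R M \<longleftrightarrow> \<not> sat e R M"
  "sat (Conj e f) R M \<longleftrightarrow> sat e R M \<and> sat f R M"
  "sat (Exists v e) R M \<longleftrightarrow> (\<exists>x<R 3. sat e (R(v := x)) M)"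
  "sat (Disj e f) R M \<longleftrightarrow> sat e R M \<or> sat f R M"
  "sat (Iff e f) R M \<longleftrightarrow> (sat e R M \<longleftrightarrow> sat f R M)"
  by (auto simp: sat_def Disj_def Iff_def)

lemma sat_Conjs [simp]: "sat (Conjs m f) R M \<longleftrightarrow> (\<forall>h<m. sat (f h) R M)"
proof -
  have "sat (foldr (\<lambda>h. Conj (f h)) xs (Num 1)) R M \<longleftrightarrow> (\<forall>h\<in>set xs. sat (f h) R M)" for xs
    by (induction xs) auto
  then show ?thesis by (auto simp: Conjs_def)
qed

text \<open>Each quantifier ranges below register \<open>3\<close> and is then cut down to register
  \<open>4\<close>; all digits are reached since \<open>R 4 \<le> R 3\<close>.\<close>

lemma sat_Exists_digits:
  assumes "4 < b" "R 4 \<le> R 3"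
  shows "sat (Exists_digits m b e) R M \<longleftrightarrow>
     (\<exists>xs. length xs = m \<and> (\<forall>x\<in>set xs. x < R 4) \<and> sat e (writes R b xs) M)"
  using assms
proof (induction m arbitrary: b R)
  case (Suc m)
  have IH: "sat (Exists_digits m (Suc b) e) (R(b := x)) M \<longleftrightarrow>
     (\<exists>xs. length xs = m \<and> (\<forall>x\<in>set xs. x < R 4) \<and> sat e (writes (R(b := x)) (Suc b) xs) M)" for x
  proof -
    have 4: "(R(b := x)) 4 = R 4" "(R(b := x)) 3 = R 3" using Suc.prems by auto
    have "4 < Suc b" using Suc.prems by simp
    from Suc.IH[OF this, of "R(b := x)", unfolded 4, OF Suc.prems(2)] show ?thesis .
  qed
  have "sat (Exists_digits (Suc m) b e) R M \<longleftrightarrow>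
     (\<exists>x<R 4. \<exists>xs. length xs = m \<and> (\<forall>x\<in>set xs. x < R 4) \<and> sat e (writes R b (x # xs)) M)"
    using Suc.prems IH by (auto intro: less_le_trans)
  also have "\<dots> \<longleftrightarrow> (\<exists>xs. length xs = Suc m \<and> (\<forall>x\<in>set xs. x < R 4) \<and> sat e (writes R b xs) M)"
  proof
    assume "\<exists>x<R 4. \<exists>xs. length xs = m \<and> (\<forall>x\<in>set xs. x < R 4) \<and> sat e (writes R b (x # xs)) M"
    then obtain x xs where "x < R 4" "length xs = m" "\<forall>x\<in>set xs. x < R 4" "sat e (writes R b (x # xs)) M"
      by blast
    then show "\<exists>xs. length xs = Suc m \<and> (\<forall>x\<in>set xs. x < R 4) \<and> sat e (writes R b xs) M"
      by (intro exI[of _ "x # xs"]) simp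
  next
    assume "\<exists>xs. length xs = Suc m \<and> (\<forall>x\<in>set xs. x < R 4) \<and> sat e (writes R b xs) M"
    then obtain xs where xs: "length xs = Suc m" "\<forall>x\<in>set xs. x < R 4" "sat e (writes R b xs) M"
      by blast
    then obtain x ys where "xs = x # ys" by (cases xs) auto
    with xs show "\<exists>x<R 4. \<exists>xs. length xs = m \<and> (\<forall>x\<in>set xs. x < R 4) \<and> sat e (writes R b (x # xs)) M"
      by (intro exI[of _ x] conjI exI[of _ ys]) simp_all
  qed
  finally show ?case .
qed simp

lemma uses_below_macros [simp]:
  "uses_below (Disj e f) d \<longleftrightarrow> uses_below e d \<and> uses_below f d"
  "uses_below (Iff e f) d \<longleftrightarrow> uses_below e d \<and> uses_below f d"
  "uses_below (Conjs m g) d \<longleftrightarrow> (\<forall>h<m. uses_below (g h) d)"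
proof -
  have "uses_below (foldr (\<lambda>h. Conj (g h)) xs (Num 1)) d \<longleftrightarrow> (\<forall>h\<in>set xs. uses_below (g h) d)" for xs
    by (induction xs) auto
  then show "uses_below (Conjs m g) d \<longleftrightarrow> (\<forall>h<m. uses_below (g h) d)" by (auto simp: Conjs_def)
qed (auto simp: Disj_def Iff_def)

lemma uses_below_Exists_digits:
  "b + m \<le> d \<Longrightarrow> 4 < b \<Longrightarrow> uses_below e d \<Longrightarrow> uses_below (Exists_digits m b e) d"
  by (induction m arbitrary: b) auto

section \<open>Formulas for bits, codes and lists in memory\<close>

text \<open>Instead of a division, the binary expansion is guessed: bit \<open>m\<close> of
  \<open>w\<close> is set iff \<open>w = a * 2^(m+1) + 2^m + b\<close> for some \<open>a\<close> and
  some \<open>b < 2^m\<close>. The power \<open>2^m\<close> comes from array \<open>10\<close>, and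
  \<open>2^(m+1)\<close> is a sum of two such cells.\<close>

definition Bit :: "nat \<Rightarrow> expr \<Rightarrow> expr" where
  "Bit x m = Exists 12 (Exists 13 (Conj (Less (Reg 13) (Cell 10 m))
     (Equal (Reg x) (Plus (Plus (Times (Reg 12) (Plus (Cell 10 m) (Cell 10 m))) (Cell 10 m)) (Reg 13)))))"

primrec Code :: "nat \<Rightarrow> nat \<Rightarrow> expr" where
  "Code 0 b = Num 0"
| "Code (Suc m) b = Plus (Reg b) (Times (Reg 4) (Code m (Suc b)))"

text \<open>
  A list of lists is represented by an array \<open>a\<close> of offsets and an array \<open>b\<close> of entries. Bags are
  stored in this way in the arrays \<open>4\<close> and \<open>5\<close>.
\<close>

definition lists_at :: "(nat \<Rightarrow> nat \<Rightarrow> nat) \<Rightarrow> nat \<Rightarrow> nat \<Rightarrow> nat \<Rightarrow> nat list \<Rightarrow> bool" where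
  "lists_at M a b i xs \<longleftrightarrow> (\<forall>p. M a i + p < M a (Suc i) \<longleftrightarrow> p < length xs) \<and>
     (\<forall>p<length xs. M b (M a i + p) = xs ! p)"

definition Member :: "nat \<Rightarrow> nat \<Rightarrow> expr \<Rightarrow> expr \<Rightarrow> expr" where
  "Member a b t u = Exists 14 (Conj (Less (Plus (Cell a t) (Reg 14)) (Cell a (Plus t (Num 1))))
     (Equal (Cell b (Plus (Cell a t) (Reg 14))) u))"

definition Vertex :: "nat \<Rightarrow> nat \<Rightarrow> expr" where
  "Vertex i y = Cell 5 (Plus (Cell 4 (Reg i)) (Pred (Pred (Reg y))))"

definition In_range :: "nat \<Rightarrow> nat \<Rightarrow> expr" where
  "In_range i y = Less (Plus (Cell 4 (Reg i)) (Pred (Pred (Reg y)))) (Cell 4 (Plus (Reg i) (Num 1)))"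

text \<open>Without the comparison with \<open>1\<close>, truncated subtraction would turn the
  digits \<open>0\<close> and \<open>1\<close> into position \<open>0\<close>.\<close>

definition In_bag :: "nat \<Rightarrow> nat \<Rightarrow> expr" where
  "In_bag i y = Conj (Less (Num 1) (Reg y)) (In_range i y)"

lemma bit_iff_decomposition: "bit (w::nat) m \<longleftrightarrow> (\<exists>a b. b < 2 ^ m \<and> w = a * (2 ^ m + 2 ^ m) + 2 ^ m + b)"
proof
  assume "bit w m"
  then have "odd (w div 2 ^ m)" by (simp add: bit_iff_odd)
  then obtain a where "w div 2 ^ m = 2 * a + 1" by (elim oddE)
  then have "w = (2 * a + 1) * 2 ^ m + w mod 2 ^ m" by (metis div_mult_mod_eq)
  then show "\<exists>a b. b < 2 ^ m \<and> w = a * (2 ^ m + 2 ^ m) + 2 ^ m + b"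
    by (intro exI[of _ a] exI[of _ "w mod 2 ^ m"]) (auto simp: algebra_simps)
next
  assume "\<exists>a b. b < 2 ^ m \<and> w = a * (2 ^ m + 2 ^ m) + 2 ^ m + b"
  then obtain a b where b: "b < 2 ^ m" and "w = a * (2 ^ m + 2 ^ m) + 2 ^ m + b" by blast
  then have "w = (2 * a + 1) * 2 ^ m + b" by (simp add: algebra_simps)
  moreover have d: "(c * k + b) div k = c" if "b < k" for c k :: nat using that by simp
  ultimately have "w div 2 ^ m = 2 * a + 1" using b by metis
  then show "bit w m" by (simp add: bit_iff_odd)
qed

locale powers =
  fixes L :: nat and M :: "nat \<Rightarrow> nat \<Rightarrow> nat"
  assumes powers: "\<And>a. a < L \<Longrightarrow> M 10 a = 2 ^ a"
begin

text \<open>The caps have no effect, because twice the power is still at most \<open>2 ^ L\<close>.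
  The last assumption keeps \<open>m\<close> independent of the registers that \<open>Bit\<close>
  binds.\<close>

lemma sat_Bit:
  assumes R3: "R 3 = 2 ^ L" and x: "x < 12" "x \<noteq> 3" "R x < R 3"
    and m: "val m R M < L" "\<And>a b. val m (R(12 := a, 13 := b)) M = val m R M"
  shows "sat (Bit x m) R M \<longleftrightarrow> bit (R x) (val m R M)"
proof -
  let ?p = "2 ^ val m R M :: nat"
  have pp: "?p + ?p \<le> 2 ^ L"
  proof -
    have "(2::nat) ^ Suc (val m R M) \<le> 2 ^ L" using m(1) by (intro power_increasing) auto
    then show ?thesis by simp
  qed
  let ?l = "2 ^ L :: nat"
  have v: "min a ?l * min (?p + min ?p ?l) ?l + min ?p ?l + min b ?l = a * (?p + ?p) + ?p + b"
    if "a < ?l" "b < ?p" for a b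
    using that pp by (simp add: min_absorb1)
  have "sat (Bit x m) R M \<longleftrightarrow> (\<exists>a<?l. \<exists>b<?l. b < ?p \<and>
      R x = min a ?l * min (?p + min ?p ?l) ?l + min ?p ?l + min b ?l)"
    unfolding Bit_def using x(1,2) m(2) R3 powers[OF m(1)] by simp
  also have "\<dots> \<longleftrightarrow> (\<exists>a<?l. \<exists>b<?l. b < ?p \<and> R x = a * (?p + ?p) + ?p + b)"
    by (simp only: v cong: conj_cong)
  \<comment> \<open>Both \<open>a\<close> and \<open>b\<close> are at most \<open>R x\<close>, so
    the bounds on the quantifiers are no restriction.\<close>
  also have "\<dots> \<longleftrightarrow> (\<exists>a b. b < ?p \<and> R x = a * (?p + ?p) + ?p + b)"
  proof -
    have "a < 2 ^ L \<and> b < 2 ^ L" if "R x = a * (?p + ?p) + ?p + b" for a b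
    proof -
      have "a * 1 \<le> a * (?p + ?p)" by (intro mult_le_mono2) (simp add: Suc_leI)
      then show ?thesis using that x(3) R3 by linarith
    qed
    then show ?thesis by blast
  qed
  also have "\<dots> \<longleftrightarrow> bit (R x) (val m R M)" using bit_iff_decomposition by presburger
  finally show ?thesis .
qed

end

text \<open>All intermediate values are at most \<open>R 4 ^ m\<close>, hence within register
  \<open>3\<close>, and the caps on sums and products have no effect.\<close>

lemma val_Code:
  assumes "R 4 ^ m \<le> R 3" "\<And>y. b \<le> y \<Longrightarrow> y < b + m \<Longrightarrow> R y < R 4"
  shows "val (Code m b) R M = code (R 4) (map R [b..<b + m])"
  using assms
proof (induction m arbitrary: b)
  case (Suc m)
  have K: "0 < R 4" using Suc.prems(2)[of b] by simp
  have le: "R 4 ^ m \<le> R 4 ^ Suc m" using K by simp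
  have IH: "val (Code m (Suc b)) R M = code (R 4) (map R [Suc b..<Suc b + m])"
    using order_trans[OF le Suc.prems(1)] Suc.prems(2) by (intro Suc.IH) auto
  define c where "c = code (R 4) (map R [Suc b..<Suc b + m])"
  have "c < R 4 ^ length (map R [Suc b..<Suc b + m])"
    unfolding c_def using Suc.prems(2) by (intro code_less) auto
  then have lt: "c < R 4 ^ m" by (simp only: length_map length_upt diff_add_inverse)
  then have "R 4 * c \<le> R 4 * R 4 ^ m" by (intro mult_le_mono2) simp
  then have 1: "R 4 * c \<le> R 3" using Suc.prems(1) unfolding power_Suc by (rule order_trans)
  have 2: "c \<le> R 3" using lt le Suc.prems(1) by linarith
  have "R 4 * 1 \<le> R 4 * R 4 ^ m" using K by (intro mult_le_mono2) (simp add: Suc_leI)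
  then have 3: "R 4 \<le> R 3" using Suc.prems(1) unfolding power_Suc mult_1_right by (rule order_trans)
  have "[b..<b + Suc m] = b # [Suc b..<Suc b + m]" by (simp add: upt_conv_Cons)
  then show ?case using IH[folded c_def] 1 2 3 c_def by (simp add: min_absorb1 del: upt_Suc)
qed simp

lemma uses_below_Code: "4 < d \<Longrightarrow> b + m \<le> d \<Longrightarrow> uses_below (Code m b) d"
  by (induction m arbitrary: b) auto

lemma sat_Member:
  assumes l: "lists_at M a b (val t R M) xs" "length xs \<le> R 3" and R: "1 \<le> R 3"
    and t: "\<And>x. val t (R(14 := x)) M = val t R M" "\<And>x. val u (R(14 := x)) M = val u R M"
  shows "sat (Member a b t u) R M \<longleftrightarrow> val u R M \<in> set xs"
proof -
  have "sat (Member a b t u) R M \<longleftrightarrow>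
    (\<exists>p<R 3. M a (val t R M) + p < M a (Suc (val t R M)) \<and> M b (M a (val t R M) + p) = val u R M)"
    unfolding Member_def using t R by (auto simp: min_absorb1)
  also have "\<dots> \<longleftrightarrow> (\<exists>p<length xs. xs ! p = val u R M)"
    using l by (auto simp: lists_at_def intro: less_le_trans)
  finally show ?thesis by (auto simp: in_set_conv_nth)
qed

lemma val_Vertex:
  assumes "lists_at M 4 5 (R i) B" "2 \<le> R y" "R y < length B + 2" "length B \<le> R 3"
  shows "val (Vertex i y) R M = B ! (R y - 2)"
proof -
  have "R y - 2 < length B" using assms(2,3) by linarith
  moreover have "min (R y - Suc (Suc 0)) (R 3) = R y - 2" using assms by auto
  ultimately show ?thesis using assms(1) by (simp add: Vertex_def lists_at_def)
qed

lemma sat_In_bag: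
  assumes "lists_at M 4 5 (R i) B" "R y \<le> R 3" "1 \<le> R 3"
  shows "sat (In_bag i y) R M \<longleftrightarrow> 2 \<le> R y \<and> R y < length B + 2"
proof -
  have "min (R y - Suc (Suc 0)) (R 3) = R y - 2" using assms by auto
  then have "sat (In_bag i y) R M \<longleftrightarrow> 2 \<le> R y \<and> R y - 2 < length B"
    using assms(1,3) by (auto simp: In_bag_def In_range_def lists_at_def)
  then show ?thesis by linarith
qed

section \<open>The dynamic program as a formula\<close>

definition Keeps :: "nat \<Rightarrow> nat \<Rightarrow> nat \<Rightarrow> nat \<Rightarrow> expr" where
  "Keeps i j y z = Disj (Conj (In_bag j z) (Equal (Vertex j z) (Vertex i y)))
     (Conj (Equal (Reg z) (Num 0)) (Neg (Member 4 5 (Reg j) (Vertex i y))))"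

definition Forgets :: "nat \<Rightarrow> nat \<Rightarrow> nat \<Rightarrow> expr" where
  "Forgets i j z = Disj (Equal (Reg z) (Num 1))
     (Conj (In_bag j z) (Neg (Member 4 5 (Reg i) (Vertex j z))))"

text \<open>\<open>In_bag 5 y\<close> takes the place of the condition \<open>2 \<le> d\<close>. The
  two agree once the digit is in range, which \<open>Bag_ok\<close> ensures.\<close>

definition Join_digit :: "nat \<Rightarrow> nat \<Rightarrow> nat \<Rightarrow> expr" where
  "Join_digit y z u = Disj (Conj (Equal (Reg y) (Num 0)) (Conj (Equal (Reg z) (Num 0)) (Equal (Reg u) (Num 0))))
     (Disj (Conj (Equal (Reg y) (Num 1))
        (Disj (Conj (Forgets 5 6 z) (Equal (Reg u) (Num 0))) (Conj (Equal (Reg z) (Num 0)) (Forgets 5 7 u))))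
     (Conj (In_bag 5 y) (Conj (Keeps 5 6 y z) (Keeps 5 7 y u))))"

text \<open>An edge is guaranteed to be on the short list of one of its ends only, so both lists are
  searched.\<close>

definition Adjacent :: "expr \<Rightarrow> expr \<Rightarrow> expr" where
  "Adjacent t u = Disj (Member 8 9 t u) (Member 8 9 u t)"

text \<open>The pattern is fixed, so \<open>F h h'\<close> is decided while the formula is built,
  and only the resulting tests on the host graph remain.\<close>

definition Bag_ok :: "(nat \<Rightarrow> nat \<Rightarrow> bool) \<Rightarrow> nat \<Rightarrow> expr" where
  "Bag_ok F r = Conj (Conjs r (\<lambda>h. Disj (Less (Reg (30 + h)) (Num 2)) (In_bag 5 (30 + h))))
     (Conjs r (\<lambda>h. Conjs r (\<lambda>h'. if h = h' then Num 1 else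
        Disj (Less (Reg (30 + h)) (Num 2)) (Disj (Less (Reg (30 + h')) (Num 2))
          (Conj (Neg (Equal (Reg (30 + h)) (Reg (30 + h'))))
            (if F h h' then Adjacent (Vertex 5 (30 + h)) (Vertex 5 (30 + h'))
             else Neg (Adjacent (Vertex 5 (30 + h)) (Vertex 5 (30 + h')))))))))"

definition Joins :: "(nat \<Rightarrow> nat \<Rightarrow> bool) \<Rightarrow> nat \<Rightarrow> expr" where
  "Joins F r = Conj (Conjs r (\<lambda>h. Join_digit (30 + h) (30 + r + h) (30 + 2 * r + h)))
     (Conjs r (\<lambda>h. Conjs r (\<lambda>h'. if h = h' \<or> \<not> F h h' then Num 1 else
        Disj (Equal (Reg (30 + h)) (Num 0)) (Disj (Equal (Reg (30 + h')) (Num 0))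
        (Disj (Conj (Less (Num 0) (Reg (30 + r + h))) (Less (Num 0) (Reg (30 + r + h'))))
        (Disj (Conj (Less (Num 0) (Reg (30 + 2 * r + h))) (Less (Num 0) (Reg (30 + 2 * r + h'))))
          (Conj (Less (Num 1) (Reg (30 + h))) (Less (Num 1) (Reg (30 + h'))))))))))"

definition Exists_colour :: "expr \<Rightarrow> expr" where
  "Exists_colour e = Exists 11 (Conj (Less (Reg 11) (Num 2)) e)"

lemma sat_Exists_colour:
  "2 \<le> R 3 \<Longrightarrow> sat (Exists_colour e) R M \<longleftrightarrow> (\<exists>c<2. sat e (R(11 := c)) M)"
  by (auto simp: Exists_colour_def intro: less_le_trans)

lemma uses_below_Exists_colour: "uses_below e d \<Longrightarrow> 11 < d \<Longrightarrow> uses_below (Exists_colour e) d"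
  by (simp add: Exists_colour_def)

definition Bit_code :: "nat \<Rightarrow> nat \<Rightarrow> nat \<Rightarrow> expr" where
  "Bit_code r x b = Bit x (Plus (Plus (Code r b) (Code r b)) (Reg 11))"

definition Bit_digit :: "nat \<Rightarrow> nat \<Rightarrow> expr \<Rightarrow> expr" where
  "Bit_digit x y c = Bit x (Plus (Plus (Reg y) (Reg y)) c)"

definition Entry :: "(nat \<Rightarrow> nat \<Rightarrow> bool) \<Rightarrow> nat \<Rightarrow> expr" where
  "Entry F r = Conj (Bag_ok F r)
     (Conj (Conjs r (\<lambda>h. Disj (Less (Reg (30 + h)) (Num 2)) (Bit_digit 8 (30 + h) (Reg 11))))
       (Exists_digits r (30 + r) (Exists_digits r (30 + 2 * r)
         (Conj (Bit_code r 9 (30 + r)) (Conj (Bit_code r 10 (30 + 2 * r)) (Joins F r))))))"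

definition Transition :: "(nat \<Rightarrow> nat \<Rightarrow> bool) \<Rightarrow> nat \<Rightarrow> expr" where
  "Transition F r = Conj
     (Neg (Exists 15 (Conj (Less (Reg 15) (Reg 4)) (Conj (In_bag 5 15)
        (Iff (Bit_digit 8 15 (Num 0)) (Bit_digit 8 15 (Num 1)))))))
     (Neg (Exists_colour (Exists_digits r 30 (Neg (Iff (Bit_code r 8 30) (Entry F r))))))"

definition Step :: "(nat \<Rightarrow> nat \<Rightarrow> bool) \<Rightarrow> nat \<Rightarrow> expr" where
  "Step F r = Exists 9 (Exists 10 (Conj (Cell 12 (Plus (Cell 11 (Reg 6)) (Reg 9)))
     (Conj (Cell 12 (Plus (Cell 11 (Reg 7)) (Reg 10))) (Transition F r))))"

definition Accepts :: "nat \<Rightarrow> expr" where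
  "Accepts r = Neg (Exists_colour (Exists_digits r 30
     (Conj (Conjs r (\<lambda>h. Less (Num 0) (Reg (30 + h)))) (Bit_code r 8 30))))"

definition Answer :: "nat \<Rightarrow> expr" where
  "Answer r = Conj (Less (Num 1) (Reg 0))
     (Exists 8 (Conj (Cell 12 (Plus (Cell 11 (Reg 2)) (Reg 8))) (Accepts r)))"

lemma uses_below_Bit: "uses_below m d \<Longrightarrow> x < d \<Longrightarrow> 13 < d \<Longrightarrow> uses_below (Bit x m) d"
  by (simp add: Bit_def)

lemma uses_below_Vertex: "i < d \<Longrightarrow> y < d \<Longrightarrow> uses_below (Vertex i y) d"
  by (simp add: Vertex_def)

lemma uses_below_In_bag: "i < d \<Longrightarrow> y < d \<Longrightarrow> uses_below (In_bag i y) d"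
  by (simp add: In_bag_def In_range_def)

lemma uses_below_Member: "uses_below t d \<Longrightarrow> uses_below u d \<Longrightarrow> 14 < d \<Longrightarrow> uses_below (Member a b t u) d"
  by (simp add: Member_def)

lemmas uses_below_parts = uses_below_Bit uses_below_Vertex uses_below_In_bag uses_below_Member uses_below_Code

lemma uses_below_Joins: "uses_below (Joins F r) (30 + 3 * r)"
  by (auto simp: Joins_def Join_digit_def Keeps_def Forgets_def intro!: uses_below_parts)

lemma uses_below_Bag_ok: "uses_below (Bag_ok F r) (30 + 3 * r)"
  by (auto simp: Bag_ok_def Adjacent_def intro!: uses_below_parts)

lemma uses_below_Step: "uses_below (Step F r) (30 + 3 * r)"
  by (auto simp: Step_def Transition_def Entry_def Bit_code_def Bit_digit_def uses_below_Joins uses_below_Bag_ok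
      intro!: uses_below_parts uses_below_Exists_digits uses_below_Exists_colour)

lemma uses_below_Answer: "uses_below (Answer r) (30 + 3 * r)"
  by (auto simp: Answer_def Accepts_def Bit_code_def intro!: uses_below_parts uses_below_Exists_digits uses_below_Exists_colour)

lemma sat_Keeps:
  assumes B: "lists_at M 4 5 (R i) B" "length B + 2 \<le> R 3"
    and B': "lists_at M 4 5 (R j) B'" "length B' + 2 \<le> R 3"
    and y: "2 \<le> R y" "R y < length B + 2" and z: "R z \<le> R 3"
    and reg: "i < 14" "j < 14" "30 \<le> y"
  shows "sat (Keeps i j y z) R M \<longleftrightarrow> keeps B B' (R y) (R z)"
proof -
  have v: "val (Vertex i y) R M = B ! (R y - 2)" using B y by (intro val_Vertex) auto
  have v14: "val (Vertex i y) (R(14 := x)) M = val (Vertex i y) R M" for x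
    using reg by (simp add: Vertex_def)
  have m: "sat (Member 4 5 (Reg j) (Vertex i y)) R M \<longleftrightarrow> B ! (R y - 2) \<in> set B'"
    using B' v14 reg by (subst sat_Member) (auto simp: v)
  have b: "sat (In_bag j z) R M \<longleftrightarrow> 2 \<le> R z \<and> R z < length B' + 2"
    using B' z by (intro sat_In_bag) auto
  have z': "val (Vertex j z) R M = B' ! (R z - 2)" if "2 \<le> R z" "R z < length B' + 2"
    using B' that by (intro val_Vertex) auto
  show ?thesis by (auto simp: Keeps_def keeps_def m b v z')
qed

lemma sat_Forgets:
  assumes B: "lists_at M 4 5 (R i) B" "length B + 2 \<le> R 3"
    and B': "lists_at M 4 5 (R j) B'" "length B' + 2 \<le> R 3"
    and z: "R z \<le> R 3" and reg: "i < 14" "j < 14" "30 \<le> z"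
  shows "sat (Forgets i j z) R M \<longleftrightarrow> forgets B B' (R z)"
proof -
  have v14: "val (Vertex j z) (R(14 := x)) M = val (Vertex j z) R M" for x
    using reg by (simp add: Vertex_def)
  have m: "sat (Member 4 5 (Reg i) (Vertex j z)) R M \<longleftrightarrow> val (Vertex j z) R M \<in> set B"
    using B v14 reg by (subst sat_Member) auto
  have b: "sat (In_bag j z) R M \<longleftrightarrow> 2 \<le> R z \<and> R z < length B' + 2"
    using B' z by (intro sat_In_bag) auto
  have z': "val (Vertex j z) R M = B' ! (R z - 2)" if "2 \<le> R z" "R z < length B' + 2"
    using B' that by (intro val_Vertex) auto
  show ?thesis by (auto simp: Forgets_def forgets_def m b z')
qed

lemma val_Code_upd: "x \<noteq> 3 \<Longrightarrow> x \<noteq> 4 \<Longrightarrow> x < b \<Longrightarrow> val (Code m b) (R(x := a)) M = val (Code m b) R M"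
  by (induction m arbitrary: b) auto

section \<open>Correctness of the formulas\<close>

locale digits = pattern F E r + powers "2 * K ^ r" M
  for F E r K M +
  assumes K2: "2 \<le> K"
begin

definition N :: nat where "N = 2 ^ (2 * K ^ r)"

text \<open>These bounds keep digits and bit numbers within the range \<open>N\<close> of the
  quantifiers, and sums of them below the caps.\<close>

lemma K_le: "K \<le> K ^ r" "2 * K ^ r < N" "K < N"
proof -
  have "K ^ 1 \<le> K ^ r" using r_pos K2 by (intro power_increasing) auto
  then show 1: "K \<le> K ^ r" by simp
  show 2: "2 * K ^ r < N" unfolding N_def by (rule less_exp)
  show "K < N" using 1 2 K2 by linarith
qed

lemma sat_Bit_code:
  assumes "R 3 = N" "R 4 = K" "x \<in> {8, 9, 10}" "R x < N" "R 11 < 2" "30 \<le> b"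
    and d: "length d = r" "\<forall>x\<in>set d. x < K" "\<And>h. h < r \<Longrightarrow> R (b + h) = d ! h"
  shows "sat (Bit_code r x b) R M \<longleftrightarrow> bit (R x) (2 * code K d + R 11)"
proof -
  have "map R [b..<b + r] = d" using d by (auto intro!: nth_equalityI)
  moreover have "R y < R 4" if "b \<le> y" "y < b + r" for y
    using d(3)[of "y - b"] that d(1,2) assms(2) by auto
  ultimately have c: "val (Code r b) R M = code K d"
    using K_le assms(1,2) by (subst val_Code) auto
  have "code K d < K ^ r" using code_less[of d K] d by auto
  then have lt: "2 * code K d + R 11 < 2 * K ^ r" "code K d \<le> N" "R 11 \<le> N"
    using assms(5) K_le K2 by linarith+
  let ?m = "Plus (Plus (Code r b) (Code r b)) (Reg 11)"
  have v: "val ?m R M = 2 * code K d + R 11"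
    using c lt assms(1) by (simp add: min_absorb1)
  have "sat (Bit x ?m) R M \<longleftrightarrow> bit (R x) (val ?m R M)"
  proof (rule sat_Bit)
    show "val ?m (R(12 := a, 13 := b')) M = val ?m R M" for a b'
      using assms(6) by (simp add: val_Code_upd)
  qed (use assms lt v in \<open>auto simp: N_def\<close>)
  then show ?thesis by (simp only: Bit_code_def v)
qed

lemma sat_Bit_digit:
  assumes "R 3 = N" "x \<in> {8, 9, 10}" "R x < N" "y \<ge> 15" "R y < K" "val c R M < 2"
    "\<And>a b. val c (R(12 := a, 13 := b)) M = val c R M"
  shows "sat (Bit_digit x y c) R M \<longleftrightarrow> bit (R x) (2 * R y + val c R M)"
proof -
  have lt: "2 * R y + val c R M < 2 * K ^ r" "R y \<le> N" "val c R M \<le> N"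
    using assms K_le K2 by linarith+
  let ?m = "Plus (Plus (Reg y) (Reg y)) c"
  have v: "val ?m R M = 2 * R y + val c R M"
    using lt assms(1) by (simp add: min_absorb1)
  have "sat (Bit x ?m) R M \<longleftrightarrow> bit (R x) (val ?m R M)"
  proof (rule sat_Bit)
    show "val ?m (R(12 := a, 13 := b')) M = val ?m R M" for a b'
      using assms(4,7) by simp
  qed (use assms lt v in \<open>auto simp: N_def\<close>)
  then show ?thesis by (simp only: Bit_digit_def v)
qed

lemma sat_Accepts:
  assumes R: "R 3 = N" "R 4 = K" "R 8 < N"
  shows "sat (Accepts r) R M \<longleftrightarrow> accepts K (R 8)"
proof -
  let ?e = "Conj (Conjs r (\<lambda>h. Less (Num 0) (Reg (30 + h)))) (Bit_code r 8 30)"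
  have e: "sat ?e (writes (R(11 := c)) 30 d) M \<longleftrightarrow> (\<forall>h<r. d ! h \<noteq> 0) \<and> bit (R 8) (2 * code K d + c)"
    if "c < 2" "length d = r" "\<forall>x\<in>set d. x < K" for c d
  proof -
    define S where "S = writes (R(11 := c)) 30 d"
    have S: "S 3 = N" "S 4 = K" "S 8 = R 8" "S 11 = c" "\<And>h. h < r \<Longrightarrow> S (30 + h) = d ! h"
      using R that by (auto simp: S_def writes_apply)
    have "sat (Bit_code r 8 30) S M \<longleftrightarrow> bit (R 8) (2 * code K d + c)"
      using sat_Bit_code[of S 8 30 d] S R that by simp
    then show ?thesis using S(5) by (simp add: S_def)
  qed
  have "sat (Exists_digits r 30 ?e) (R(11 := c)) M \<longleftrightarrow>
     (\<exists>d. length d = r \<and> (\<forall>x\<in>set d. x < K) \<and> sat ?e (writes (R(11 := c)) 30 d) M)" for c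
    using R K_le by (subst sat_Exists_digits) auto
  then have "sat (Accepts r) R M \<longleftrightarrow> \<not> (\<exists>c<2. \<exists>d. length d = r \<and> (\<forall>x\<in>set d. x < K) \<and>
      sat ?e (writes (R(11 := c)) 30 d) M)"
    unfolding Accepts_def sat_simps(4) using sat_Exists_colour[of R] R K2 K_le(3) by simp
  then show ?thesis unfolding accepts_def digit_lists_def using e by blast
qed

end

text \<open>The memory at the time when the table of node \<open>i\<close> is computed.
  \<open>ups\<close> are the short neighbour lists; the bound on their lengths lets a quantifier
  reach every position in them.\<close>

locale step_environment = digits F E r K M
  for F E r K M +
  fixes ups :: "nat \<Rightarrow> nat list" and i i1 i2 :: nat and B B1 B2 :: "nat list"
  assumes K: "length B + 2 \<le> K" "length B1 + 2 \<le> K" "length B2 + 2 \<le> K"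
    and bags_at: "lists_at M 4 5 i B" "lists_at M 4 5 i1 B1" "lists_at M 4 5 i2 B2"
    and ups_at: "\<And>x. x \<in> set B \<Longrightarrow> lists_at M 8 9 x (ups x)"
    and ups_length: "\<And>x. x \<in> set B \<Longrightarrow> length (ups x) \<le> 2 ^ (2 * K ^ r)"
    and E_iff: "\<And>x y. x \<in> set B \<Longrightarrow> y \<in> set B \<Longrightarrow> E x y \<longleftrightarrow> y \<in> set (ups x) \<or> x \<in> set (ups y)"
begin

definition ready :: "(nat \<Rightarrow> nat) \<Rightarrow> nat \<Rightarrow> nat \<Rightarrow> nat \<Rightarrow> bool" where
  "ready R w w1 w2 \<longleftrightarrow> R 3 = N \<and> R 4 = K \<and> R 5 = i \<and> R 6 = i1 \<and> R 7 = i2 \<and>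
     R 8 = w \<and> R 9 = w1 \<and> R 10 = w2 \<and> w < N \<and> w1 < N \<and> w2 < N"

lemma sat_Bag_ok:
  assumes R: "ready R w w1 w2" and d: "length d = r" "\<forall>x\<in>set d. x < K" "\<And>h. h < r \<Longrightarrow> R (30 + h) = d ! h"
  shows "sat (Bag_ok F r) R M \<longleftrightarrow> bag_ok B d"
proof -
  have R3: "R 3 = N" "R 5 = i" using R by (auto simp: ready_def)
  have dK: "d ! h < K" if "h < r" for h using d that by auto
  have b: "sat (In_bag 5 (30 + h)) R M \<longleftrightarrow> 2 \<le> d ! h \<and> d ! h < length B + 2" if "h < r" for h
    using sat_In_bag[of M R 5 B "30 + h"] bags_at d(3)[OF that] dK[OF that] K K2 K_le R3 by simp
  have 1: "sat (Disj (Less (Reg (30 + h)) (Num 2)) (In_bag 5 (30 + h))) R M \<longleftrightarrow> d ! h < length B + 2" if "h < r" for h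
    using b[OF that] d(3)[OF that] by auto
  have adj: "sat (Adjacent (Vertex 5 (30 + h)) (Vertex 5 (30 + h'))) R M \<longleftrightarrow> E (B ! (d ! h - 2)) (B ! (d ! h' - 2))"
    if h: "h < r" "2 \<le> d ! h" "d ! h < length B + 2" and h': "h' < r" "2 \<le> d ! h'" "d ! h' < length B + 2" for h h'
  proof -
    have v: "val (Vertex 5 (30 + h)) R M = B ! (d ! h - 2)" "val (Vertex 5 (30 + h')) R M = B ! (d ! h' - 2)"
      using val_Vertex[of M R 5 B "30 + h"] val_Vertex[of M R 5 B "30 + h'"] bags_at d(3) that K K2 K_le R3 by auto
    have v14: "val (Vertex 5 (30 + h)) (R(14 := x)) M = val (Vertex 5 (30 + h)) R M" for h x
      by (simp add: Vertex_def)
    have "d ! h - 2 < length B" "d ! h' - 2 < length B" using that by linarith+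
    then have B: "B ! (d ! h - 2) \<in> set B" "B ! (d ! h' - 2) \<in> set B" by auto
    have "sat (Member 8 9 (Vertex 5 (30 + h)) (Vertex 5 (30 + h'))) R M \<longleftrightarrow> B ! (d ! h' - 2) \<in> set (ups (B ! (d ! h - 2)))"
      using ups_at[OF B(1)] ups_length[OF B(1)] v14 K K2 K_le R3 N_def by (subst sat_Member) (auto simp: v)
    moreover have "sat (Member 8 9 (Vertex 5 (30 + h')) (Vertex 5 (30 + h))) R M \<longleftrightarrow> B ! (d ! h - 2) \<in> set (ups (B ! (d ! h' - 2)))"
      using ups_at[OF B(2)] ups_length[OF B(2)] v14 K K2 K_le R3 N_def by (subst sat_Member) (auto simp: v)
    ultimately show ?thesis using E_iff[OF B] by (simp add: Adjacent_def)
  qed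
  have s1: "sat (Conjs r (\<lambda>h. Disj (Less (Reg (30 + h)) (Num 2)) (In_bag 5 (30 + h)))) R M \<longleftrightarrow>
      (\<forall>h<r. d ! h < length B + 2)"
    unfolding sat_Conjs using 1 by blast
  show ?thesis
  \<comment> \<open>\<open>Vertex\<close> is meaningful only for positions inside the bag. If some
    digit is out of range, both sides already fail in their first conjunct.\<close>
  proof (cases "\<forall>h<r. d ! h < length B + 2")
    case False
    then show ?thesis unfolding Bag_ok_def bag_ok_def sat_simps(5) s1 by blast
  next
    case True
    have 2: "sat (if h = h' then Num 1 else
        Disj (Less (Reg (30 + h)) (Num 2)) (Disj (Less (Reg (30 + h')) (Num 2))
          (Conj (Neg (Equal (Reg (30 + h)) (Reg (30 + h'))))
            (if F h h' then Adjacent (Vertex 5 (30 + h)) (Vertex 5 (30 + h'))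
             else Neg (Adjacent (Vertex 5 (30 + h)) (Vertex 5 (30 + h'))))))) R M \<longleftrightarrow>
       (h \<noteq> h' \<and> 2 \<le> d ! h \<and> 2 \<le> d ! h' \<longrightarrow>
        d ! h \<noteq> d ! h' \<and> (F h h' \<longleftrightarrow> E (B ! (d ! h - 2)) (B ! (d ! h' - 2))))"
      if "h < r" "h' < r" for h h'
      using adj[of h h'] that True d(3) by auto
    have "sat (Bag_ok F r) R M \<longleftrightarrow> (\<forall>h<r. d ! h < length B + 2) \<and> (\<forall>h<r. \<forall>h'<r.
       (h \<noteq> h' \<and> 2 \<le> d ! h \<and> 2 \<le> d ! h' \<longrightarrow>
        d ! h \<noteq> d ! h' \<and> (F h h' \<longleftrightarrow> E (B ! (d ! h - 2)) (B ! (d ! h' - 2)))))"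
      unfolding Bag_ok_def sat_simps(5) s1 unfolding sat_Conjs using 2 by blast
    then show ?thesis by (simp add: bag_ok_def)
  qed
qed

lemma sat_Joins:
  assumes R: "ready R w w1 w2"
    and d: "length d = r" "\<forall>x\<in>set d. x < K" "\<And>h. h < r \<Longrightarrow> R (30 + h) = d ! h"
    and e: "length e = r" "\<forall>x\<in>set e. x < K" "\<And>h. h < r \<Longrightarrow> R (30 + r + h) = e ! h"
    and f: "length f = r" "\<forall>x\<in>set f. x < K" "\<And>h. h < r \<Longrightarrow> R (30 + 2 * r + h) = f ! h"
    and ok: "\<And>h. h < r \<Longrightarrow> d ! h < length B + 2"
  shows "sat (Joins F r) R M \<longleftrightarrow> joins B B1 B2 d e f"
proof -
  have R3: "R 3 = N" "R 5 = i" "R 6 = i1" "R 7 = i2" using R by (auto simp: ready_def)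
  have dK: "d ! h < K" "e ! h < K" "f ! h < K" if "h < r" for h
    using d(1,2) e(1,2) f(1,2) that by (auto simp: all_set_conv_all_nth)
  have N: "d ! h \<le> N" "e ! h \<le> N" "f ! h \<le> N" if "h < r" for h
    using dK[OF that] K_le(3) by linarith+
  have NB: "length B + 2 \<le> N" "length B1 + 2 \<le> N" "length B2 + 2 \<le> N" "1 \<le> N" using K K2 K_le by linarith+
  have 1: "sat (Join_digit (30 + h) (30 + r + h) (30 + 2 * r + h)) R M \<longleftrightarrow>
    digit_join B B1 B2 (d ! h) (e ! h) (f ! h)" if h: "h < r" for h
  proof -
    note def = d(3)[OF h] e(3)[OF h] f(3)[OF h]
    have "sat (Forgets 5 6 (30 + r + h)) R M \<longleftrightarrow> forgets B B1 (e ! h)"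
      using sat_Forgets[of M R 5 B 6 B1 "30 + r + h"] bags_at R3 NB N[OF h] def by simp
    moreover have "sat (Forgets 5 7 (30 + 2 * r + h)) R M \<longleftrightarrow> forgets B B2 (f ! h)"
      using sat_Forgets[of M R 5 B 7 B2 "30 + 2 * r + h"] bags_at R3 NB N[OF h] def by simp
    moreover have "sat (In_bag 5 (30 + h)) R M \<longleftrightarrow> 2 \<le> d ! h"
      using sat_In_bag[of M R 5 B "30 + h"] bags_at R3 NB N[OF h] def ok[OF h] by simp
    moreover have "sat (Keeps 5 6 (30 + h) (30 + r + h)) R M \<longleftrightarrow> keeps B B1 (d ! h) (e ! h)" if "2 \<le> d ! h"
      using sat_Keeps[of M R 5 B 6 B1 "30 + h" "30 + r + h"] bags_at R3 NB N[OF h] def ok[OF h] that by simp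
    moreover have "sat (Keeps 5 7 (30 + h) (30 + 2 * r + h)) R M \<longleftrightarrow> keeps B B2 (d ! h) (f ! h)" if "2 \<le> d ! h"
      using sat_Keeps[of M R 5 B 7 B2 "30 + h" "30 + 2 * r + h"] bags_at R3 NB N[OF h] def ok[OF h] that by simp
    ultimately show ?thesis
      unfolding Join_digit_def digit_join_def sat_simps val.simps def by (auto simp only:)
  qed
  have 2: "sat (if h = h' \<or> \<not> F h h' then Num 1 else
        Disj (Equal (Reg (30 + h)) (Num 0)) (Disj (Equal (Reg (30 + h')) (Num 0))
        (Disj (Conj (Less (Num 0) (Reg (30 + r + h))) (Less (Num 0) (Reg (30 + r + h'))))
        (Disj (Conj (Less (Num 0) (Reg (30 + 2 * r + h))) (Less (Num 0) (Reg (30 + 2 * r + h'))))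
          (Conj (Less (Num 1) (Reg (30 + h))) (Less (Num 1) (Reg (30 + h')))))))) R M \<longleftrightarrow>
     (h \<noteq> h' \<and> F h h' \<and> d ! h \<noteq> 0 \<and> d ! h' \<noteq> 0 \<longrightarrow>
        e ! h \<noteq> 0 \<and> e ! h' \<noteq> 0 \<or> f ! h \<noteq> 0 \<and> f ! h' \<noteq> 0 \<or> 2 \<le> d ! h \<and> 2 \<le> d ! h')"
    if "h < r" "h' < r" for h h'
    using d(3) e(3) f(3) that by auto
  show ?thesis unfolding Joins_def joins_def sat_simps(5) sat_Conjs using 1 2 by simp
qed

lemma sat_Entry:
  assumes R: "ready R w w1 w2" and c: "c < 2" and d: "length d = r" "\<forall>x\<in>set d. x < K"
  shows "sat (Iff (Bit_code r 8 30) (Entry F r)) (writes (R(11 := c)) 30 d) M \<longleftrightarrow>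
    (bit w (2 * code K d + c) \<longleftrightarrow> entry K B B1 B2 w w1 w2 c d)"
proof -
  have R3: "w < N" using R by (simp add: ready_def)
  define S where "S = writes (R(11 := c)) 30 d"
  have S: "ready S w w1 w2" "S 11 = c" "\<And>h. h < r \<Longrightarrow> S (30 + h) = d ! h"
    using R d by (auto simp: S_def ready_def writes_apply)
  have S3: "S 3 = N" "S 4 = K" "S 8 = w" using S by (auto simp: ready_def)
  have 1: "sat (Bit_code r 8 30) S M \<longleftrightarrow> bit w (2 * code K d + c)"
    using sat_Bit_code[of S 8 30 d] S S3 R3 c d by simp
  have 2: "sat (Bag_ok F r) S M \<longleftrightarrow> bag_ok B d"
    using sat_Bag_ok[OF S(1) d S(3)] .
  have 3: "sat (Disj (Less (Reg (30 + h)) (Num 2)) (Bit_digit 8 (30 + h) (Reg 11))) S M \<longleftrightarrow>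
    (2 \<le> d ! h \<longrightarrow> bit w (2 * (d ! h) + c))" if "h < r" for h
  proof -
    have "d ! h < K" using d that by auto
    then show ?thesis
      using sat_Bit_digit[of S 8 "30 + h" "Reg 11"] S(2,3) S3 R3 c that by auto
  qed
  \<comment> \<open>\<open>bag_ok\<close> supplies the range condition of \<open>sat_Joins\<close>.
    It may be assumed here because it is another conjunct of the entry.\<close>
  have 4: "sat (Exists_digits r (30 + r) (Exists_digits r (30 + 2 * r)
          (Conj (Bit_code r 9 (30 + r)) (Conj (Bit_code r 10 (30 + 2 * r)) (Joins F r))))) S M \<longleftrightarrow>
    (\<exists>e\<in>digit_lists K. \<exists>f\<in>digit_lists K. bit w1 (2 * code K e + c) \<and>
         bit w2 (2 * code K f + c) \<and> joins B B1 B2 d e f)" if ok: "bag_ok B d"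
  proof -
    have inner: "sat (Conj (Bit_code r 9 (30 + r)) (Conj (Bit_code r 10 (30 + 2 * r)) (Joins F r)))
        (writes (writes S (30 + r) e) (30 + 2 * r) f) M \<longleftrightarrow>
       bit w1 (2 * code K e + c) \<and> bit w2 (2 * code K f + c) \<and> joins B B1 B2 d e f"
      if e: "length e = r" "\<forall>x\<in>set e. x < K" and f: "length f = r" "\<forall>x\<in>set f. x < K" for e f
    proof -
      define U where "U = writes (writes S (30 + r) e) (30 + 2 * r) f"
      have U: "ready U w w1 w2" "U 11 = c" "\<And>h. h < r \<Longrightarrow> U (30 + h) = d ! h"
        "\<And>h. h < r \<Longrightarrow> U (30 + r + h) = e ! h" "\<And>h. h < r \<Longrightarrow> U (30 + 2 * r + h) = f ! h"
        using S e f by (auto simp: U_def ready_def writes_apply)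
      have U3: "U 3 = N" "U 4 = K" "U 9 = w1" "U 10 = w2" "w1 < N" "w2 < N"
        using U by (auto simp: ready_def)
      have "sat (Bit_code r 9 (30 + r)) U M \<longleftrightarrow> bit w1 (2 * code K e + c)"
        using sat_Bit_code[of U 9 "30 + r" e] U(2,4) U3 c e by simp
      moreover have "sat (Bit_code r 10 (30 + 2 * r)) U M \<longleftrightarrow> bit w2 (2 * code K f + c)"
        using sat_Bit_code[of U 10 "30 + 2 * r" f] U(2,5) U3 c f by simp
      moreover have "sat (Joins F r) U M \<longleftrightarrow> joins B B1 B2 d e f"
        using sat_Joins[OF U(1) d U(3) e U(4) f U(5)] ok by (simp add: bag_ok_def)
      ultimately show ?thesis by (simp add: U_def)
    qed
    have "sat (Exists_digits r (30 + r) (Exists_digits r (30 + 2 * r)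
          (Conj (Bit_code r 9 (30 + r)) (Conj (Bit_code r 10 (30 + 2 * r)) (Joins F r))))) S M \<longleftrightarrow>
      (\<exists>e. length e = r \<and> (\<forall>x\<in>set e. x < K) \<and> sat (Exists_digits r (30 + 2 * r)
          (Conj (Bit_code r 9 (30 + r)) (Conj (Bit_code r 10 (30 + 2 * r)) (Joins F r)))) (writes S (30 + r) e) M)"
      using S3 K_le by (subst sat_Exists_digits) auto
    also have "\<dots> \<longleftrightarrow> (\<exists>e. length e = r \<and> (\<forall>x\<in>set e. x < K) \<and> (\<exists>f. length f = r \<and> (\<forall>x\<in>set f. x < K) \<and>
       sat (Conj (Bit_code r 9 (30 + r)) (Conj (Bit_code r 10 (30 + 2 * r)) (Joins F r)))
        (writes (writes S (30 + r) e) (30 + 2 * r) f) M))"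
      using S3 K_le by (subst sat_Exists_digits) (auto simp: writes_apply)
    also have "\<dots> \<longleftrightarrow> (\<exists>e. length e = r \<and> (\<forall>x\<in>set e. x < K) \<and> (\<exists>f. length f = r \<and> (\<forall>x\<in>set f. x < K) \<and>
       bit w1 (2 * code K e + c) \<and> bit w2 (2 * code K f + c) \<and> joins B B1 B2 d e f))"
      using inner by blast
    finally show ?thesis by (auto simp: digit_lists_def)
  qed
  have cs: "sat (Conjs r (\<lambda>h. Disj (Less (Reg (30 + h)) (Num 2)) (Bit_digit 8 (30 + h) (Reg 11)))) S M \<longleftrightarrow>
    (\<forall>h<r. 2 \<le> d ! h \<longrightarrow> bit w (2 * (d ! h) + c))"
    unfolding sat_Conjs using 3 by blast
  show ?thesis unfolding S_def[symmetric] Entry_def entry_def sat_simps(5,8) 1 2 cs using 4 by blast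
qed

lemma sat_Transition:
  assumes R: "ready R w w1 w2"
  shows "sat (Transition F r) R M \<longleftrightarrow> transition K B B1 B2 w w1 w2"
proof -
  have R3: "R 3 = N" "R 4 = K" "R 5 = i" "R 8 = w" "w < N" using R by (auto simp: ready_def)
  have part1: "sat (Conj (In_bag 5 15) (Iff (Bit_digit 8 15 (Num 0)) (Bit_digit 8 15 (Num 1)))) (R(15 := x)) M \<longleftrightarrow>
    2 \<le> x \<and> x < length B + 2 \<and> bit w (2 * x) = bit w (2 * x + 1)" if "x < K" for x
  proof -
    have "sat (In_bag 5 15) (R(15 := x)) M \<longleftrightarrow> 2 \<le> x \<and> x < length B + 2"
      using sat_In_bag[of M "R(15 := x)" 5 B 15] bags_at R3 that K_le K K2 by simp
    moreover have "sat (Bit_digit 8 15 (Num c)) (R(15 := x)) M \<longleftrightarrow> bit w (2 * x + c)" if "c < 2" for c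
      using sat_Bit_digit[of "R(15 := x)" 8 15 "Num c"] R3 \<open>x < K\<close> that by simp
    ultimately show ?thesis by simp
  qed
  have part2: "sat (Neg (Iff (Bit_code r 8 30) (Entry F r))) (writes (R(11 := c)) 30 d) M \<longleftrightarrow>
     \<not> (bit w (2 * code K d + c) \<longleftrightarrow> entry K B B1 B2 w w1 w2 c d)"
    if "c < 2" "length d = r" "\<forall>x\<in>set d. x < K" for c d
    unfolding sat_simps(4) using sat_Entry[OF R that] by blast
  have "sat (Transition F r) R M \<longleftrightarrow>
     \<not> (\<exists>x<N. x < K \<and> 2 \<le> x \<and> x < length B + 2 \<and> bit w (2 * x) = bit w (2 * x + 1)) \<and>
     \<not> (\<exists>c<2. \<exists>d. length d = r \<and> (\<forall>x\<in>set d. x < K) \<and>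
       \<not> (bit w (2 * code K d + c) \<longleftrightarrow>
        entry K B B1 B2 w w1 w2 c d))"
  proof -
    have 1: "sat (Exists 15 (Conj (Less (Reg 15) (Reg 4)) (Conj (In_bag 5 15)
        (Iff (Bit_digit 8 15 (Num 0)) (Bit_digit 8 15 (Num 1)))))) R M \<longleftrightarrow>
        (\<exists>x<N. x < K \<and> 2 \<le> x \<and> x < length B + 2 \<and> bit w (2 * x) = bit w (2 * x + 1))"
      using part1 R3 by (auto simp del: sat_simps(8))
    let ?e = "Neg (Iff (Bit_code r 8 30) (Entry F r))"
    have "sat (Exists_digits r 30 ?e) (R(11 := c)) M \<longleftrightarrow>
       (\<exists>d. length d = r \<and> (\<forall>x\<in>set d. x < K) \<and> sat ?e (writes (R(11 := c)) 30 d) M)" for c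
      using R3 K_le by (subst sat_Exists_digits) auto
    then have 2: "sat (Exists_colour (Exists_digits r 30 ?e)) R M \<longleftrightarrow>
       (\<exists>c<2. \<exists>d. length d = r \<and> (\<forall>x\<in>set d. x < K) \<and> sat ?e (writes (R(11 := c)) 30 d) M)"
      using sat_Exists_colour[of R] R3 K2 K_le(3) by simp
    show ?thesis unfolding Transition_def sat_simps(5) sat_simps(4)[of "Exists a b" for a b]
      sat_simps(4)[of "Exists_colour a" for a] 1 2 using part2 by blast
  qed
  moreover have "x < N" if "x < K" for x using that K_le by linarith
  ultimately show ?thesis unfolding transition_def digit_lists_def by blast
qed

end

section \<open>Reading lists of lists from arrays\<close>

lemma offsets_nth: "i \<le> length xss \<Longrightarrow> offsets xss ! i = length (concat (take i xss))"
  by (auto simp: offsets_def nth_append simp del: upt_Suc)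

lemma length_offsets: "length (offsets xss) = Suc (length xss)"
  by (simp add: offsets_def)

lemma concat_nth_offset:
  assumes "i < length xss" "p < length (xss ! i)"
  shows "length (concat (take i xss)) + p < length (concat xss)"
    "concat xss ! (length (concat (take i xss)) + p) = xss ! i ! p"
proof -
  have "xss = take i xss @ xss ! i # drop (Suc i) xss" using assms(1) by (rule id_take_nth_drop)
  then have c: "concat xss = concat (take i xss) @ xss ! i @ concat (drop (Suc i) xss)"
    by (metis concat.simps(2) concat_append)
  show "length (concat (take i xss)) + p < length (concat xss)" using arg_cong[OF c, of length] assms(2) by simp
  show "concat xss ! (length (concat (take i xss)) + p) = xss ! i ! p"
    using assms(2) by (subst c) (simp add: nth_append)
qed

lemma concat_take_Suc: "i < length xss \<Longrightarrow> concat (take (Suc i) xss) = concat (take i xss) @ xss ! i"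
  by (simp add: take_Suc_conv_app_nth)

lemma lists_atI:
  assumes "\<And>i. i \<le> length xss \<Longrightarrow> M a i = length (concat (take i xss))"
    and "\<And>p. p < length (concat xss) \<Longrightarrow> M b p = concat xss ! p" and "i < length xss"
  shows "lists_at M a b i (xss ! i)"
  unfolding lists_at_def using assms concat_nth_offset[OF assms(3)]
  by (auto simp: concat_take_Suc)

lemma cells_nth: "i < length xs \<Longrightarrow> cells xs i = xs ! i"
  by (simp add: cells_def)

lemma lists_at_cells:
  assumes "M a = cells (offsets xss)" "M b = cells (concat xss)" "i < length xss"
  shows "lists_at M a b i (xss ! i)"
  using assms by (intro lists_atI) (simp_all add: cells_nth length_offsets offsets_nth)

text \<open>Index \<open>length xss\<close> stands for an empty list, because the cells behind the offsets are \<open>0\<close>.\<close>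

lemma lists_at_cells_end:
  assumes "M a = cells (offsets xss)"
  shows "lists_at M a b (length xss) []"
  using assms by (simp add: lists_at_def cells_def length_offsets)

lemma cells_offsets: "i \<le> length xss \<Longrightarrow> cells (offsets xss) i = length (concat (take i xss))"
  by (simp add: cells_nth length_offsets offsets_nth)

lemma cells_concat:
  assumes "i < length xss" "p < length (xss ! i)"
  shows "cells (concat xss) (length (concat (take i xss)) + p) = xss ! i ! p"
  using concat_nth_offset[OF assms] by (simp add: cells_nth)

section \<open>Preprocessing programs\<close>

text \<open>Array \<open>6\<close> is the queue itself, with reading end in register
  \<open>16\<close> and writing end in register \<open>17\<close>. Nodes are not marked as visited,
  since each is the child of at most one node.\<close>

definition Bfs :: com where
  "Bfs = SET 16 0 ;; SET 17 1 ;; SET 18 0 ;; STORE 6 18 2 ;;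
     LOOP 16 1 (LOAD 18 6 16 ;; LOAD 19 2 18 ;; INC 18 ;; LOAD 20 2 18 ;;
       LOOP 19 20 (LOAD 21 3 19 ;; STORE 6 17 21 ;; INC 17))"

text \<open>Nodes are visited in reverse breadth-first order, so the value that survives for a
  vertex is the smallest position. Meanwhile register \<open>4\<close> becomes the largest bag size
  plus two, which is \<open>K\<close>.\<close>

definition Tops :: com where
  "Tops = SET 4 2 ;; COPY 16 1 ;; SET 17 0 ;;
     LOOP 17 1 (DEC 16 ;; LOAD 18 6 16 ;; LOAD 19 4 18 ;; INC 18 ;; LOAD 20 4 18 ;; SET 21 2 ;;
       LOOP 19 20 (LOAD 22 5 19 ;; STORE 7 22 16 ;; INC 21) ;;
       IF (LESS 4 21) (COPY 4 21) (SET 22 0))"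

text \<open>The offset of each list is written before its entries; the final \<open>STORE\<close>
  adds the total length, which ends the list of the last vertex.\<close>

definition Ups :: com where
  "Ups = SET 16 0 ;; SET 17 0 ;;
     LOOP 16 0 (STORE 8 16 17 ;; LOAD 18 7 16 ;; LOAD 19 0 16 ;; COPY 20 16 ;; INC 20 ;; LOAD 20 0 20 ;;
       LOOP 19 20 (LOAD 21 1 19 ;; LOAD 22 7 21 ;; IF (LESS 18 22) (SET 22 0) (STORE 9 17 21 ;; INC 17))) ;;
     STORE 8 16 17"

section \<open>Breadth-first order, topmost nodes and short neighbour lists\<close>

text \<open>The rooted tree as plain data. \<open>all_descend\<close> expresses reachability from
  the root as an induction over sets closed under children.\<close>

locale layout =
  fixes adj ch bag :: "nat list list" and \<rho> :: nat
  assumes length_bag: "length bag = length ch" and root: "\<rho> < length ch"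
    and ch: "\<And>i. i < length ch \<Longrightarrow> distinct (ch ! i) \<and> set (ch ! i) \<subseteq> {..<length ch} \<and> length (ch ! i) \<le> 2"
    and unique_parent: "\<And>i i' j. i < length ch \<Longrightarrow> i' < length ch \<Longrightarrow> j \<in> set (ch ! i) \<Longrightarrow> j \<in> set (ch ! i') \<Longrightarrow> i = i'"
    and root_no_parent: "\<And>i. i < length ch \<Longrightarrow> \<rho> \<notin> set (ch ! i)"
    and all_descend: "\<And>S. \<rho> \<in> S \<Longrightarrow> (\<And>i. i \<in> S \<Longrightarrow> i < length ch \<Longrightarrow> set (ch ! i) \<subseteq> S) \<Longrightarrow> {..<length ch} \<subseteq> S"
    and bag: "\<And>i. i < length bag \<Longrightarrow> distinct (bag ! i) \<and> set (bag ! i) \<subseteq> {..<length adj}"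
    and adj: "\<And>v. v < length adj \<Longrightarrow> set (adj ! v) \<subseteq> {..<length adj}"
begin

primrec queue :: "nat \<Rightarrow> nat list" where
  "queue 0 = [\<rho>]"
| "queue (Suc h) = queue h @ ch ! (queue h ! h)"

text \<open>The essential claim is that the queue never runs empty too early: if it did, its nodes
  would be closed under children and contain the root, so by \<open>all_descend\<close> it would
  already contain all nodes. There are no repetitions, because parents are unique and the root has
  none.\<close>

lemma queue_invariant:
  assumes "h \<le> length ch"
  shows "distinct (queue h) \<and> set (queue h) \<subseteq> {..<length ch} \<and> h \<le> length (queue h) \<and>
    (h < length ch \<longrightarrow> h < length (queue h)) \<and>
    (\<forall>j\<in>set (queue h). j = \<rho> \<or> (\<exists>a<h. j \<in> set (ch ! (queue h ! a)))) \<and> \<rho> \<in> set (queue h) \<and>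
    (\<forall>a<h. \<forall>j\<in>set (ch ! (queue h ! a)). \<exists>b<length (queue h). a < b \<and> queue h ! b = j)"
  using assms
proof (induction h)
  case (Suc h)
  then have h: "h < length ch" by simp
  let ?q = "queue h"
  have IH: "distinct ?q" "set ?q \<subseteq> {..<length ch}" "h < length ?q"
    "\<And>j. j \<in> set ?q \<Longrightarrow> j = \<rho> \<or> (\<exists>a<h. j \<in> set (ch ! (?q ! a)))" "\<rho> \<in> set ?q"
    "\<And>a j. a < h \<Longrightarrow> j \<in> set (ch ! (?q ! a)) \<Longrightarrow> \<exists>b<length ?q. a < b \<and> ?q ! b = j"
    using Suc.IH h by auto
  have qh: "?q ! a < length ch" if "a < length ?q" for a using IH(2) that nth_mem by blast
  let ?new = "ch ! (?q ! h)"
  have new: "distinct ?new" "set ?new \<subseteq> {..<length ch}" using ch[OF qh[OF IH(3)]] by auto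
  have disj: "set ?q \<inter> set ?new = {}"
  proof (rule ccontr)
    assume "set ?q \<inter> set ?new \<noteq> {}"
    then obtain j where j: "j \<in> set ?q" "j \<in> set ?new" by blast
    have "j \<noteq> \<rho>" using root_no_parent[OF qh[OF IH(3)]] j by blast
    then obtain a where a: "a < h" "j \<in> set (ch ! (?q ! a))" using IH(4)[OF j(1)] by blast
    then have "?q ! a = ?q ! h" using unique_parent[of "?q ! a" "?q ! h" j] j qh IH(3) by auto
    then show False using IH(1,3) a(1) nth_eq_iff_index_eq[of ?q a h] by auto
  qed
  let ?q' = "queue (Suc h)"
  have nth: "?q' ! a = ?q ! a" if "a < length ?q" for a using that by (simp add: nth_append)
  have d: "distinct ?q'" using IH(1) new disj by auto
  have s: "set ?q' \<subseteq> {..<length ch}" using IH(2) new by auto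
  have par: "j = \<rho> \<or> (\<exists>a<Suc h. j \<in> set (ch ! (?q' ! a)))" if "j \<in> set ?q'" for j
  proof (cases "j \<in> set ?q")
    case True
    then consider "j = \<rho>" | a where "a < h" "j \<in> set (ch ! (?q ! a))" using IH(4) by blast
    then show ?thesis
    proof cases
      case 2
      then have "j \<in> set (ch ! (?q' ! a))" using nth[of a] IH(3) by simp
      then show ?thesis using 2 by (meson less_SucI)
    qed simp
  next
    case False
    then have "j \<in> set (ch ! (?q' ! h))" using that nth[of h] IH(3) by simp
    then show ?thesis by blast
  qed
  have ord: "\<exists>b<length ?q'. a < b \<and> ?q' ! b = j" if a: "a < Suc h" and j: "j \<in> set (ch ! (?q' ! a))" for a j
  proof (cases "a = h")
    case True
    then have "j \<in> set ?new" using j nth IH(3) by simp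
    then obtain p where "p < length ?new" "?new ! p = j" by (auto simp: in_set_conv_nth)
    then show ?thesis using True IH(3) by (intro exI[of _ "length ?q + p"]) (auto simp: nth_append)
  next
    case False
    then obtain b where b: "b < length ?q" "a < b" "?q ! b = j"
      using IH(6)[of a j] a j nth IH(3) by auto
    then show ?thesis using nth by (intro exI[of _ b]) auto
  qed
  have le: "Suc h < length ?q'" if lt: "Suc h < length ch"
  proof (rule ccontr)
    assume "\<not> Suc h < length ?q'"
    then have len: "length ?q' = Suc h" using IH(3) by simp
    have "{..<length ch} \<subseteq> set ?q'"
    proof (rule all_descend)
      show "\<rho> \<in> set ?q'" using IH(5) by simp
      fix i assume "i \<in> set ?q'"
      then obtain a where "a < Suc h" "?q' ! a = i" using len by (metis in_set_conv_nth)
      then show "set (ch ! i) \<subseteq> set ?q'" using ord by (metis nth_mem subsetI)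
    qed
    then have "length ch \<le> card (set ?q')" by (metis card_lessThan card_mono finite_set)
    then show False using lt len card_length[of ?q'] by simp
  qed
  have "Suc h \<le> length ?q'" using IH(3) by simp
  moreover have "\<rho> \<in> set ?q'" using IH(5) by simp
  ultimately show ?case using d s par ord le by blast
qed (use root in auto)

definition order :: "nat list" where "order = queue (length ch)"

lemma order: "distinct order" "set order = {..<length ch}" "length order = length ch"
  "\<And>a j. a < length ch \<Longrightarrow> j \<in> set (ch ! (order ! a)) \<Longrightarrow> \<exists>b<length ch. a < b \<and> order ! b = j"
proof -
  note q = queue_invariant[OF order_refl, folded order_def]
  show d: "distinct order" using q by blast
  have "length order = card (set order)" using d by (simp add: distinct_card)
  also have "\<dots> \<le> card {..<length ch}" using q by (intro card_mono) auto
  finally show l: "length order = length ch" using q by simp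
  show "set order = {..<length ch}"
    using q l d by (intro card_subset_eq) (auto simp: distinct_card)
  show "\<exists>b<length ch. a < b \<and> order ! b = j" if "a < length ch" "j \<in> set (ch ! (order ! a))" for a j
    using q l that by simp
qed

lemma run_Bfs:
  assumes "R 1 = length ch" "R 2 = \<rho>" "M 2 = cells (offsets ch)" "M 3 = cells (concat ch)"
  shows "run Bfs (\<lambda>n' R' M'. n' \<le> n + 17 * length ch + 5 \<and> (\<forall>y<16. R' y = R y) \<and>
    (\<forall>c. c \<noteq> 6 \<longrightarrow> M' c = M c) \<and> (\<forall>a<length ch. M' 6 a = order ! a)) n R M"
proof -
  let ?I = "\<lambda>h R' M'. R' 17 = length (queue h) \<and> (\<forall>a<length (queue h). M' 6 a = queue h ! a) \<and>
     (\<forall>y<16. R' y = R y) \<and> (\<forall>c. c \<noteq> 6 \<longrightarrow> M' c = M c)"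
  show ?thesis unfolding Bfs_def run_SEQ run_atom
  \<comment> \<open>The \<open>15\<close> consists of four steps before the inner loop, at most two
    children at five steps each, and the last test.\<close>
  proof (rule run_LOOP_const[where lo=0 and hi="length ch" and b=15 and I="?I"])
    fix h n R' M' assume h: "h < length ch" and R': "R' 16 = h" "R' 1 = length ch" and I: "?I h R' M'"
    have hq: "h < length (queue h)" "queue h ! h < length ch"
      using queue_invariant[of h] h nth_mem by (auto simp: subset_iff)
    let ?i = "queue h ! h"
    let ?lo = "length (concat (take ?i ch))" and ?hi = "length (concat (take (Suc ?i) ch))"
    have hi: "?hi = ?lo + length (ch ! ?i)" using hq by (simp add: concat_take_Suc)
    have lt: "length (ch ! ?i) \<le> 2" using ch hq by blast
    let ?J = "\<lambda>x R'' M''. R'' 17 = length (queue h) + (x - ?lo) \<and>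
      (\<forall>a<length (queue h) + (x - ?lo). M'' 6 a = queue (Suc h) ! a) \<and>
      (\<forall>y<16. R'' y = R y) \<and> (\<forall>c. c \<noteq> 6 \<longrightarrow> M'' c = M c) \<and> R'' 16 = h"
    have M: "M' 2 ?i = ?lo" "M' 2 (Suc ?i) = ?hi" "M' 6 h = ?i"
      using I assms hq by (simp_all add: cells_offsets)
    show "run (LOAD 18 6 16 ;; LOAD 19 2 18 ;; INC 18 ;; LOAD 20 2 18 ;;
        LOOP 19 20 (LOAD 21 3 19 ;; STORE 6 17 21 ;; INC 17))
      (\<lambda>n' R'' M''. n' \<le> n + 15 \<and> R'' 16 = h \<and> R'' 1 = length ch \<and> ?I (Suc h) (R''(16 := Suc h)) M'') n R' M'"
      unfolding run_SEQ run_atom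
    proof (rule run_LOOP_const[where lo="?lo" and hi="?hi" and b=3 and I="?J"])
      fix x n' R'' M'' assume x: "?lo \<le> x" "x < ?hi" "R'' 19 = x" "R'' 20 = ?hi" and J: "?J x R'' M''"
      let ?p = "x - ?lo"
      have p: "?p < length (ch ! ?i)" "x = ?lo + ?p" using x hi by auto
      have "M'' 3 x = ch ! ?i ! ?p" using J assms p cells_concat[of ?i ch ?p] hq by simp
      moreover have "queue (Suc h) ! (length (queue h) + ?p) = ch ! ?i ! ?p"
        by (simp add: nth_append)
      ultimately show "run (LOAD 21 3 19 ;; STORE 6 17 21 ;; INC 17)
        (\<lambda>n'' R''' M'''. n'' \<le> n' + 3 \<and> R''' 19 = x \<and> R''' 20 = ?hi \<and> ?J (Suc x) (R'''(19 := Suc x)) M''') n' R'' M''"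
        using J x by (auto simp: Suc_diff_le less_Suc_eq)
    qed (use I R' M hi lt hq assms in \<open>auto simp: nth_append\<close>)
  qed (use assms in \<open>auto simp: order_def\<close>, use queue_invariant[of "length ch"] in auto)
qed

text \<open>For \<open>lo = 0\<close> this is the position of the topmost node of \<open>v\<close>.
  The general form serves the reverse traversal, which has seen only the positions from
  \<open>lo\<close> on.\<close>

definition topmost :: "nat \<Rightarrow> nat \<Rightarrow> nat \<Rightarrow> bool" where
  "topmost lo v m \<longleftrightarrow> lo \<le> m \<and> m < length ch \<and> v \<in> set (bag ! (order ! m)) \<and>
     (\<forall>a<m. lo \<le> a \<longrightarrow> v \<notin> set (bag ! (order ! a)))"

lemma run_Tops:
  assumes "R 1 = length ch" "M 4 = cells (offsets bag)" "M 5 = cells (concat bag)"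
    and ord: "\<And>a. a < length ch \<Longrightarrow> M 6 a = order ! a"
    and t: "\<And>i. i < length bag \<Longrightarrow> length (bag ! i) \<le> t"
  shows "run Tops (\<lambda>n' R' M'. n' \<le> n + length ch * (5 * t + 11) + 4 \<and> (\<forall>y<16. y \<noteq> 4 \<longrightarrow> R' y = R y) \<and>
    (\<forall>c. c \<noteq> 7 \<longrightarrow> M' c = M c) \<and> 2 \<le> R' 4 \<and> R' 4 \<le> t + 2 \<and>
    (\<forall>i<length bag. length (bag ! i) + 2 \<le> R' 4) \<and>
    (\<forall>v. (\<exists>i<length bag. v \<in> set (bag ! i)) \<longrightarrow> topmost 0 v (M' 7 v))) n R M"
proof -
  let ?n = "length ch"
  let ?I = "\<lambda>x R' M'. R' 16 = ?n - x \<and> (\<forall>y<16. y \<noteq> 4 \<longrightarrow> R' y = R y) \<and> (\<forall>c. c \<noteq> 7 \<longrightarrow> M' c = M c) \<and>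
    2 \<le> R' 4 \<and> R' 4 \<le> t + 2 \<and>
    (\<forall>a. ?n - x \<le> a \<longrightarrow> a < ?n \<longrightarrow> length (bag ! (order ! a)) + 2 \<le> R' 4) \<and>
    (\<forall>v. (\<exists>a. ?n - x \<le> a \<and> a < ?n \<and> v \<in> set (bag ! (order ! a))) \<longrightarrow> topmost (?n - x) v (M' 7 v))"
  show ?thesis unfolding Tops_def run_SEQ run_atom
  proof (rule run_LOOP_const[where lo=0 and hi="?n" and b="5 * t + 9" and I="?I"])
    fix x n R' M' assume x: "x < ?n" and R': "R' 17 = x" "R' 1 = ?n" and I: "?I x R' M'"
    define pos where "pos = ?n - Suc x"
    have pos: "pos < ?n" "?n - x = Suc pos" "?n - x - 1 = pos" using x by (auto simp: pos_def)
    define i where "i = order ! pos"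
    have i: "i < length bag" using order pos length_bag nth_mem unfolding i_def by fastforce
    let ?lo = "length (concat (take i bag))" and ?hi = "length (concat (take (Suc i) bag))"
    have hi: "?hi = ?lo + length (bag ! i)" using i by (simp add: concat_take_Suc)
    have M: "M' 4 i = ?lo" "M' 4 (Suc i) = ?hi" "M' 6 pos = i"
      using I assms i pos by (simp_all add: cells_offsets i_def)
    let ?J = "\<lambda>z R'' M''. R'' 16 = pos \<and> R'' 17 = x \<and> R'' 21 = 2 + (z - ?lo) \<and> (\<forall>y<16. R'' y = R' y) \<and>
      (\<forall>c. c \<noteq> 7 \<longrightarrow> M'' c = M c) \<and>
      (\<forall>v. M'' 7 v = (if v \<in> set (take (z - ?lo) (bag ! i)) then pos else M' 7 v))"
    show "run (DEC 16 ;; LOAD 18 6 16 ;; LOAD 19 4 18 ;; INC 18 ;; LOAD 20 4 18 ;; SET 21 2 ;;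
       LOOP 19 20 (LOAD 22 5 19 ;; STORE 7 22 16 ;; INC 21) ;;
       IF (LESS 4 21) (COPY 4 21) (SET 22 0))
      (\<lambda>n' R'' M''. n' \<le> n + (5 * t + 9) \<and> R'' 17 = x \<and> R'' 1 = ?n \<and> ?I (Suc x) (R''(17 := Suc x)) M'') n R' M'"
      unfolding run_SEQ run_atom
    proof (rule run_LOOP_const[where lo="?lo" and hi="?hi" and b=3 and I="?J"])
      fix z n' R'' M'' assume z: "?lo \<le> z" "z < ?hi" "R'' 19 = z" "R'' 20 = ?hi" and J: "?J z R'' M''"
      let ?p = "z - ?lo"
      have p: "?p < length (bag ! i)" "z = ?lo + ?p" using z hi by auto
      have "M'' 5 z = bag ! i ! ?p" using J assms p cells_concat[of i bag ?p] i by simp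
      moreover have "take (Suc z - ?lo) (bag ! i) = take ?p (bag ! i) @ [bag ! i ! ?p]"
        using p by (simp add: Suc_diff_le z take_Suc_conv_app_nth)
      ultimately show "run (LOAD 22 5 19 ;; STORE 7 22 16 ;; INC 21)
        (\<lambda>na Ra Ma. na \<le> n' + 3 \<and> Ra 19 = z \<and> Ra 20 = ?hi \<and> ?J (Suc z) (Ra(19 := Suc z)) Ma) n' R'' M''"
        using J z by (auto simp: Suc_diff_le)
    next
      fix n' R'' M'' assume n': "n' \<le> Suc (Suc (Suc (Suc (Suc (Suc n))))) + (?hi - ?lo) * (3 + 2) + 1"
        and J: "?J ?hi R'' M''"
      have r21: "R'' 21 = 2 + length (bag ! i)" using J hi by simp
      have r: "R'' y = R' y" if "y < 16" for y using J that by blast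
      have m7: "M'' 7 v = (if v \<in> set (bag ! i) then pos else M' 7 v)" for v using J hi by simp
      have lt: "length (bag ! i) \<le> t" using t i by blast
      have cost: "n' \<le> n + 5 * t + 7" using n' lt hi by simp
      have tops: "topmost pos v (M'' 7 v)"
        if ex: "\<exists>a. pos \<le> a \<and> a < ?n \<and> v \<in> set (bag ! (order ! a))" for v
      proof (cases "v \<in> set (bag ! i)")
        case True
        then show ?thesis using m7 pos by (auto simp: topmost_def i_def)
      next
        case False
        then obtain a where "Suc pos \<le> a" "a < ?n" "v \<in> set (bag ! (order ! a))"
          using ex by (metis i_def Suc_leI le_neq_implies_less)
        then have "topmost (Suc pos) v (M' 7 v)" using I pos(2) by auto
        then show ?thesis using False m7 by (auto simp: topmost_def i_def Suc_le_eq le_less)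
      qed
      have len: "length (bag ! (order ! a)) + 2 \<le> max (R' 4) (2 + length (bag ! i))" if "pos \<le> a" "a < ?n" for a
      proof (cases "a = pos")
        case False
        then have "?n - x \<le> a" using that pos by simp
        then show ?thesis using I that by fastforce
      qed (simp add: i_def)
      show "run (IF (LESS 4 21) (COPY 4 21) (SET 22 0))
        (\<lambda>n' R'' M''. n' \<le> n + (5 * t + 9) \<and> R'' 17 = x \<and> R'' 1 = ?n \<and> ?I (Suc x) (R''(17 := Suc x)) M'') n' R'' M''"
        using J I cost tops len r21 r R' lt by (auto simp: pos_def[symmetric] max_def split: if_splits)
    qed (use I R' M hi pos in auto)
  next
    fix n' R' M' assume n': "n' \<le> Suc (Suc (Suc n)) + (?n - 0) * (5 * t + 9 + 2) + 1" and I: "?I ?n R' M'"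
    have ex: "\<exists>a<?n. order ! a = i" if "i < length bag" for i
      using order that length_bag by (metis in_set_conv_nth lessThan_iff)
    have "length (bag ! i) + 2 \<le> R' 4" if "i < length bag" for i
      using I ex[OF that] by (metis diff_self_eq_0 le0)
    moreover have "topmost 0 v (M' 7 v)" if "i < length bag" "v \<in> set (bag ! i)" for i v
      using I ex[OF that(1)] that(2) by (metis diff_self_eq_0 le0)
    ultimately show "n' \<le> n + ?n * (5 * t + 11) + 4 \<and> (\<forall>y<16. y \<noteq> 4 \<longrightarrow> R' y = R y) \<and>
      (\<forall>c. c \<noteq> 7 \<longrightarrow> M' c = M c) \<and> 2 \<le> R' 4 \<and> R' 4 \<le> t + 2 \<and>
      (\<forall>i<length bag. length (bag ! i) + 2 \<le> R' 4) \<and>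
      (\<forall>v. (\<exists>i<length bag. v \<in> set (bag ! i)) \<longrightarrow> topmost 0 v (M' 7 v))"
      using n' I by (auto simp: algebra_simps)
  qed (use assms in auto)
qed

definition up :: "(nat \<Rightarrow> nat) \<Rightarrow> nat \<Rightarrow> nat list" where
  "up m v = filter (\<lambda>u. \<not> m v < m u) (adj ! v)"

text \<open>Each adjacency list is read once. Summing the costs over the actual list lengths gives a
  bound linear in the number of arcs, whereas a uniform bound per vertex would not.\<close>

lemma run_Ups:
  assumes "R 0 = length adj" "M 0 = cells (offsets adj)" "M 1 = cells (concat adj)"
  shows "run Ups (\<lambda>n' R' M'. n' \<le> n + 9 * length adj + 7 * length (concat adj) + 4 \<and> (\<forall>y<16. R' y = R y) \<and>
    (\<forall>c. c \<noteq> 8 \<longrightarrow> c \<noteq> 9 \<longrightarrow> M' c = M c) \<and>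
    (\<forall>v<length adj. lists_at M' 8 9 v (up (M 7) v))) n R M"
proof -
  let ?n = "length adj"
  define us where "us = map (up (M 7)) [0..<?n]"
  have us: "length us = ?n" "\<And>v. v < ?n \<Longrightarrow> us ! v = up (M 7) v" by (simp_all add: us_def)
  let ?I = "\<lambda>x R' M'. R' 17 = length (concat (take x us)) \<and> (\<forall>y<16. R' y = R y) \<and>
    (\<forall>c. c \<noteq> 8 \<longrightarrow> c \<noteq> 9 \<longrightarrow> M' c = M c) \<and> (\<forall>v<x. M' 8 v = length (concat (take v us))) \<and>
    (\<forall>p<length (concat (take x us)). M' 9 p = concat (take x us) ! p)"
  show ?thesis unfolding Ups_def run_SEQ run_atom
  proof (rule run_LOOP[where lo=0 and hi="?n" and b="\<lambda>v. 7 + 7 * length (adj ! v)" and I="?I"])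
    fix v n R' M' assume v: "v < ?n" and R': "R' 16 = v" "R' 0 = ?n" and I: "?I v R' M'"
    let ?lo = "length (concat (take v adj))" and ?hi = "length (concat (take (Suc v) adj))"
    have hi: "?hi = ?lo + length (adj ! v)" using v by (simp add: concat_take_Suc)
    let ?c = "concat (take v us)"
    let ?pre = "\<lambda>z. ?c @ filter (\<lambda>u. \<not> M 7 v < M 7 u) (take (z - ?lo) (adj ! v))"
    have M: "M' 0 v = ?lo" "M' 0 (Suc v) = ?hi" using I assms v by (simp_all add: cells_offsets)
    let ?J = "\<lambda>z R'' M''. R'' 16 = v \<and> R'' 18 = M 7 v \<and> (\<forall>y<16. R'' y = R y) \<and>
      (\<forall>c. c \<noteq> 8 \<longrightarrow> c \<noteq> 9 \<longrightarrow> M'' c = M c) \<and> (\<forall>x<Suc v. M'' 8 x = length (concat (take x us))) \<and>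
      R'' 17 = length (?pre z) \<and> (\<forall>p<length (?pre z). M'' 9 p = ?pre z ! p)"
    show "run (STORE 8 16 17 ;; LOAD 18 7 16 ;; LOAD 19 0 16 ;; COPY 20 16 ;; INC 20 ;; LOAD 20 0 20 ;;
       LOOP 19 20 (LOAD 21 1 19 ;; LOAD 22 7 21 ;; IF (LESS 18 22) (SET 22 0) (STORE 9 17 21 ;; INC 17)))
      (\<lambda>n' R'' M''. n' \<le> n + (7 + 7 * length (adj ! v)) \<and> R'' 16 = v \<and> R'' 0 = ?n \<and> ?I (Suc v) (R''(16 := Suc v)) M'') n R' M'"
      unfolding run_SEQ run_atom
    proof (rule run_LOOP_const[where lo="?lo" and hi="?hi" and b=5 and I="?J"])
      fix z n' R'' M'' assume z: "?lo \<le> z" "z < ?hi" "R'' 19 = z" "R'' 20 = ?hi" and J: "?J z R'' M''"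
      let ?p = "z - ?lo"
      have p: "?p < length (adj ! v)" "z = ?lo + ?p" using z hi by auto
      have a: "M'' 1 z = adj ! v ! ?p" using J assms p cells_concat[of v adj ?p] v by simp
      have tk: "?pre (Suc z) = ?pre z @ (if M 7 v < M 7 (adj ! v ! ?p) then [] else [adj ! v ! ?p])"
        using p by (simp add: Suc_diff_le z take_Suc_conv_app_nth)
      define q where "q = ?pre z"
      show "run (LOAD 21 1 19 ;; LOAD 22 7 21 ;; IF (LESS 18 22) (SET 22 0) (STORE 9 17 21 ;; INC 17))
        (\<lambda>na Ra Ma. na \<le> n' + 5 \<and> Ra 19 = z \<and> Ra 20 = ?hi \<and> ?J (Suc z) (Ra(19 := Suc z)) Ma) n' R'' M''"
        using J z a unfolding tk q_def[symmetric] by (auto simp: nth_append less_Suc_eq)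
    next
      fix n' R'' M'' assume n': "n' \<le> Suc (Suc (Suc (Suc (Suc (Suc n))))) + (?hi - ?lo) * (5 + 2) + 1"
        and J: "?J ?hi R'' M''"
      have e: "?pre ?hi = concat (take (Suc v) us)"
        using hi us v by (simp add: concat_take_Suc up_def)
      show "n' \<le> n + (7 + 7 * length (adj ! v)) \<and> R'' 16 = v \<and> R'' 0 = ?n \<and> ?I (Suc v) (R''(16 := Suc v)) M''"
        using n' J R' I hi unfolding e by auto
    qed (use I R' M hi in \<open>auto simp: less_Suc_eq\<close>)
  next
    fix n' R' M' assume n': "n' \<le> Suc (Suc n) + (\<Sum>v=0..<?n. 7 + 7 * length (adj ! v) + 2) + 1"
      and R': "R' 16 = ?n" "R' 0 = ?n" and I: "?I ?n R' M'"
    have "(\<Sum>v=0..<?n. 7 + 7 * length (adj ! v) + 2) = (\<Sum>v=0..<?n. 9 + 7 * length (adj ! v))"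
      by (intro sum.cong) auto
    also have "\<dots> = 9 * ?n + 7 * length (concat adj)"
      by (simp add: sum.distrib sum_distrib_left[symmetric] length_concat sum_list_sum_nth)
    finally have "n' \<le> n + 9 * ?n + 7 * length (concat adj) + 3" using n' by simp
    moreover define M2 where "M2 = M'(8 := (M' 8)(R' 16 := R' 17))"
    moreover have "lists_at M2 8 9 v (up (M 7) v)" if "v < ?n" for v
    proof -
      have "lists_at M2 8 9 v (us ! v)"
        using I R' us that by (intro lists_atI) (auto simp: M2_def)
      then show ?thesis using us that by simp
    qed
    ultimately show "Suc n' \<le> n + 9 * ?n + 7 * length (concat adj) + 4 \<and>
      (\<forall>y<16. R' y = R y) \<and>
      (\<forall>c. c \<noteq> 8 \<longrightarrow> c \<noteq> 9 \<longrightarrow> (M'(8 := (M' 8)(R' 16 := R' 17))) c = M c) \<and>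
      (\<forall>v<length adj. lists_at (M'(8 := (M' 8)(R' 16 := R' 17))) 8 9 v (up (M 7) v))"
      using I by simp
  qed (use assms in auto)
qed

end

section \<open>Computing the bound \<open>N\<close> and the powers of two\<close>

definition Multiply :: com where
  "Multiply = SET 19 0 ;; SET 20 0 ;; LOOP 20 4 (SET 21 0 ;; LOOP 21 18 (INC 19)) ;; COPY 18 19"

lemma run_Multiply:
  "run Multiply (\<lambda>n' R' M'. n' \<le> n + R 4 * (3 * R 18 + 4) + 4 \<and> (\<forall>y<16. R' y = R y) \<and> M' = M \<and>
     R' 18 = R 18 * R 4) n R M"
proof -
  let ?I = "\<lambda>x R' M'. R' 18 = R 18 \<and> R' 19 = R 18 * x \<and> (\<forall>y<16. R' y = R y) \<and> M' = M"
  show ?thesis unfolding Multiply_def run_SEQ run_atom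
  proof (rule run_LOOP_const[where lo=0 and hi="R 4" and b="3 * R 18 + 2" and I="?I"])
    fix x n R' M' assume R': "R' 20 = x" "R' 4 = R 4" and I: "?I x R' M'"
    show "run (SET 21 0 ;; LOOP 21 18 (INC 19))
      (\<lambda>n' R'' M''. n' \<le> n + (3 * R 18 + 2) \<and> R'' 20 = x \<and> R'' 4 = R 4 \<and> ?I (Suc x) (R''(20 := Suc x)) M'') n R' M'"
      unfolding run_SEQ run_atom
      by (rule run_LOOP_const[where lo=0 and hi="R 18" and b=1 and
         I="\<lambda>z R'' M''. R'' 20 = x \<and> R'' 18 = R 18 \<and> R'' 19 = R 18 * x + z \<and> (\<forall>y<16. R'' y = R y) \<and> M'' = M"])
        (use R' I in auto)
  qed (auto simp: algebra_simps)
qed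

text \<open>The exponent is a constant of the program, so the power is unrolled into that many
  multiplications by \<open>K\<close>, starting from \<open>2\<close>.\<close>

primrec Power :: "nat \<Rightarrow> com" where
  "Power 0 = SET 18 2"
| "Power (Suc m) = Power m ;; Multiply"

lemma run_Power:
  assumes "R 4 = K" "2 \<le> K"
  shows "run (Power m) (\<lambda>n' R' M'. n' \<le> n + 14 * m * K ^ m + 1 \<and> (\<forall>y<16. R' y = R y) \<and> M' = M \<and>
     R' 18 = 2 * K ^ m) n R M"
proof (induction m)
  case (Suc m)
  show ?case unfolding Power.simps run_SEQ
  proof (rule run_mono[OF Suc.IH], elim conjE)
    fix n1 R1 M1 assume 1: "n1 \<le> n + 14 * m * K ^ m + 1" "\<forall>y<16. R1 y = R y" "M1 = M" "R1 18 = 2 * K ^ m"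
    have K4: "R1 4 = K" using 1 assms by simp
    have "K * 1 \<le> K * K ^ m" using assms by (intro mult_le_mono2) (simp add: Suc_leI)
    moreover have "K * (3 * (2 * K ^ m) + 4) + 4 = 6 * (K * K ^ m) + 4 * K + 4"
      by (simp add: algebra_simps)
    ultimately have "K * (3 * (2 * K ^ m) + 4) + 4 \<le> 14 * K ^ Suc m"
      using assms(2) unfolding power_Suc by linarith
    moreover have "14 * m * K ^ m \<le> 14 * m * K ^ Suc m"
      using assms by (intro mult_le_mono2 power_increasing) auto
    ultimately have c: "n + 14 * m * K ^ m + 1 + (K * (3 * (2 * K ^ m) + 4) + 4) \<le> n + 14 * Suc m * K ^ Suc m + 1"
      by (simp only: mult_Suc_right add_mult_distrib)
    show "run Multiply (\<lambda>n' R' M'. n' \<le> n + 14 * Suc m * K ^ Suc m + 1 \<and> (\<forall>y<16. R' y = R y) \<and> M' = M \<and>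
     R' 18 = 2 * K ^ Suc m) n1 R1 M1"
      by (rule run_mono[OF run_Multiply]) (use 1 K4 c in \<open>auto simp: algebra_simps\<close>)
  qed
qed simp

text \<open>Register \<open>3\<close> is doubled by counting, \<open>2 * K ^ m\<close> times, and so
  ends as \<open>N\<close>. A round costs at most a constant multiple of \<open>N\<close>, within
  the budget.\<close>

definition Powers :: "nat \<Rightarrow> com" where
  "Powers m = Power m ;; SET 3 1 ;; SET 19 0 ;; STORE 10 19 3 ;; SET 22 0 ;;
     LOOP 22 18 (COPY 20 3 ;; SET 21 0 ;; LOOP 21 20 (INC 3) ;; INC 19 ;; STORE 10 19 3)"

lemma run_Powers:
  assumes "R 4 = K" "2 \<le> K"
  shows "run (Powers m) (\<lambda>n' R' M'. n' \<le> n + 14 * m * K ^ m + 2 * K ^ m * (3 * 2 ^ (2 * K ^ m) + 7) + 6 \<and>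
     (\<forall>y<16. y \<noteq> 3 \<longrightarrow> R' y = R y) \<and> (\<forall>c. c \<noteq> 10 \<longrightarrow> M' c = M c) \<and> R' 3 = 2 ^ (2 * K ^ m) \<and>
     (\<forall>a\<le>2 * K ^ m. M' 10 a = 2 ^ a)) n R M"
  unfolding Powers_def run_SEQ
proof (rule run_mono[OF run_Power[of R K, OF assms]], elim conjE)
  fix n1 R1 M1 assume 1: "n1 \<le> n + 14 * m * K ^ m + 1" "\<forall>y<16. R1 y = R y" "M1 = M" "R1 18 = 2 * K ^ m"
  let ?L = "2 * K ^ m"
  let ?I = "\<lambda>x R' M'. R' 3 = 2 ^ x \<and> R' 19 = x \<and> (\<forall>a\<le>x. M' 10 a = 2 ^ a) \<and>
     (\<forall>y<16. y \<noteq> 3 \<longrightarrow> R' y = R y) \<and> (\<forall>c. c \<noteq> 10 \<longrightarrow> M' c = M c)"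
  show "run (SET 3 1) (run (SET 19 0) (run (STORE 10 19 3) (run (SET 22 0)
     (run (LOOP 22 18 (COPY 20 3 ;; SET 21 0 ;; LOOP 21 20 (INC 3) ;; INC 19 ;; STORE 10 19 3))
     (\<lambda>n' R' M'. n' \<le> n + 14 * m * K ^ m + 2 * K ^ m * (3 * 2 ^ (2 * K ^ m) + 7) + 6 \<and>
     (\<forall>y<16. y \<noteq> 3 \<longrightarrow> R' y = R y) \<and> (\<forall>c. c \<noteq> 10 \<longrightarrow> M' c = M c) \<and> R' 3 = 2 ^ (2 * K ^ m) \<and>
     (\<forall>a\<le>2 * K ^ m. M' 10 a = 2 ^ a)))))) n1 R1 M1"
    unfolding run_atom
  proof (rule run_LOOP_const[where lo=0 and hi="?L" and b="3 * 2 ^ ?L + 5" and I="?I"])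
    fix x n R' M' assume x: "x < ?L" and R': "R' 22 = x" "R' 18 = ?L" and I: "?I x R' M'"
    have "(2::nat) ^ x \<le> 2 ^ ?L" using x by (intro power_increasing) auto
    then have le: "(2::nat) ^ x + (2 ^ x + 2 ^ x) \<le> 3 * 2 ^ ?L" by linarith
    show "run (COPY 20 3 ;; SET 21 0 ;; LOOP 21 20 (INC 3) ;; INC 19 ;; STORE 10 19 3)
      (\<lambda>n' R'' M''. n' \<le> n + (3 * 2 ^ ?L + 5) \<and> R'' 22 = x \<and> R'' 18 = ?L \<and> ?I (Suc x) (R''(22 := Suc x)) M'') n R' M'"
      unfolding run_SEQ run_atom
      by (rule run_LOOP_const[where lo=0 and hi="2 ^ x" and b=1 and
         I="\<lambda>z R'' M''. R'' 3 = 2 ^ x + z \<and> R'' 22 = x \<and> R'' 18 = ?L \<and> R'' 19 = x \<and>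
           (\<forall>y<16. y \<noteq> 3 \<longrightarrow> R'' y = R y) \<and> M'' = M'"])
        (use R' I le in \<open>auto simp: le_Suc_eq\<close>)
  qed (use 1 in \<open>auto simp: algebra_simps\<close>)
qed

section \<open>Filling the tables\<close>

definition Fill :: "(nat \<Rightarrow> nat \<Rightarrow> bool) \<Rightarrow> nat \<Rightarrow> com" where
  "Fill F r = SET 8 0 ;; LOOP 8 3 (compile (Step F r) (30 + 3 * r) ;; STORE 12 17 (30 + 3 * r) ;; INC 17)"

lemma lists_at_cong: "M' a = M a \<Longrightarrow> M' b = M b \<Longrightarrow> lists_at M' a b i xs = lists_at M a b i xs"
  by (simp add: lists_at_def)

lemma sat_Cell: "sat (Cell a e) R M \<longleftrightarrow> M a (val e R M) \<noteq> 0"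
  by (simp add: sat_def)

context step_environment
begin

text \<open>Tables are written to array \<open>12\<close> only, while powers, bags and neighbour
  lists are in other arrays; so the environment persists while a table is being filled.\<close>

lemma step_environment_cong:
  assumes "\<And>c. c \<noteq> 12 \<Longrightarrow> M' c = M c"
  shows "step_environment E r K M' ups i i1 i2 B B1 B2"
  using K K2 bags_at ups_at ups_length E_iff powers r_pos assms
  by unfold_locales (simp_all add: lists_at_cong[of M' _ M])

lemma sat_Step:
  assumes R: "R 3 = N" "R 4 = K" "R 5 = i" "R 6 = i1" "R 7 = i2" "R 8 < N"
  shows "sat (Step F r) R M \<longleftrightarrow> (\<exists>w1<N. \<exists>w2<N. M 12 (M 11 i1 + w1) \<noteq> 0 \<and> M 12 (M 11 i2 + w2) \<noteq> 0 \<and>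
    transition K B B1 B2 (R 8) w1 w2)"
proof -
  have t: "sat (Transition F r) (R(9 := w1, 10 := w2)) M \<longleftrightarrow> transition K B B1 B2 (R 8) w1 w2"
    if "w1 < N" "w2 < N" for w1 w2
    using R that by (intro sat_Transition) (simp add: ready_def)
  have "sat (Step F r) R M \<longleftrightarrow> (\<exists>w1<N. \<exists>w2<N. M 12 (M 11 i1 + min w1 N) \<noteq> 0 \<and> M 12 (M 11 i2 + min w2 N) \<noteq> 0 \<and>
    sat (Transition F r) (R(9 := w1, 10 := w2)) M)"
    using R by (simp add: Step_def sat_Cell)
  also have "\<dots> \<longleftrightarrow> (\<exists>w1<N. \<exists>w2<N. M 12 (M 11 i1 + w1) \<noteq> 0 \<and> M 12 (M 11 i2 + w2) \<noteq> 0 \<and>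
    transition K B B1 B2 (R 8) w1 w2)"
    by (simp add: t min_absorb1 cong: conj_cong)
  finally show ?thesis .
qed

text \<open>The assumptions on \<open>p\<close> say that the tables of the children end before the
  new one starts, so they can be read unchanged throughout.\<close>

lemma run_Fill:
  assumes R: "R 3 = N" "R 4 = K" "R 5 = i" "R 6 = i1" "R 7 = i2" "R 17 = p"
    and p: "M 11 i1 + N \<le> p" "M 11 i2 + N \<le> p"
  shows "run (Fill F r) (\<lambda>n' R' M'. n' \<le> n + N * (cost (Step F r) N + 4) + 2 \<and> R' 17 = p + N \<and>
    (\<forall>y<30. y \<noteq> 8 \<longrightarrow> y \<noteq> 17 \<longrightarrow> R' y = R y) \<and> (\<forall>c. c \<noteq> 12 \<longrightarrow> M' c = M c) \<and>
    (\<forall>a<p. M' 12 a = M 12 a) \<and>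
    (\<forall>w<N. M' 12 (p + w) \<noteq> 0 \<longleftrightarrow> (\<exists>w1<N. \<exists>w2<N. M 12 (M 11 i1 + w1) \<noteq> 0 \<and>
       M 12 (M 11 i2 + w2) \<noteq> 0 \<and> transition K B B1 B2 w w1 w2))) n R M"
proof -
  let ?D = "30 + 3 * r"
  let ?P = "\<lambda>w. \<exists>w1<N. \<exists>w2<N. M 12 (M 11 i1 + w1) \<noteq> 0 \<and>
       M 12 (M 11 i2 + w2) \<noteq> 0 \<and> transition K B B1 B2 w w1 w2"
  let ?I = "\<lambda>x R' M'. R' 17 = p + x \<and> (\<forall>y<30. y \<noteq> 8 \<longrightarrow> y \<noteq> 17 \<longrightarrow> R' y = R y) \<and>
    (\<forall>c. c \<noteq> 12 \<longrightarrow> M' c = M c) \<and> (\<forall>a<p. M' 12 a = M 12 a) \<and> (\<forall>w<x. M' 12 (p + w) \<noteq> 0 \<longleftrightarrow> ?P w)"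
  show ?thesis unfolding Fill_def run_SEQ run_atom
  proof (rule run_LOOP_const[where lo=0 and hi=N and b="cost (Step F r) N + 2" and I="?I"])
    fix x n R' M' assume x: "x < N" and R': "R' 8 = x" "R' 3 = N" and I: "?I x R' M'"
    interpret M': step_environment F E r K M' ups i i1 i2 B B1 B2
      using I by (intro step_environment_cong) blast
    have RR: "R' 4 = K" "R' 5 = i" "R' 6 = i1" "R' 7 = i2" using I R by auto
    have "sat (Step F r) R' M' \<longleftrightarrow> (\<exists>w1<N. \<exists>w2<N. M' 12 (M' 11 i1 + w1) \<noteq> 0 \<and> M' 12 (M' 11 i2 + w2) \<noteq> 0 \<and>
      transition K B B1 B2 x w1 w2)"
      using M'.sat_Step[of R'] R' RR x by simp
    also have "\<dots> \<longleftrightarrow> ?P x"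
    proof -
      have "M' 11 = M 11" using I by simp
      moreover have "M' 12 (M 11 i1 + w1) = M 12 (M 11 i1 + w1)" "M' 12 (M 11 i2 + w1) = M 12 (M 11 i2 + w1)" if "w1 < N" for w1
        using I p that by auto
      ultimately show ?thesis by (metis (no_types, lifting))
    qed
    finally have v: "val (Step F r) R' M' \<noteq> 0 \<longleftrightarrow> ?P x" by (simp add: sat_def)
    show "run (compile (Step F r) ?D ;; STORE 12 17 ?D ;; INC 17)
      (\<lambda>n' R'' M''. n' \<le> n + (cost (Step F r) N + 2) \<and> R'' 8 = x \<and> R'' 3 = N \<and> ?I (Suc x) (R''(8 := Suc x)) M'') n R' M'"
      unfolding run_SEQ
    proof (rule run_mono[OF run_compile[OF uses_below_Step]])
      fix n2 R2 M2 assume 2: "n2 \<le> n + cost (Step F r) (R' 3) \<and> M2 = M' \<and> R2 ?D = val (Step F r) R' M' \<and> (\<forall>y<?D. R2 y = R' y)"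
      have r: "R2 y = R' y" if "y < 30" for y using 2 that by simp
      show "run (STORE 12 17 ?D) (run (INC 17)
         (\<lambda>n' R'' M''. n' \<le> n + (cost (Step F r) N + 2) \<and> R'' 8 = x \<and> R'' 3 = N \<and> ?I (Suc x) (R''(8 := Suc x)) M'')) n2 R2 M2"
        using 2 R' I v r by (auto simp: less_Suc_eq)
    qed simp
  qed (use R in \<open>auto simp: algebra_simps\<close>)
qed

end

text \<open>Both children are preset to the number of nodes, which is the index of the dummy node,
  and overwritten by those that exist.\<close>

definition Fetch :: com where
  "Fetch = LOAD 5 6 16 ;; COPY 6 1 ;; COPY 7 1 ;; LOAD 20 2 5 ;; COPY 19 5 ;; INC 19 ;; LOAD 21 2 19 ;;
     IF (LESS 20 21) (LOAD 6 3 20 ;; INC 20 ;; IF (LESS 20 21) (LOAD 7 3 20) (SET 19 0)) (SET 19 0)"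

text \<open>
  The first table belongs to the dummy node. Its only state is \<open>3\<close>, which has bits \<open>0\<close> and \<open>1\<close>: the
  empty embedding, in both colours. Its address is \<open>0\<close>, the initial value of all cells.
\<close>

definition Main :: "(nat \<Rightarrow> nat \<Rightarrow> bool) \<Rightarrow> nat \<Rightarrow> com" where
  "Main F r = SET 16 3 ;; SET 17 1 ;; STORE 12 16 17 ;; COPY 17 3 ;; COPY 16 1 ;; SET 18 0 ;;
     LOOP 18 1 (DEC 16 ;; Fetch ;; STORE 11 5 17 ;; Fill F r)"

context layout begin

definition kid1 :: "nat \<Rightarrow> nat" where
  "kid1 i = (if ch ! i = [] then length ch else ch ! i ! 0)"

definition kid2 :: "nat \<Rightarrow> nat" where
  "kid2 i = (if length (ch ! i) < 2 then length ch else ch ! i ! 1)"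

lemma run_Fetch:
  assumes "R 1 = length ch" "M 2 = cells (offsets ch)" "M 3 = cells (concat ch)" "M 6 (R 16) = i" "i < length ch"
  shows "run Fetch (\<lambda>n' R' M'. n' \<le> n + 12 \<and> M' = M \<and> R' 5 = i \<and> R' 6 = kid1 i \<and> R' 7 = kid2 i \<and>
    (\<forall>y. y \<notin> {5, 6, 7, 19, 20, 21} \<longrightarrow> R' y = R y)) n R M"
proof -
  let ?lo = "length (concat (take i ch))"
  have M: "M 2 i = ?lo" "M 2 (Suc i) = ?lo + length (ch ! i)"
    using assms by (simp_all add: cells_offsets concat_take_Suc)
  have 0: "M 3 ?lo = ch ! i ! 0" if "ch ! i \<noteq> []" using assms that cells_concat[of i ch 0] by simp
  have 1: "M 3 (Suc ?lo) = ch ! i ! 1" if "1 < length (ch ! i)" using assms that cells_concat[of i ch 1] by simp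
  show ?thesis unfolding Fetch_def
    using assms M 0 1 by (cases "ch ! i"; cases "tl (ch ! i)") (auto simp: kid1_def kid2_def)
qed

definition bag_at :: "nat \<Rightarrow> nat list" where
  "bag_at i = (if i < length ch then bag ! i else [])"

end

text \<open>Adds what the graph and its decomposition provide: the part \<open>V i\<close> below
  each node, with the index \<open>length ch\<close> for the dummy node, and
  \<open>edge_top\<close>, from which the short lists get their length bound.\<close>

locale decomposition_layout = layout adj ch bag \<rho> + pattern F E r
  for adj ch bag \<rho> F E r +
  fixes V :: "nat \<Rightarrow> nat set"
  assumes step: "\<And>i. i < length ch \<Longrightarrow>
      node_step E r (V i) (V (kid1 i)) (V (kid2 i)) (bag ! i) (bag_at (kid1 i)) (bag_at (kid2 i))"
    and V_end: "V (length ch) = {}"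
    and adj_E: "\<And>v. v < length adj \<Longrightarrow> distinct (adj ! v) \<and> set (adj ! v) = {u. E v u}"
    and E_sym: "\<And>u v. E u v \<Longrightarrow> E v u"
    and cover: "\<And>v. v < length adj \<Longrightarrow> \<exists>i<length bag. v \<in> set (bag ! i)"
    and edge_top: "\<And>x y a b. E x y \<Longrightarrow> topmost 0 x a \<Longrightarrow> topmost 0 y b \<Longrightarrow> b \<le> a \<Longrightarrow> y \<in> set (bag ! (order ! a))"
begin

lemma kid_cases:
  assumes "a < length ch" "j = kid1 (order ! a) \<or> j = kid2 (order ! a)"
  shows "j = length ch \<or> (\<exists>b<length ch. a < b \<and> order ! b = j)"
proof -
  have "j = length ch \<or> j \<in> set (ch ! (order ! a))"
    using assms(2) by (auto simp: kid1_def kid2_def split: if_splits)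
  then show ?thesis using order(4)[OF assms(1)] by blast
qed

text \<open>By \<open>edge_top\<close>, every vertex on the short list of \<open>x\<close> lies in
  the bag of the topmost node of \<open>x\<close>.\<close>

lemma up_length:
  assumes m: "\<And>v. v < length adj \<Longrightarrow> topmost 0 v (m v)" and x: "x < length adj"
  shows "\<exists>i<length bag. length (up m x) \<le> length (bag ! i)"
proof -
  have "set (up m x) \<subseteq> set (bag ! (order ! m x))"
  proof
    fix y assume "y \<in> set (up m x)"
    then have y: "E x y" "m y \<le> m x" "y < length adj"
      using adj_E[OF x] adj[OF x] by (auto simp: up_def)
    then show "y \<in> set (bag ! (order ! m x))" using edge_top m x by blast
  qed
  moreover have "distinct (up m x)" using adj_E[OF x] by (simp add: up_def)
  ultimately have "length (up m x) \<le> length (bag ! (order ! m x))"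
    by (metis card_length card_mono distinct_card finite_set le_trans)
  moreover have "order ! m x < length bag"
    using m[OF x] order(2,3) length_bag nth_mem unfolding topmost_def by fastforce
  ultimately show ?thesis by blast
qed

text \<open>In reverse breadth-first order the tables of the children are complete when a node is
  reached.\<close>

lemma run_Main:
  fixes K t :: nat
  defines "N \<equiv> 2 ^ (2 * K ^ r)"
  assumes R: "R 1 = length ch" "R 3 = N" "R 4 = K"
    and M: "M 2 = cells (offsets ch)" "M 3 = cells (concat ch)" "M 4 = cells (offsets bag)" "M 5 = cells (concat bag)"
      "M 11 = (\<lambda>_. 0)" "M 12 = (\<lambda>_. 0)"
    and ord: "\<And>a. a < length ch \<Longrightarrow> M 6 a = order ! a"
    and ups: "\<And>v. v < length adj \<Longrightarrow> lists_at M 8 9 v (up m v)"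
    and top: "\<And>v. v < length adj \<Longrightarrow> topmost 0 v (m v)"
    and pow: "\<And>a. a \<le> 2 * K ^ r \<Longrightarrow> M 10 a = 2 ^ a"
    and K: "2 \<le> K" "\<And>i. i < length bag \<Longrightarrow> length (bag ! i) + 2 \<le> K"
  shows "run (Main F r) (\<lambda>n' R' M'. n' \<le> n + length ch * (N * (cost (Step F r) N + 4) + 18) + 7 \<and>
    (\<forall>y<5. R' y = R y) \<and> (\<forall>c. c \<noteq> 11 \<longrightarrow> c \<noteq> 12 \<longrightarrow> M' c = M c) \<and>
    table_ok K N (V \<rho>) (bag ! \<rho>) (\<lambda>w. M' 12 (M' 11 \<rho> + w) \<noteq> 0)) n R M"
proof -
  let ?n = "length ch"
  let ?C = "N * (cost (Step F r) N + 4)"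
  have K': "length (bag_at i) + 2 \<le> K" for i
    using K length_bag by (auto simp: bag_at_def)
  have bags: "lists_at M 4 5 i (bag_at i)" if "i \<le> ?n" for i
  proof (cases "i < ?n")
    case True
    then show ?thesis using lists_at_cells[of M 4 bag 5 i] M length_bag by (simp add: bag_at_def)
  next
    case False
    then have "i = length bag" using that length_bag by simp
    then show ?thesis using lists_at_cells_end[of M 4 bag 5] M length_bag by (simp add: bag_at_def)
  qed
  have upN: "length (up m v) \<le> N" if v: "v < length adj" for v
  proof -
    obtain i where "i < length bag" "length (up m v) \<le> length (bag ! i)" using up_length[of m, OF top v] by blast
    then have "length (up m v) \<le> K" using K(2)[of i] by linarith
    moreover have "K ^ 1 \<le> K ^ r" using r_pos K by (intro power_increasing) auto
    then have "K \<le> 2 * K ^ r" by simp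
    moreover have "2 * K ^ r < N" unfolding N_def by (rule less_exp)
    ultimately show ?thesis by linarith
  qed
  have N3: "3 < N"
  proof -
    have "K ^ 1 \<le> K ^ r" using r_pos K by (intro power_increasing) auto
    then have "(2::nat) ^ 2 \<le> 2 ^ (2 * K ^ r)" using K by (intro power_increasing) auto
    then show ?thesis by (simp add: N_def)
  qed
  let ?T = "\<lambda>M' j w. M' 12 (M' 11 j + w) \<noteq> (0::nat)"
  \<comment> \<open>After \<open>x\<close> nodes there are \<open>Suc x\<close> tables of length
    \<open>N\<close>, since the table of the dummy node is the first.\<close>
  let ?I = "\<lambda>x R' M'. R' 16 = ?n - x \<and> R' 17 = N * Suc x \<and> (\<forall>y<5. R' y = R y) \<and>
    (\<forall>c. c \<noteq> 11 \<longrightarrow> c \<noteq> 12 \<longrightarrow> M' c = M c) \<and>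
    (\<forall>j. j = ?n \<or> (\<exists>a. ?n - x \<le> a \<and> a < ?n \<and> order ! a = j) \<longrightarrow>
       M' 11 j + N \<le> N * Suc x \<and> table_ok K N (V j) (bag_at j) (?T M' j))"
  show ?thesis unfolding Main_def run_SEQ run_atom
  proof (rule run_LOOP_const[where lo=0 and hi="?n" and b="?C + 16" and I="?I"])
    fix x n R' M' assume x: "x < ?n" and R': "R' 18 = x" "R' 1 = ?n" and I: "?I x R' M'"
    define pos where "pos = ?n - Suc x"
    have pos: "pos < ?n" "?n - x = Suc pos" "?n - x - 1 = pos" using x by (auto simp: pos_def)
    define i where "i = order ! pos"
    have o_lt: "order ! b < ?n" if "b < ?n" for b
      using order(2,3) nth_mem[of b order] that by auto
    have i: "i < ?n" using o_lt pos unfolding i_def by blast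
    have ib: "i < length bag" using i length_bag by simp
    have kids: "M' 11 j + N \<le> N * Suc x \<and> table_ok K N (V j) (bag_at j) (?T M' j) \<and> j \<le> ?n \<and> j \<noteq> i"
      if "j = kid1 i \<or> j = kid2 i" for j
    proof -
      have j: "j = ?n \<or> (\<exists>b<?n. pos < b \<and> order ! b = j)"
        using kid_cases[of pos j] pos(1) that unfolding i_def by blast
      then have "j = ?n \<or> (\<exists>a. ?n - x \<le> a \<and> a < ?n \<and> order ! a = j)"
        using pos(2) by (metis Suc_leI)
      moreover have "j \<noteq> i"
        using j i order(1,3) pos(1) unfolding i_def by (auto simp: nth_eq_iff_index_eq)
      moreover have "j \<le> ?n" using j less_imp_le[OF o_lt] by auto
      ultimately show ?thesis using I by blast
    qed
    let ?p = "N * Suc x"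
    let ?M1 = "M'(11 := (M' 11)(i := ?p))"
    let ?Q = "\<lambda>n' R'' M''. n' \<le> n + (?C + 16) \<and> R'' 18 = x \<and> R'' 1 = ?n \<and> ?I (Suc x) (R''(18 := Suc x)) M''"
    have M'c: "M' c = M c" if "c \<noteq> 11" "c \<noteq> 12" for c using I that by blast
    have env: "step_environment E r K ?M1 (up m) i (kid1 i) (kid2 i) (bag ! i) (bag_at (kid1 i)) (bag_at (kid2 i))"
    proof unfold_locales
      show "?M1 10 a = 2 ^ a" if "a < 2 * K ^ r" for a using pow[of a] M'c[of 10] that by simp
      show "2 \<le> K" by (fact K)
      show "length (bag ! i) + 2 \<le> K" "length (bag_at (kid1 i)) + 2 \<le> K" "length (bag_at (kid2 i)) + 2 \<le> K"
        using K(2)[OF ib] K' by auto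
      have l: "lists_at ?M1 4 5 j (bag_at j)" if "j \<le> ?n" for j
        using bags[OF that] M'c[of 4] M'c[of 5] by (simp add: lists_at_def)
      show "lists_at ?M1 4 5 i (bag ! i)" using l[of i] i by (simp add: bag_at_def)
      show "lists_at ?M1 4 5 (kid1 i) (bag_at (kid1 i))" "lists_at ?M1 4 5 (kid2 i) (bag_at (kid2 i))"
        using l kids by blast+
      fix v assume "v \<in> set (bag ! i)"
      then have v: "v < length adj" using bag[OF ib] by auto
      show "lists_at ?M1 8 9 v (up m v)" using ups[OF v] M'c[of 8] M'c[of 9] by (simp add: lists_at_def)
      show "length (up m v) \<le> 2 ^ (2 * K ^ r)" using upN[OF v] by (simp add: N_def)
      fix u assume "u \<in> set (bag ! i)"
      then have u: "u < length adj" using bag[OF ib] by auto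
      show "E v u \<longleftrightarrow> u \<in> set (up m v) \<or> v \<in> set (up m u)"
        using adj_E[OF u] adj_E[OF v] E_sym by (auto simp: up_def)
    qed
    interpret e: step_environment F E r K ?M1 "up m" i "kid1 i" "kid2 i" "bag ! i" "bag_at (kid1 i)" "bag_at (kid2 i)"
      by (fact env)
    have eN: "e.N = N" by (simp add: e.N_def N_def)
    show "run (DEC 16 ;; Fetch ;; STORE 11 5 17 ;; Fill F r) ?Q n R' M'"
      unfolding run_SEQ run_atom
    proof (rule run_mono[OF run_Fetch[where i=i]])
      fix n2 R2 M2 assume "n2 \<le> Suc n + 12 \<and> M2 = M' \<and> R2 5 = i \<and> R2 6 = kid1 i \<and> R2 7 = kid2 i \<and>
        (\<forall>y. y \<notin> {5, 6, 7, 19, 20, 21} \<longrightarrow> R2 y = (R'(16 := R' 16 - 1)) y)"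
      then have 2: "n2 \<le> n + 13" "M2 = M'" "R2 5 = i" "R2 6 = kid1 i" "R2 7 = kid2 i" "R2 16 = pos" "R2 17 = ?p"
        "R2 18 = x" "\<And>y. y < 5 \<Longrightarrow> R2 y = R' y"
        using I R' pos by auto
      have M1: "M2(11 := (M2 11)(R2 5 := R2 17)) = ?M1" using 2 by simp
      show "run (Fill F r) ?Q (Suc n2) R2 (M2(11 := (M2 11)(R2 5 := R2 17)))" unfolding M1
      proof (rule run_mono[OF e.run_Fill[where p="?p", unfolded eN]])
        fix n3 R3 M3 assume 3: "n3 \<le> Suc n2 + ?C + 2 \<and> R3 17 = ?p + N \<and>
          (\<forall>y<30. y \<noteq> 8 \<longrightarrow> y \<noteq> 17 \<longrightarrow> R3 y = R2 y) \<and> (\<forall>c. c \<noteq> 12 \<longrightarrow> M3 c = ?M1 c) \<and>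
          (\<forall>a<?p. M3 12 a = ?M1 12 a) \<and>
          (\<forall>w<N. M3 12 (?p + w) \<noteq> 0 \<longleftrightarrow> (\<exists>w1<N. \<exists>w2<N. ?M1 12 (?M1 11 (kid1 i) + w1) \<noteq> 0 \<and>
            ?M1 12 (?M1 11 (kid2 i) + w2) \<noteq> 0 \<and>
            transition K (bag ! i) (bag_at (kid1 i)) (bag_at (kid2 i)) w w1 w2))"
        have M3c: "M3 c = M c" if "c \<noteq> 11" "c \<noteq> 12" for c using 3 M'c that by simp
        have M3_11: "M3 11 j = (if j = i then ?p else M' 11 j)" for j using 3 by simp
        have M3_12: "M3 12 a = M' 12 a" if "a < ?p" for a using 3 that by simp
        have new: "table_ok K N (V i) (bag_at i) (?T M3 i)"
        proof -
          interpret s: node_step F E r "V i" "V (kid1 i)" "V (kid2 i)" "bag ! i" "bag_at (kid1 i)" "bag_at (kid2 i)"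
            by (rule step[OF i])
          have "table_ok K N (V i) (bag ! i) (?T M3 i)"
          proof (rule s.table_ok_step)
            show "table_ok K N (V (kid1 i)) (bag_at (kid1 i)) (?T M' (kid1 i))"
              "table_ok K N (V (kid2 i)) (bag_at (kid2 i)) (?T M' (kid2 i))" using kids by blast+
            show "?T M3 i w \<longleftrightarrow> (\<exists>w1<N. \<exists>w2<N. ?T M' (kid1 i) w1 \<and> ?T M' (kid2 i) w2 \<and>
              transition K (bag ! i) (bag_at (kid1 i)) (bag_at (kid2 i)) w w1 w2)" if "w < N" for w
              using 3 that kids[of "kid1 i"] kids[of "kid2 i"] M3_11[of i] by simp
          qed (use K(2)[OF ib] K' N_def in auto)
          then show ?thesis using i by (simp add: bag_at_def)
        qed
        have "M3 11 j + N \<le> N * Suc (Suc x) \<and> table_ok K N (V j) (bag_at j) (?T M3 j)"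
          if j: "j = ?n \<or> (\<exists>a. ?n - Suc x \<le> a \<and> a < ?n \<and> order ! a = j)" for j
        proof (cases "j = i")
          case True
          then show ?thesis using new M3_11[of i] by simp
        next
          case False
          have "j = ?n \<or> (\<exists>a. ?n - x \<le> a \<and> a < ?n \<and> order ! a = j)"
            using j False pos(2) unfolding i_def pos_def[symmetric] by (metis Suc_leI le_neq_implies_less)
          then have old: "M' 11 j + N \<le> N * Suc x" "table_ok K N (V j) (bag_at j) (?T M' j)" using I by blast+
          \<comment> \<open>An older table lies entirely below \<open>?p\<close>, where nothing has
            been written.\<close>
          have "?T M3 j w = ?T M' j w" if "w < N" for w
            using M3_11[of j] False M3_12[of "M' 11 j + w"] old(1) that by simp
          then have "table_ok K N (V j) (bag_at j) (?T M3 j)"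
            using old(2) unfolding table_ok_def by (simp cong: conj_cong)
          then show ?thesis using old(1) M3_11[of j] False by simp
        qed
        then show "?Q n3 R3 M3"
          using 3 2 R' I M3c pos by (auto simp: pos_def algebra_simps)
      qed (use 2 R I kids eN in auto)
    qed (use R' I M M'c ord pos i in \<open>auto simp: i_def\<close>)
  next
    let ?M0 = "M(12 := (M 12)((R(16 := 3, 17 := 1)) 16 := (R(16 := 3, 17 := 1)) 17))"
    have "table_ok K N {} [] (\<lambda>w. w = 3)" using table_ok_empty[of K N] K N3 by simp
    moreover have "?T ?M0 ?n = (\<lambda>w. w = 3)" using M by (auto simp: fun_eq_iff)
    ultimately have "table_ok K N (V ?n) (bag_at ?n) (?T ?M0 ?n)" using V_end by (simp add: bag_at_def)
    then show "?I 0 (R(16 := 3, 17 := 1, 17 := (R(16 := 3, 17 := 1)) 3, 16 := (R(16 := 3, 17 := 1, 17 := (R(16 := 3, 17 := 1)) 3)) 1, 18 := 0)) ?M0"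
      using R M by auto
  next
    fix n' R' M' assume n': "n' \<le> Suc (Suc (Suc (Suc (Suc (Suc n))))) + (?n - 0) * (?C + 16 + 2) + 1"
      and I: "?I ?n R' M'"
    obtain a where "a < ?n" "order ! a = \<rho>" using root order(2,3) by (metis in_set_conv_nth lessThan_iff)
    then have "table_ok K N (V \<rho>) (bag_at \<rho>) (?T M' \<rho>)" using I by (metis diff_self_eq_0 le0)
    moreover have "n' \<le> n + ?n * (?C + 18) + 7" using n' by (simp add: algebra_simps)
    ultimately show "n' \<le> n + ?n * (?C + 18) + 7 \<and> (\<forall>y<5. R' y = R y) \<and> (\<forall>c. c \<noteq> 11 \<longrightarrow> c \<noteq> 12 \<longrightarrow> M' c = M c) \<and>
      table_ok K N (V \<rho>) (bag ! \<rho>) (?T M' \<rho>)"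
      using I root by (simp add: bag_at_def)
  qed (use R in auto)
qed

end

section \<open>Induced subgraphs and bipartitions\<close>

text \<open>Arcs are pairs with the projections as tail and head, so the arc map of an isomorphism
  is determined by its vertex map. \<open>\<eta>\<close> numbers the vertices of \<open>H\<close>,
  and restricting to \<open>A\<close> and then to \<open>S \<subseteq> A\<close> is restricting to
  \<open>S\<close>.\<close>

lemma contains_induced_iff:
  fixes G :: "'a pair_pre_digraph" and H :: "'h pair_pre_digraph"
  assumes G: "pair_graph G" and H: "pair_graph H" and \<eta>: "bij_betw \<eta> {..<r} (pverts H)"
  shows "contains_induced (with_proj G \<restriction> A) (with_proj H) \<longleftrightarrow>
    has_copy (\<lambda>h h'. (\<eta> h, \<eta> h') \<in> parcs H) (\<lambda>u v. (u, v) \<in> parcs G) r A" (is "?l \<longleftrightarrow> ?r")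
proof
  interpret H: pair_graph H by (fact H)
  assume ?l
  then obtain S f where S: "S \<subseteq> A" and f: "pre_digraph.digraph_isomorphism (with_proj H) f"
    and eq: "(with_proj G \<restriction> A) \<restriction> S = app_iso f (with_proj H)"
    unfolding contains_induced_def digraph_iso_def by auto
  let ?g = "iso_verts f"
  have inj: "inj_on ?g (pverts H)" and ends: "\<And>a. a \<in> parcs H \<Longrightarrow>
      ?g (fst a) = iso_tail f (iso_arcs f a) \<and> ?g (snd a) = iso_head f (iso_arcs f a)"
    using f by (auto simp: pre_digraph.digraph_isomorphism_def)
  have V: "S = ?g ` pverts H" using arg_cong[OF eq, of verts] by simp
  have arcs: "{e \<in> parcs G. fst e \<in> A \<and> snd e \<in> A \<and> fst e \<in> S \<and> snd e \<in> S} = iso_arcs f ` parcs H"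
    using arg_cong[OF eq, of arcs] by auto
  have tl: "iso_tail f = fst" "iso_head f = snd"
    using arg_cong[OF eq, of tail] arg_cong[OF eq, of head] by simp_all
  have e: "(u, v) \<in> parcs H \<longleftrightarrow> (?g u, ?g v) \<in> parcs G" if uv: "u \<in> pverts H" "v \<in> pverts H" for u v
  proof
    assume a: "(u, v) \<in> parcs H"
    then have "iso_arcs f (u, v) = (?g u, ?g v)" using ends[OF a] tl by (simp add: prod_eq_iff)
    then show "(?g u, ?g v) \<in> parcs G" using arcs a by (metis (no_types, lifting) imageI mem_Collect_eq)
  next
    assume "(?g u, ?g v) \<in> parcs G"
    then have "(?g u, ?g v) \<in> iso_arcs f ` parcs H" using uv V S unfolding arcs[symmetric] by auto
    then obtain a where a: "a \<in> parcs H" "iso_arcs f a = (?g u, ?g v)" by (metis imageE)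
    then have "?g (fst a) = ?g u" "?g (snd a) = ?g v" using ends[OF a(1)] tl by auto
    moreover have "fst a \<in> pverts H" "snd a \<in> pverts H"
      using a(1) H.arc_fst_in_verts H.arc_snd_in_verts by auto
    ultimately have "fst a = u" "snd a = v" using inj uv by (auto dest: inj_onD)
    then show "(u, v) \<in> parcs H" using a(1) by (metis prod.collapse)
  qed
  have \<eta>V: "\<eta> h \<in> pverts H" if "h < r" for h using \<eta> that by (auto simp: bij_betw_def)
  have "inj_on (?g \<circ> \<eta>) {..<r}" using \<eta> inj by (intro comp_inj_on) (auto simp: bij_betw_def)
  then show ?r unfolding has_copy_def using e \<eta>V V S by (intro exI[of _ "?g \<circ> \<eta>"]) auto
next
  interpret H: pair_graph H by (fact H)
  interpret G: pair_graph G by (fact G)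
  assume ?r
  then obtain \<psi> where \<psi>: "\<forall>h<r. \<psi> h \<in> A" "inj_on \<psi> {..<r}"
    "\<forall>h<r. \<forall>h'<r. h \<noteq> h' \<longrightarrow> ((\<eta> h, \<eta> h') \<in> parcs H \<longleftrightarrow> (\<psi> h, \<psi> h') \<in> parcs G)"
    unfolding has_copy_def by blast
  define g where "g = \<psi> \<circ> the_inv_into {..<r} \<eta>"
  have inv: "the_inv_into {..<r} \<eta> u < r \<and> \<eta> (the_inv_into {..<r} \<eta> u) = u" if "u \<in> pverts H" for u
    using \<eta> that by (metis bij_betw_def f_the_inv_into_f lessThan_iff order_refl the_inv_into_into)
  have gA: "g u \<in> A" if "u \<in> pverts H" for u using inv[OF that] \<psi>(1) by (simp add: g_def)
  have "inj_on (the_inv_into {..<r} \<eta>) (pverts H)"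
    by (rule inj_on_inverseI[of _ \<eta>]) (use inv in blast)
  then have inj: "inj_on g (pverts H)" unfolding g_def
    using inv \<psi>(2) by (intro comp_inj_on) (auto intro: inj_on_subset)
  have ge: "(u, v) \<in> parcs H \<longleftrightarrow> (g u, g v) \<in> parcs G" if uv: "u \<in> pverts H" "v \<in> pverts H" for u v
  \<comment> \<open>\<open>has_copy\<close> says nothing about a single pattern vertex; on the
    diagonal both sides are false, as there are no loops.\<close>
  proof (cases "u = v")
    case True
    then show ?thesis using H.pair_no_loops[of "(u, v)"] G.pair_no_loops[of "(g u, g v)"] by auto
  next
    case False
    then have "the_inv_into {..<r} \<eta> u \<noteq> the_inv_into {..<r} \<eta> v" using inv uv by metis
    then show ?thesis using \<psi>(3) inv[OF uv(1)] inv[OF uv(2)] unfolding g_def comp_def by metis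
  qed
  define f where "f = \<lparr>iso_verts = g, iso_arcs = map_prod g g, iso_head = snd, iso_tail = fst\<rparr>"
  let ?S = "g ` pverts H"
  have "inj_on (map_prod g g) (parcs H)"
  proof (rule inj_onI)
    fix x y assume a: "x \<in> parcs H" "y \<in> parcs H" "map_prod g g x = map_prod g g y"
    then have "g (fst x) = g (fst y)" "g (snd x) = g (snd y)"
      by (metis fst_map_prod, metis snd_map_prod)
    then show "x = y" using inj a H.arc_fst_in_verts H.arc_snd_in_verts
      by (meson inj_onD prod_eqI)
  qed
  then have "pre_digraph.digraph_isomorphism (with_proj H) f"
    unfolding pre_digraph.digraph_isomorphism_def using inj H.wf_digraph_axioms by (auto simp: f_def)
  moreover have "(with_proj G \<restriction> A) \<restriction> ?S = app_iso f (with_proj H)"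
  proof (rule pre_digraph.equality)
    have "{e \<in> parcs G. fst e \<in> A \<and> snd e \<in> A \<and> fst e \<in> ?S \<and> snd e \<in> ?S} = map_prod g g ` parcs H"
    proof (intro set_eqI iffI)
      fix e assume "e \<in> {e \<in> parcs G. fst e \<in> A \<and> snd e \<in> A \<and> fst e \<in> ?S \<and> snd e \<in> ?S}"
      then obtain u v where uv: "u \<in> pverts H" "v \<in> pverts H" "e = (g u, g v)" "e \<in> parcs G"
        by (cases e) auto
      then have "(u, v) \<in> parcs H" using ge by blast
      then show "e \<in> map_prod g g ` parcs H" using uv(3) by (auto simp: image_iff intro!: bexI[of _ "(u, v)"])
    next
      fix e assume "e \<in> map_prod g g ` parcs H"
      then obtain u v where uv: "(u, v) \<in> parcs H" "e = (g u, g v)" by auto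
      then have "u \<in> pverts H" "v \<in> pverts H" using H.in_arcsD1 H.in_arcsD2 by blast+
      then show "e \<in> {e \<in> parcs G. fst e \<in> A \<and> snd e \<in> A \<and> fst e \<in> ?S \<and> snd e \<in> ?S}"
        using uv ge gA by auto
    qed
    then show "arcs ((with_proj G \<restriction> A) \<restriction> ?S) = arcs (app_iso f (with_proj H))"
      by (auto simp: f_def)
  qed (simp_all add: f_def)
  moreover have "?S \<subseteq> A" using gA by blast
  ultimately show ?l unfolding contains_induced_def digraph_iso_def by auto
qed

text \<open>
  If one colour class is empty, then the whole graph is free of the pattern, and so are both parts of
  any other bipartition. So it does not matter which parts are empty, as long as there are two vertices.
\<close>

lemma has_induced_free_bipartition_iff:
  fixes G :: "nat pair_pre_digraph" and H :: "'h pair_pre_digraph"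
  assumes G: "pair_graph G" and H: "pair_graph H" and \<eta>: "bij_betw \<eta> {..<r} (pverts H)"
  shows "has_induced_free_bipartition (with_proj G) (with_proj H) \<longleftrightarrow>
    1 < card (pverts G) \<and> (\<exists>\<chi>::nat \<Rightarrow> nat. (\<forall>x. \<chi> x < 2) \<and> (\<forall>c<2. \<not> has_copy
      (\<lambda>h h'. (\<eta> h, \<eta> h') \<in> parcs H) (\<lambda>u v. (u, v) \<in> parcs G) r {x \<in> pverts G. \<chi> x = c}))"
    (is "_ \<longleftrightarrow> ?R")
proof -
  interpret G: pair_graph G by (fact G)
  let ?P = "has_copy (\<lambda>h h'. (\<eta> h, \<eta> h') \<in> parcs H) (\<lambda>u v. (u, v) \<in> parcs G) r"
  note ci = contains_induced_iff[OF G H \<eta>]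
  show ?thesis
  proof
    assume "has_induced_free_bipartition (with_proj G) (with_proj H)"
    then obtain A B where AB: "A \<union> B = pverts G" "A \<inter> B = {}" "A \<noteq> {}" "B \<noteq> {}" "\<not> ?P A" "\<not> ?P B"
      unfolding has_induced_free_bipartition_def ci by auto
    then have fin: "finite A" "finite B" using G.pair_finite_verts by (metis finite_Un)+
    then have "card (pverts G) = card A + card B" using AB(1,2) card_Un_disjoint by metis
    moreover have "0 < card A" "0 < card B" using AB fin by (auto simp: card_gt_0_iff)
    ultimately have "1 < card (pverts G)" by linarith
    moreover define \<chi> :: "nat \<Rightarrow> nat" where "\<chi> x = (if x \<in> A then 0 else 1)" for x
    have "{x \<in> pverts G. \<chi> x = 0} = A" "{x \<in> pverts G. \<chi> x = 1} = B"
      using AB by (auto simp: \<chi>_def)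
    then have "\<not> ?P {x \<in> pverts G. \<chi> x = c}" if "c < 2" for c
      using AB(5,6) less_2_cases[OF that] by (elim disjE) (simp_all only: One_nat_def not_False_eq_True)
    moreover have "\<forall>x. \<chi> x < 2" by (simp add: \<chi>_def)
    ultimately show ?R by blast
  next
    assume ?R
    then obtain \<chi> :: "nat \<Rightarrow> nat" where n: "1 < card (pverts G)" and \<chi>: "\<forall>x. \<chi> x < 2"
      and free: "\<forall>c<2. \<not> ?P {x \<in> pverts G. \<chi> x = c}" by blast
    define A where "A = {x \<in> pverts G. \<chi> x = 0}"
    define B where "B = {x \<in> pverts G. \<chi> x = 1}"
    have "\<chi> x = 0 \<or> \<chi> x = 1" for x using \<chi> by (metis less_2_cases One_nat_def)
    then have AB: "A \<union> B = pverts G" "A \<inter> B = {}" by (auto simp: A_def B_def)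
    have free: "\<not> ?P A" "\<not> ?P B" unfolding A_def B_def using free by simp_all
    show "has_induced_free_bipartition (with_proj G) (with_proj H)"
    proof (cases "A = {} \<or> B = {}")
      case False
      then show ?thesis unfolding has_induced_free_bipartition_def ci
        using AB free by (intro exI[of _ A] exI[of _ B]) auto
    next
      case True
      then have all: "\<not> ?P (pverts G)" using AB free by auto
      obtain v where v: "v \<in> pverts G" using n by fastforce
      have "pverts G - {v} \<noteq> {}"
      proof
        assume "pverts G - {v} = {}"
        then have "card (pverts G) \<le> card {v}" by (intro card_mono) auto
        then show False using n by simp
      qed
      moreover have sub: "\<not> ?P S" if "S \<subseteq> pverts G" for S using all has_copy_mono[OF _ that] by blast
      moreover have "\<not> ?P {v}" "\<not> ?P (pverts G - {v})" using sub[of "{v}"] v by (simp, intro sub, simp)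
      ultimately show ?thesis unfolding has_induced_free_bipartition_def ci
        using v by (intro exI[of _ "{v}"] exI[of _ "pverts G - {v}"]) auto
    qed
  qed
qed

section \<open>The algorithm\<close>

definition Algorithm :: "(nat \<Rightarrow> nat \<Rightarrow> bool) \<Rightarrow> nat \<Rightarrow> com" where
  "Algorithm F r = Bfs ;; Tops ;; Ups ;; Powers r ;; Main F r ;;
     compile (Answer r) (30 + 3 * r) ;; COPY 0 (30 + 3 * r)"

section \<open>From the nice decomposition to the layout in memory\<close>

text \<open>Niceness provides at most two children per node. The part of a node is the union of the
  bags of its descendants, and the dummy index gets the empty part.\<close>

lemma nice_layout:
  fixes G T :: "nat pair_pre_digraph"
  assumes G: "pair_graph G" and nice: "nice_tree_decomposition G T \<rho> X"
    and V: "pverts G = {..<length adj}"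
    and adj: "\<And>v. v < length adj \<Longrightarrow> distinct (adj ! v) \<and> set (adj ! v) = {u. (v, u) \<in> parcs G}"
    and T: "pverts T = {..<length ch}"
    and ch: "\<And>i. i < length ch \<Longrightarrow> distinct (ch ! i) \<and> set (ch ! i) = children T \<rho> i"
    and lb: "length bag = length ch"
    and bag: "\<And>i. i < length bag \<Longrightarrow> distinct (bag ! i) \<and> set (bag ! i) = X i"
    and r: "0 < r"
  shows "\<exists>V. decomposition_layout adj ch bag \<rho> (\<lambda>u v. (u, v) \<in> parcs G) r V \<and> V \<rho> = pverts G"
proof -
  let ?E = "\<lambda>u v. (u, v) \<in> parcs G"
  have td: "tree_decomposition G T X" and rt: "\<rho> \<in> pverts T"
    using nice by (auto simp: nice_tree_decomposition_def)
  interpret G: pair_graph G by (fact G)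
  interpret D: rooted_decomposition T \<rho> G X
    using td rt G by (auto simp: rooted_decomposition_def rooted_tree_def rooted_tree_axioms_def
        rooted_decomposition_axioms_def tree_decomposition_def undirected_tree_def)
  have child: "j \<in> set (ch ! i) \<longleftrightarrow> (i, j) \<in> D.child" if "i < length ch" for i j
    using ch[OF that] by (simp add: D.child_def)
  have Xbag: "set (bag ! i) = X i" "distinct (bag ! i)" if "i < length ch" for i
    using bag lb that by auto
  interpret L: layout adj ch bag \<rho>
  proof
    show "length bag = length ch" by (fact lb)
    show "\<rho> < length ch" using rt T by simp
    fix i assume i: "i < length ch"
    have "card (children T \<rho> i) \<le> 2"
    proof -
      have "leaf_node T \<rho> X i \<or> introduce_node T \<rho> X i \<or> forget_node T \<rho> X i \<or> join_node T \<rho> X i"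
        using nice i T by (simp add: nice_tree_decomposition_def)
      then show ?thesis
        by (auto simp: leaf_node_def introduce_node_def forget_node_def join_node_def)
    qed
    then show "distinct (ch ! i) \<and> set (ch ! i) \<subseteq> {..<length ch} \<and> length (ch ! i) \<le> 2"
      using ch[OF i] distinct_card[of "ch ! i"] D.child_verts child[OF i] T by auto
    show "\<rho> \<notin> set (ch ! i)" using child[OF i] D.root_no_parent by blast
    show "i = i'" if "i' < length ch" "j \<in> set (ch ! i)" "j \<in> set (ch ! i')" for i' j
      using child[OF i] child[OF that(1)] that D.unique_parent by blast
  next
    fix S assume S: "\<rho> \<in> S" "\<And>i. i \<in> S \<Longrightarrow> i < length ch \<Longrightarrow> set (ch ! i) \<subseteq> S"
    have "i \<in> S" if "(\<rho>, i) \<in> D.child\<^sup>*" for i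
      using that
    proof (induction rule: rtrancl_induct)
      case (step y z)
      then have "y < length ch" using D.child_verts T by blast
      then show ?case using S(2)[of y] step child by blast
    qed (fact S)
    then show "{..<length ch} \<subseteq> S" using D.root_descends T by auto
  next
    show "distinct (bag ! i) \<and> set (bag ! i) \<subseteq> {..<length adj}" if "i < length bag" for i
      using bag[OF that] D.bag_verts[of i] that lb T V by auto
    show "set (adj ! v) \<subseteq> {..<length adj}" if "v < length adj" for v
      using adj[OF that] G.in_arcsD2 V by auto
  qed
  define W where "W i = (if i < length ch then D.below i else {})" for i
  have W_root: "W \<rho> = pverts G" using D.below_root rt T by (simp add: W_def)
  have bag_W: "set (L.bag_at j) \<subseteq> W j" for j
    using D.bag_below Xbag by (auto simp: W_def L.bag_at_def)
  \<comment> \<open>The last claim means that two actual children are different, which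
    \<open>below_inter_below\<close> requires.\<close>
  have kids: "(\<Union>j \<in> children T \<rho> i. D.below j) = W (L.kid1 i) \<union> W (L.kid2 i)"
    "L.kid1 i \<noteq> length ch \<Longrightarrow> (i, L.kid1 i) \<in> D.child \<and> L.kid1 i < length ch"
    "L.kid2 i \<noteq> length ch \<Longrightarrow> (i, L.kid2 i) \<in> D.child \<and> L.kid2 i < length ch"
    "L.kid1 i = L.kid2 i \<Longrightarrow> L.kid1 i = length ch"
    if i: "i < length ch" for i
  proof -
    have s: "set (ch ! i) = children T \<rho> i" "distinct (ch ! i)" "length (ch ! i) \<le> 2" "set (ch ! i) \<subseteq> {..<length ch}"
      using ch[OF i] L.ch[OF i] by auto
    consider "ch ! i = []" | j where "ch ! i = [j]" | j k where "ch ! i = [j, k]"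
      using s(3) by (cases "ch ! i"; cases "tl (ch ! i)"; cases "tl (tl (ch ! i))") auto
    then have "(\<Union>j \<in> children T \<rho> i. D.below j) = W (L.kid1 i) \<union> W (L.kid2 i) \<and>
      (L.kid1 i \<noteq> length ch \<longrightarrow> L.kid1 i \<in> set (ch ! i)) \<and>
      (L.kid2 i \<noteq> length ch \<longrightarrow> L.kid2 i \<in> set (ch ! i)) \<and>
      (L.kid1 i = L.kid2 i \<longrightarrow> L.kid1 i = length ch)"
    proof cases
      case 1
      then show ?thesis using s(1) by (simp add: L.kid1_def L.kid2_def W_def)
    next
      case (2 j)
      then have "children T \<rho> i = {j}" "j < length ch" using s by auto
      then show ?thesis using 2 by (simp add: L.kid1_def L.kid2_def W_def)
    next
      case (3 j k)
      then have "children T \<rho> i = {j, k}" "j < length ch" "k < length ch" "j \<noteq> k" using s by auto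
      then show ?thesis using 3 by (simp add: L.kid1_def L.kid2_def W_def)
    qed
    then show "(\<Union>j \<in> children T \<rho> i. D.below j) = W (L.kid1 i) \<union> W (L.kid2 i)"
      "L.kid1 i \<noteq> length ch \<Longrightarrow> (i, L.kid1 i) \<in> D.child \<and> L.kid1 i < length ch"
      "L.kid2 i \<noteq> length ch \<Longrightarrow> (i, L.kid2 i) \<in> D.child \<and> L.kid2 i < length ch"
      "L.kid1 i = L.kid2 i \<Longrightarrow> L.kid1 i = length ch"
      using child[OF i] s(4) by blast+
  qed
  have sep: "W j \<inter> X i \<subseteq> set (L.bag_at j)" if "j = length ch \<or> (i, j) \<in> D.child \<and> j < length ch" for i j
    using that D.below_inter_bag[of i j] Xbag by (auto simp: W_def L.bag_at_def)
  have "decomposition_layout adj ch bag \<rho> ?E r W"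
  proof (unfold_locales)
    show "0 < r" by (fact r)
    show "W (length ch) = {}" by (simp add: W_def)
    show "distinct (adj ! v) \<and> set (adj ! v) = {u. (v, u) \<in> parcs G}" if "v < length adj" for v
      using adj[OF that] .
    show sym: "(v, u) \<in> parcs G" if "(u, v) \<in> parcs G" for u v
      using that G.pair_sym_arcs by (auto simp: symmetric_def elim: symE)
    show "\<exists>i<length bag. v \<in> set (bag ! i)" if v: "v < length adj" for v
    proof -
      have "\<forall>v\<in>pverts G. \<exists>i\<in>pverts T. v \<in> X i" using td by (simp add: tree_decomposition_def)
      moreover have "v \<in> pverts G" using v V by simp
      ultimately obtain i where "i \<in> pverts T" "v \<in> X i" by blast
      then show ?thesis using Xbag lb T by (intro exI[of _ i]) simp
    qed
    show "y \<in> set (bag ! (L.order ! a))"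
      if e: "(x, y) \<in> parcs G" and a: "L.topmost 0 x a" and b: "L.topmost 0 y b" and le: "b \<le> a" for x y a b
    proof -
      \<comment> \<open>\<open>pos\<close> inverts the breadth-first order on nodes and increases
        from parent to child, as \<open>edge_in_top_bag\<close> demands.\<close>
      define pos where "pos i = (LEAST a. L.order ! a = i)" for i
      have pos: "pos (L.order ! a) = a" if "a < length ch" for a
        unfolding pos_def
      proof (rule Least_equality)
        fix b assume "L.order ! b = L.order ! a"
        then show "a \<le> b" using L.order(1,3) that nth_eq_iff_index_eq[of L.order b a] by (cases "b < length ch") auto
      qed simp
      have nodes: "\<exists>a<length ch. L.order ! a = i" if "i \<in> pverts T" for i
        using that L.order(2,3) T by (metis in_set_conv_nth)
      have o_lt: "L.order ! b < length ch" if "b < length ch" for b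
        using L.order(2,3) nth_mem[of b L.order] that by auto
      have mono: "pos i < pos j" if ij: "(i, j) \<in> D.child" for i j
      proof -
        obtain a where a: "a < length ch" "L.order ! a = i" using nodes D.child_verts ij by blast
        then have "j \<in> set (ch ! (L.order ! a))" using child o_lt ij by blast
        then obtain b where "b < length ch" "a < b" "L.order ! b = j" using L.order(4)[OF a(1)] by blast
        then show ?thesis using a pos by auto
      qed
      have top: "L.order ! a \<in> pverts T \<and> z \<in> X (L.order ! a) \<and> (\<forall>i\<in>pverts T. z \<in> X i \<longrightarrow> pos (L.order ! a) \<le> pos i)"
        if h: "L.topmost 0 z a" for z a
      proof -
        have a: "a < length ch" "z \<in> set (bag ! (L.order ! a))" using h by (auto simp: L.topmost_def)
        have "pos (L.order ! a) \<le> pos i" if i: "i \<in> pverts T" "z \<in> X i" for i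
        proof -
          obtain b where b: "b < length ch" "L.order ! b = i" using nodes i by blast
          then have "z \<in> set (bag ! (L.order ! b))" using i o_lt Xbag by blast
          then have "\<not> b < a" using h by (auto simp: L.topmost_def)
          then show ?thesis using pos a b by auto
        qed
        then show ?thesis using a o_lt Xbag T by auto
      qed
      have "a < length ch" "b < length ch" using a b by (auto simp: L.topmost_def)
      then have "pos (L.order ! b) \<le> pos (L.order ! a)" using pos le by simp
      then have "y \<in> X (L.order ! a)"
        using D.edge_in_top_bag[of pos y x "L.order ! b" "L.order ! a"] mono sym[OF e] top[OF a] top[OF b] by blast
      then show ?thesis using Xbag o_lt \<open>a < length ch\<close> by blast
    qed
    fix i assume i: "i < length ch"
    note k = kids[OF i]
    have W: "W i = set (bag ! i) \<union> W (L.kid1 i) \<union> W (L.kid2 i)"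
      using D.below_unfold[of i] k(1) i Xbag by (auto simp: W_def)
    then show "W i = set (bag ! i) \<union> W (L.kid1 i) \<union> W (L.kid2 i)" .
    show "set (L.bag_at (L.kid1 i)) \<subseteq> W (L.kid1 i)" "set (L.bag_at (L.kid2 i)) \<subseteq> W (L.kid2 i)"
      by (fact bag_W)+
    show "distinct (bag ! i)" using Xbag i by blast
    show "W (L.kid1 i) \<inter> set (bag ! i) \<subseteq> set (L.bag_at (L.kid1 i))"
      "W (L.kid2 i) \<inter> set (bag ! i) \<subseteq> set (L.bag_at (L.kid2 i))"
      using sep k(2,3) Xbag(1)[OF i] by blast+
    show "W (L.kid1 i) \<inter> W (L.kid2 i) \<subseteq> set (bag ! i)"
    proof (cases "L.kid1 i = length ch \<or> L.kid2 i = length ch")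
      case False
      then have "L.kid1 i \<noteq> L.kid2 i" using k(4) by blast
      then have "D.below (L.kid1 i) \<inter> D.below (L.kid2 i) \<subseteq> X i"
        using D.below_inter_below[of i "L.kid1 i" "L.kid2 i"] k(2,3) False by blast
      then show ?thesis using k(2,3) False Xbag(1)[OF i] by (simp add: W_def)
    qed (auto simp: W_def)
    fix x y assume xy: "(x, y) \<in> parcs G" "x \<in> W i" "y \<in> W i"
    have "(\<exists>j. (i, j) \<in> D.child \<and> x \<in> D.below j \<and> y \<in> D.below j) \<or> x \<in> X i \<and> y \<in> X i"
      using D.edge_inside_part[OF xy(1), of i] xy i by (simp add: W_def)
    moreover have "j = L.kid1 i \<or> j = L.kid2 i" if "(i, j) \<in> D.child" for j
    proof -
      have "j \<in> set (ch ! i)" using child[OF i] that by blast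
      then obtain p where p: "p < length (ch ! i)" "ch ! i ! p = j" by (auto simp: in_set_conv_nth)
      moreover have "length (ch ! i) \<le> 2" using L.ch[OF i] by blast
      then have "p = 0 \<or> p = 1" using p(1) by linarith
      ultimately show ?thesis by (auto simp: L.kid1_def L.kid2_def)
    qed
    moreover have "D.below j = W j" if "(i, j) \<in> D.child" for j
      using D.child_verts[OF that] T by (simp add: W_def)
    ultimately show "x \<in> W (L.kid1 i) \<and> y \<in> W (L.kid1 i) \<or> x \<in> W (L.kid2 i) \<and> y \<in> W (L.kid2 i) \<or>
        x \<in> set (bag ! i) \<and> y \<in> set (bag ! i)"
      using Xbag(1)[OF i] by metis
  qed (use r in simp)
  then show ?thesis using W_root by blast
qed

section \<open>Correctness of the whole program\<close>

context decomposition_layout begin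

text \<open>Here \<open>t\<close> bounds the bag sizes, so it will be instantiated with one more
  than the bound on the width.\<close>

lemma run_Algorithm:
  fixes t :: nat
  assumes R: "R = (\<lambda>_. 0)(0 := length adj, 1 := length ch, 2 := \<rho>)"
    and M: "M = (\<lambda>_ _. 0)(0 := cells (offsets adj), 1 := cells (concat adj),
                       2 := cells (offsets ch), 3 := cells (concat ch),
                       4 := cells (offsets bag), 5 := cells (concat bag))"
    and t: "\<And>i. i < length bag \<Longrightarrow> length (bag ! i) \<le> t"
  shows "\<exists>K N. 2 \<le> K \<and> K \<le> t + 2 \<and> N = 2 ^ (2 * K ^ r) \<and>
    run (Algorithm F r) (\<lambda>n R' M'. n \<le> 17 * length ch + length ch * (5 * t + 11) +
        (9 * length adj + 7 * length (concat adj)) + (14 * r * K ^ r + 2 * K ^ r * (3 * N + 7)) +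
        length ch * (N * (cost (Step F r) N + 4) + 18) + cost (Answer r) N + 27 \<and>
      R' 0 = (if 1 < length adj \<and> (\<exists>\<chi>::nat \<Rightarrow> nat. (\<forall>x. \<chi> x < 2) \<and>
        (\<forall>c<2. \<not> has_copy F E r {x \<in> V \<rho>. \<chi> x = c})) then 1 else 0)) 0 R M"
proof -
  let ?free = "\<exists>\<chi>::nat \<Rightarrow> nat. (\<forall>x. \<chi> x < 2) \<and> (\<forall>c<2. \<not> has_copy F E r {x \<in> V \<rho>. \<chi> x = c})"
  let ?ans = "1 < length adj \<and> ?free"
  let ?cost = "\<lambda>K N. 17 * length ch + length ch * (5 * t + 11) +
        (9 * length adj + 7 * length (concat adj)) + (14 * r * K ^ r + 2 * K ^ r * (3 * N + 7)) +
        length ch * (N * (cost (Step F r) N + 4) + 18) + cost (Answer r) N + 27"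
  \<comment> \<open>\<open>K\<close> and \<open>N\<close> are quantified inside the postcondition,
    because they become known only when \<open>Tops\<close> has run.\<close>
  let ?Q = "\<lambda>n R' M'. \<exists>K N. 2 \<le> K \<and> K \<le> t + 2 \<and> N = 2 ^ (2 * K ^ r) \<and> n \<le> ?cost K N \<and>
    R' 0 = (if ?ans then 1 else 0)"
  have "run (Algorithm F r) ?Q 0 R M" unfolding Algorithm_def run_SEQ
  proof (rule run_mono[OF run_Bfs])
    fix n1 R1 M1 assume 1: "n1 \<le> 0 + 17 * length ch + 5 \<and> (\<forall>y<16. R1 y = R y) \<and> (\<forall>c. c \<noteq> 6 \<longrightarrow> M1 c = M c) \<and>
      (\<forall>a<length ch. M1 6 a = order ! a)"
    show "run Tops (run Ups (run (Powers r) (run (Main F r) (run (compile (Answer r) (30 + 3 * r))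
      (run (COPY 0 (30 + 3 * r)) ?Q))))) n1 R1 M1"
    proof (rule run_mono[OF run_Tops[where t=t]])
      fix n2 R2 M2 assume 2: "n2 \<le> n1 + length ch * (5 * t + 11) + 4 \<and> (\<forall>y<16. y \<noteq> 4 \<longrightarrow> R2 y = R1 y) \<and>
        (\<forall>c. c \<noteq> 7 \<longrightarrow> M2 c = M1 c) \<and> 2 \<le> R2 4 \<and> R2 4 \<le> t + 2 \<and>
        (\<forall>i<length bag. length (bag ! i) + 2 \<le> R2 4) \<and>
        (\<forall>v. (\<exists>i<length bag. v \<in> set (bag ! i)) \<longrightarrow> topmost 0 v (M2 7 v))"
      define K where "K = R2 4"
      have top: "topmost 0 v (M2 7 v)" if "v < length adj" for v using 2 cover[OF that] by blast
      show "run Ups (run (Powers r) (run (Main F r) (run (compile (Answer r) (30 + 3 * r))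
        (run (COPY 0 (30 + 3 * r)) ?Q)))) n2 R2 M2"
      proof (rule run_mono[OF run_Ups])
        fix n3 R3 M3 assume 3: "n3 \<le> n2 + 9 * length adj + 7 * length (concat adj) + 4 \<and> (\<forall>y<16. R3 y = R2 y) \<and>
          (\<forall>c. c \<noteq> 8 \<longrightarrow> c \<noteq> 9 \<longrightarrow> M3 c = M2 c) \<and>
          (\<forall>v<length adj. lists_at M3 8 9 v (up (M2 7) v))"
        show "run (Powers r) (run (Main F r) (run (compile (Answer r) (30 + 3 * r))
          (run (COPY 0 (30 + 3 * r)) ?Q))) n3 R3 M3"
        proof (rule run_mono[OF run_Powers[where K=K]])
          let ?N = "2 ^ (2 * K ^ r) :: nat"
          fix n4 R4 M4 assume 4: "n4 \<le> n3 + 14 * r * K ^ r + 2 * K ^ r * (3 * ?N + 7) + 6 \<and>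
             (\<forall>y<16. y \<noteq> 3 \<longrightarrow> R4 y = R3 y) \<and> (\<forall>c. c \<noteq> 10 \<longrightarrow> M4 c = M3 c) \<and> R4 3 = ?N \<and>
             (\<forall>a\<le>2 * K ^ r. M4 10 a = 2 ^ a)"
          have M4: "M4 c = M c" if "c \<notin> {6, 7, 8, 9, 10}" for c using 1 2 3 4 that by simp
          show "run (Main F r) (run (compile (Answer r) (30 + 3 * r)) (run (COPY 0 (30 + 3 * r)) ?Q)) n4 R4 M4"
          proof (rule run_mono[OF run_Main[where K=K and m="M2 7"]])
            fix n5 R5 M5 assume 5: "n5 \<le> n4 + length ch * (?N * (cost (Step F r) ?N + 4) + 18) + 7 \<and>
              (\<forall>y<5. R5 y = R4 y) \<and> (\<forall>c. c \<noteq> 11 \<longrightarrow> c \<noteq> 12 \<longrightarrow> M5 c = M4 c) \<and>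
              table_ok K ?N (V \<rho>) (bag ! \<rho>) (\<lambda>w. M5 12 (M5 11 \<rho> + w) \<noteq> 0)"
            interpret digits F E r K M5
              by unfold_locales (use 5 4 2 in \<open>auto simp: K_def\<close>)
            have N: "N = ?N" by (simp add: N_def)
            have "R5 3 = N" unfolding N using 5 4 by simp
            moreover have "R5 0 = length adj" "R5 2 = \<rho>" "R5 4 = K"
              using 5 4 3 2 1 R by (simp_all add: K_def)
            ultimately have R5: "R5 0 = length adj" "R5 2 = \<rho>" "R5 3 = N" "R5 4 = K" by blast+
            have "length (bag ! \<rho>) + 2 \<le> K" using 2 root length_bag by (simp add: K_def)
            from table_ok_accepts[OF this, of N "V \<rho>" "\<lambda>w. M5 12 (M5 11 \<rho> + w) \<noteq> 0"]
            have acc: "(\<exists>w<N. M5 12 (M5 11 \<rho> + w) \<noteq> 0 \<and> accepts K w) \<longleftrightarrow>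
              ?free"
              using 5 N by simp
            have s: "sat (Accepts r) (R5(8 := w)) M5 \<longleftrightarrow> accepts K w" if "w < N" for w
              using sat_Accepts[of "R5(8 := w)"] R5 that by simp
            have "sat (Answer r) R5 M5 \<longleftrightarrow> 1 < length adj \<and> (\<exists>w<N. M5 12 (M5 11 \<rho> + w) \<noteq> 0 \<and> accepts K w)"
              using R5 s by (simp add: Answer_def sat_Cell min_absorb1 cong: conj_cong)
            then have eq: "val (Answer r) R5 M5 \<noteq> 0 \<longleftrightarrow> ?ans" unfolding acc sat_def .
            \<comment> \<open>A conjunction evaluates to \<open>0\<close> or \<open>1\<close>, so
              the truth value determines the number that is output.\<close>
            have "val (Answer r) R5 M5 = (if val (Answer r) R5 M5 \<noteq> 0 then 1 else 0)"
              by (simp add: Answer_def)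
            then have v: "val (Answer r) R5 M5 = (if ?ans then 1 else 0)" unfolding eq .
            show "run (compile (Answer r) (30 + 3 * r)) (run (COPY 0 (30 + 3 * r)) ?Q) n5 R5 M5"
            proof (rule run_mono[OF run_compile[OF uses_below_Answer]])
              fix n6 R6 M6 assume 6: "n6 \<le> n5 + cost (Answer r) (R5 3) \<and> M6 = M5 \<and>
                R6 (30 + 3 * r) = val (Answer r) R5 M5 \<and> (\<forall>y<30 + 3 * r. R6 y = R5 y)"
              have "2 \<le> K" "K \<le> t + 2" using 2 by (simp_all add: K_def)
              moreover have "Suc n6 \<le> ?cost K ?N" using 1 2 3 4 5 6 R5 N by simp
              ultimately show "run (COPY 0 (30 + 3 * r)) ?Q n6 R6 M6"
                unfolding run_atom using 6 v by (intro exI[of _ K] exI[of _ ?N]) (simp del: One_nat_def)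
            qed simp
          next
            show "M4 11 = (\<lambda>_. 0)" "M4 12 = (\<lambda>_. 0)" using M4[of 11] M4[of 12] M by simp_all
            show "M4 2 = cells (offsets ch)" "M4 3 = cells (concat ch)" "M4 4 = cells (offsets bag)"
              "M4 5 = cells (concat bag)" using M4 M by simp_all
            show "lists_at M4 8 9 v (up (M2 7) v)" if "v < length adj" for v
              using 3 4 that by (simp add: lists_at_def)
            show "M4 6 a = order ! a" if "a < length ch" for a using 1 2 3 4 that by simp
          qed (use 1 2 3 4 R top in \<open>auto simp: K_def\<close>)
        qed (use 2 3 in \<open>auto simp: K_def\<close>)
      qed (use 1 2 R M in auto)
    qed (use 1 R M t in auto)
  qed (use R M in auto)
  then show ?thesis unfolding run_def by blast
qed

end

section \<open>The time bound\<close>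

text \<open>Every arc is a pair of vertices of some bag, and a bag has at most \<open>t * t\<close>
  pairs.\<close>

lemma arcs_le:
  assumes G: "pair_graph G" and V: "pverts G = {..<length adj}"
    and adj: "\<And>v. v < length adj \<Longrightarrow> distinct (adj ! v) \<and> set (adj ! v) = {u. (v, u) \<in> parcs G}"
    and td: "tree_decomposition G T X" and T: "pverts T = {..<m}"
    and X: "\<And>i. i < m \<Longrightarrow> finite (X i) \<and> card (X i) \<le> t"
  shows "length (concat adj) \<le> m * (t * t)"
proof -
  interpret G: pair_graph G by (fact G)
  have "(v, u) \<in> parcs G \<longleftrightarrow> v < length adj \<and> u \<in> set (adj ! v)" for v u
    using G.in_arcsD1[of v u] V adj[of v] by auto
  then have "parcs G = Sigma {..<length adj} (\<lambda>v. set (adj ! v))" by auto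
  then have "card (parcs G) = (\<Sum>v<length adj. card (set (adj ! v)))" by simp
  also have "\<dots> = (\<Sum>v<length adj. length (adj ! v))"
    using adj by (intro sum.cong refl) (metis distinct_card lessThan_iff)
  also have "\<dots> = length (concat adj)"
    by (simp add: length_concat sum_list_sum_nth atLeast0LessThan)
  finally have "length (concat adj) = card (parcs G)" by simp
  also have "\<dots> \<le> card (\<Union>i<m. X i \<times> X i)"
    using td T X by (intro card_mono) (auto simp: tree_decomposition_def)
  also have "\<dots> \<le> (\<Sum>i<m. card (X i \<times> X i))" by (intro card_UN_le) simp
  also have "\<dots> \<le> (\<Sum>i<m. t * t)"
    using X by (intro sum_mono) (auto simp: card_cartesian_product intro: mult_le_mono)
  finally show ?thesis by simp
qed

text \<open>Every term is at most a constant times \<open>Y = n * Z ^ (D1 + D2 + 2)\<close>. The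
  exponent covers \<open>Z ^ 2\<close> from counting arcs and \<open>Z ^ (D1 + 1)\<close> from
  filling a table. The factor \<open>62 = 46 + 5 + 7 + 4\<close> collects the terms in
  \<open>nI\<close>, \<open>nI * t\<close>, \<open>m\<close> and \<open>nI * N\<close>; the summand
  \<open>46 = 9 + 3 + 7 + 27\<close> collects \<open>n\<close>, the two terms from computing powers,
  and the constant.\<close>

lemma cost_bound:
  fixes n nI m t r K N Z c A1 D1 A2 D2 s1 s2 :: nat
  assumes n: "1 \<le> n" and nI: "nI \<le> c * n" and m: "m \<le> nI * (t * t)" and t: "t \<le> Z"
    and K: "2 * K ^ r \<le> N" and N: "N + 1 \<le> Z"
    and s: "s1 \<le> A1 * (N + 1) ^ D1" "s2 \<le> A2 * (N + 1) ^ D2"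
  shows "17 * nI + nI * (5 * t + 11) + (9 * n + 7 * m) + (14 * r * K ^ r + 2 * K ^ r * (3 * N + 7)) +
      nI * (N * (s1 + 4) + 18) + s2 + 27
    \<le> (62 * c + 14 * r + c * A1 + A2 + 46) * (n * Z ^ (D1 + D2 + 2))"
proof -
  define Y where "Y = n * Z ^ (D1 + D2 + 2)"
  have Z: "1 \<le> Z" using N by simp
  have pw: "Z ^ d \<le> Z ^ (D1 + D2 + 2)" if "d \<le> D1 + D2 + 2" for d
    using Z that by (intro power_increasing) auto
  have Yd: "n * Z ^ d \<le> Y" if "d \<le> D1 + D2 + 2" for d
    using pw[OF that] by (simp add: Y_def)
  have Y1: "Z ^ d \<le> Y" if "d \<le> D1 + D2 + 2" for d
    using Yd[OF that] n by (metis le_trans mult_le_mono1 nat_mult_1)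
  have nId: "nI * x \<le> c * Y" if "x \<le> Z ^ d" "d \<le> D1 + D2 + 2" for x d
  proof -
    have "nI * x \<le> (c * n) * Z ^ d" using nI that(1) by (rule mult_le_mono)
    also have "\<dots> = c * (n * Z ^ d)" by simp
    also have "\<dots> \<le> c * Y" using Yd[OF that(2)] by simp
    finally show ?thesis .
  qed
  have Y0: "1 \<le> Y" "n \<le> Y" "Z \<le> Y" "Z * Z \<le> Y"
    using Y1[of 0] Yd[of 0] Y1[of 1] Y1[of 2] by (simp_all add: power2_eq_square)
  have i1: "nI \<le> c * Y" using nId[of 1 0] by simp
  have i2: "nI * t \<le> c * Y" using nId[of t 1] t by simp
  have "t * t \<le> Z * Z" using t by (intro mult_le_mono)
  then have i3: "m \<le> c * Y" using nId[of "t * t" 2] m by (simp add: power2_eq_square)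
  have i4: "nI * N \<le> c * Y" using nId[of N 1] N by simp
  have p: "(N + 1) ^ d \<le> Z ^ d" for d using N by (intro power_mono) auto
  have i5: "nI * (N * s1) \<le> A1 * (c * Y)"
  proof -
    have "N * (N + 1) ^ D1 \<le> Z * Z ^ D1" using N p by (intro mult_le_mono) auto
    then have "nI * (N * (N + 1) ^ D1) \<le> c * Y" using nId[of _ "Suc D1"] by simp
    moreover have "nI * (N * s1) \<le> nI * (N * (A1 * (N + 1) ^ D1))" using s by (intro mult_le_mono2)
    moreover have "nI * (N * (A1 * (N + 1) ^ D1)) = A1 * (nI * (N * (N + 1) ^ D1))" by simp
    ultimately show ?thesis by (metis le_trans mult_le_mono2)
  qed
  have i6: "s2 \<le> A2 * Y"
    using s(2) p[of D2] Y1[of D2] by (meson le_add1 le_add2 le_trans mult_le_mono2 trans_le_add1)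
  have kz: "K ^ r \<le> Z" "2 * K ^ r \<le> Z" using K N by linarith+
  have i7: "r * K ^ r \<le> r * Y" using kz Y0 by (intro mult_le_mono2) linarith
  have i8: "2 * K ^ r * N \<le> Y"
  proof -
    have "2 * K ^ r * N \<le> Z * Z" using kz N by (intro mult_le_mono) auto
    then show ?thesis using Y0 by linarith
  qed
  have e: "17 * nI + nI * (5 * t + 11) + (9 * n + 7 * m) + (14 * r * K ^ r + 2 * K ^ r * (3 * N + 7)) +
      nI * (N * (s1 + 4) + 18) + s2 + 27 =
    46 * nI + 5 * (nI * t) + 9 * n + 7 * m + 14 * (r * K ^ r) + 3 * (2 * K ^ r * N) + 7 * (2 * K ^ r) +
    nI * (N * s1) + 4 * (nI * N) + s2 + 27"
    by (simp add: algebra_simps)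
  have "(62 * c + 14 * r + c * A1 + A2 + 46) * Y =
    62 * (c * Y) + 14 * (r * Y) + A1 * (c * Y) + A2 * Y + 46 * Y" by (simp add: algebra_simps)
  moreover have "7 * (2 * K ^ r) \<le> 7 * Y" using kz Y0 by linarith
  ultimately show ?thesis unfolding e Y_def[symmetric]
    using i1 i2 i3 i4 i5 i6 i7 i8 Y0 by linarith
qed

text \<open>From \<open>t = 3\<close> on, \<open>t + 3 \<le> 2 * t\<close>, so the shift costs a
  factor \<open>2 ^ r\<close>, and constants are absorbed by \<open>1 \<le> t ^ r\<close>.\<close>

lemma shifted_power_bigo: "(\<lambda>t. a + b * (2 * (real t + 3) ^ r + 1)) \<in> O(\<lambda>t. real t ^ r)"
proof (rule bigoI)
  show "\<forall>\<^sub>F t in sequentially. norm (a + b * (2 * (real t + 3) ^ r + 1)) \<le>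
    (\<bar>a\<bar> + \<bar>b\<bar> * (2 * 2 ^ r + 1)) * norm (real t ^ r)"
  proof (rule eventually_sequentiallyI[of 3])
    fix t :: nat assume t: "3 \<le> t"
    have 1: "1 \<le> real t ^ r" using t by (intro one_le_power) simp
    have "(real t + 3) ^ r \<le> (2 * real t) ^ r" using t by (intro power_mono) auto
    then have "2 * (real t + 3) ^ r + 1 \<le> (2 * 2 ^ r + 1) * real t ^ r"
      using 1 by (simp add: power_mult_distrib algebra_simps)
    then have "\<bar>b\<bar> * (2 * (real t + 3) ^ r + 1) \<le> \<bar>b\<bar> * ((2 * 2 ^ r + 1) * real t ^ r)"
      by (intro mult_left_mono) auto
    moreover have "\<bar>a\<bar> * 1 \<le> \<bar>a\<bar> * real t ^ r" using 1 by (intro mult_left_mono) auto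
    moreover have "\<bar>a + b * (2 * (real t + 3) ^ r + 1)\<bar> \<le> \<bar>a\<bar> + \<bar>b\<bar> * (2 * (real t + 3) ^ r + 1)"
      using abs_triangle_ineq[of a "b * (2 * (real t + 3) ^ r + 1)"] by (simp add: abs_mult)
    ultimately show "norm (a + b * (2 * (real t + 3) ^ r + 1)) \<le>
      (\<bar>a\<bar> + \<bar>b\<bar> * (2 * 2 ^ r + 1)) * norm (real t ^ r)"
      by (simp add: algebra_simps)
  qed
qed

theorem theorem5:
  fixes H :: "'h pair_pre_digraph" and r :: nat
  assumes "pair_graph H" and "card (pverts H) = r"
  shows "\<exists>P :: com. \<forall>c :: nat. \<exists>f :: nat \<Rightarrow> real. f \<in> O(\<lambda>t. real t ^ r) \<and>
    (\<forall>(G :: nat pair_pre_digraph) (T :: nat pair_pre_digraph) \<rho> X (n :: nat) (t :: nat) s.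
       pair_graph G \<and> card (pverts G) = n \<and> treewidth G \<le> int t \<and>
       nice_tree_decomposition G T \<rho> X \<and> width T X \<le> int t \<and> card (pverts T) \<le> c * n \<and>
       encodes G T \<rho> X s \<longrightarrow>
       (\<exists>k R M. exec P s k (R, M) \<and>
          R 0 = (if has_induced_free_bipartition (with_proj G) (with_proj H) then 1 else 0) \<and>
          real k \<le> 2 powr f t * real n))"
proof -
  interpret H: pair_graph H by fact
  obtain \<eta> where \<eta>: "bij_betw \<eta> {..<r} (pverts H)"
    using ex_bij_betw_nat_finite[OF H.pair_finite_verts] assms(2) by (auto simp: atLeast0LessThan)
  have nodes: "pverts T \<noteq> {} \<and> finite (pverts T)" if "nice_tree_decomposition G T \<rho> X"
    for G T :: "nat pair_pre_digraph" and \<rho> X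
    using that by (auto simp: nice_tree_decomposition_def tree_decomposition_def undirected_tree_def
        pair_graph_def pair_digraph_def pair_fin_digraph_def pair_fin_digraph_axioms_def)
  \<comment> \<open>A tree has at least one node, so at most \<open>c * n\<close> nodes forces
    \<open>n > 0\<close>. Constant costs can then be charged to \<open>n\<close>.\<close>
  have n_pos: "1 \<le> n" if "nice_tree_decomposition G T \<rho> X" "card (pverts T) \<le> c * n"
    for G T :: "nat pair_pre_digraph" and \<rho> X c n
    using nodes[OF that(1)] that(2) by (cases n) auto
  show ?thesis
  \<comment> \<open>The empty pattern is contained in every graph, so for \<open>r = 0\<close> the
    answer is always no and one step is enough.\<close>
  proof (cases "r = 0")
    case True
    show ?thesis
    proof (intro exI allI conjI impI)
      show "(\<lambda>_. 0) \<in> O(\<lambda>t. real t ^ r)" by simp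
      fix c :: nat and G T :: "nat pair_pre_digraph" and \<rho> X and n t :: nat and s
      assume a: "pair_graph G \<and> card (pverts G) = n \<and> treewidth G \<le> int t \<and>
       nice_tree_decomposition G T \<rho> X \<and> width T X \<le> int t \<and> card (pverts T) \<le> c * n \<and> encodes G T \<rho> X s"
      obtain R M where s: "s = (R, M)" by (cases s)
      show "exec (SET 0 0) s 1 ((fst s)(0 := 0), snd s)" using exec.Set[of 0 0 R M] by (simp add: s)
      have "\<not> has_induced_free_bipartition (with_proj G) (with_proj H)"
        using has_induced_free_bipartition_iff[OF _ assms(1) \<eta>, of G] a True
        by (force simp: has_copy_def)
      then show "((fst s)(0 := 0)) 0 = (if has_induced_free_bipartition (with_proj G) (with_proj H) then 1 else 0)"
        by simp
      show "real 1 \<le> 2 powr 0 * real n" using n_pos a by (metis mult_1 of_nat_mono powr_zero_eq_one zero_neq_numeral)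
    qed
  next
    case False
    then have r: "0 < r" by simp
    define F where "F h h' \<longleftrightarrow> (\<eta> h, \<eta> h') \<in> parcs H" for h h'
    obtain A1 D1 where s1: "\<And>N. cost (Step F r) N \<le> A1 * (N + 1) ^ D1" using cost_polynomial by blast
    obtain A2 D2 where s2: "\<And>N. cost (Answer r) N \<le> A2 * (N + 1) ^ D2" using cost_polynomial by blast
    show ?thesis
    proof (rule exI[of _ "Algorithm F r"], rule allI)
      fix c :: nat
      define B where "B = 62 * c + 14 * r + c * A1 + A2 + 46"
      define D where "D = D1 + D2 + 2"
      \<comment> \<open>The binary logarithm of \<open>B * Z ^ D\<close>, where \<open>Z\<close> is
        \<open>2\<close> to the power \<open>2 * (t + 3) ^ r + 1\<close>.\<close>
      define f where "f t = log 2 (real B) + real D * (2 * (real t + 3) ^ r + 1)" for t :: nat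
      have "f \<in> O(\<lambda>t. real t ^ r)" unfolding f_def by (rule shifted_power_bigo)
      moreover have "\<exists>k R M. exec (Algorithm F r) s k (R, M) \<and>
          R 0 = (if has_induced_free_bipartition (with_proj G) (with_proj H) then 1 else 0) \<and>
          real k \<le> 2 powr f t * real n"
        if G: "pair_graph G" and n: "card (pverts G) = n"
          and nice: "nice_tree_decomposition G T \<rho> X" and w: "width T X \<le> int t"
          and cn: "card (pverts T) \<le> c * n" and enc: "encodes G T \<rho> X s"
        for G T :: "nat pair_pre_digraph" and \<rho> X n t s
      proof -
        obtain adj ch bag where V: "pverts G = {..<length adj}"
          and adjG: "\<And>v. v < length adj \<Longrightarrow> distinct (adj ! v) \<and> set (adj ! v) = {u. (v, u) \<in> parcs G}"
          and T: "pverts T = {..<length ch}"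
          and chT: "\<And>i. i < length ch \<Longrightarrow> distinct (ch ! i) \<and> set (ch ! i) = children T \<rho> i"
          and lb: "length bag = length ch"
          and bagX: "\<And>i. i < length bag \<Longrightarrow> distinct (bag ! i) \<and> set (bag ! i) = X i"
          and s: "s = ((\<lambda>_. 0)(0 := length adj, 1 := length ch, 2 := \<rho>),
             (\<lambda>_ _. 0)(0 := cells (offsets adj), 1 := cells (concat adj),
                       2 := cells (offsets ch), 3 := cells (concat ch),
                       4 := cells (offsets bag), 5 := cells (concat bag)))"
          using enc unfolding encodes_def by blast
        obtain W where W: "decomposition_layout adj ch bag \<rho> (\<lambda>u v. (u, v) \<in> parcs G) r W" "W \<rho> = pverts G"
          using nice_layout[OF G nice V adjG T chT lb bagX r] by blast
        interpret decomposition_layout adj ch bag \<rho> F "\<lambda>u v. (u, v) \<in> parcs G" r W by (fact W(1))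
        have card_bag: "card (X i) \<le> t + 1" if "i < length ch" for i
        proof -
          have "int (card (X i)) \<le> Max ((\<lambda>i. int (card (X i))) ` pverts T)"
            using that T by (intro Max_ge) auto
          then show ?thesis using w by (simp add: width_def)
        qed
        have len_bag: "length (bag ! i) \<le> t + 1" if "i < length bag" for i
          using bagX[OF that] card_bag[of i] that lb by (metis distinct_card)
        have nI: "length ch \<le> c * n" and nV: "length adj = n" using cn T n V by simp_all
        have "1 \<le> n" using n_pos[OF nice cn] .
        have td: "tree_decomposition G T X" using nice by (simp add: nice_tree_decomposition_def)
        have m: "length (concat adj) \<le> length ch * ((t + 1) * (t + 1))"
          using arcs_le[OF G V adjG td T] card_bag bagX lb by (metis List.finite_set)
        obtain K N where K: "2 \<le> K" "K \<le> t + 1 + 2" "N = 2 ^ (2 * K ^ r)"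
          and run: "run (Algorithm F r) (\<lambda>n R' M'. n \<le> 17 * length ch + length ch * (5 * (t + 1) + 11) +
            (9 * length adj + 7 * length (concat adj)) + (14 * r * K ^ r + 2 * K ^ r * (3 * N + 7)) +
            length ch * (N * (cost (Step F r) N + 4) + 18) + cost (Answer r) N + 27 \<and>
            R' 0 = (if 1 < length adj \<and> (\<exists>\<chi>::nat \<Rightarrow> nat. (\<forall>x. \<chi> x < 2) \<and>
              (\<forall>c<2. \<not> has_copy F (\<lambda>u v. (u, v) \<in> parcs G) r {x \<in> W \<rho>. \<chi> x = c})) then 1 else 0)) 0 (fst s) (snd s)"
          using run_Algorithm[of "fst s" "snd s" "t + 1"] s len_bag by auto
        then obtain k R M where ex: "exec (Algorithm F r) s k (R, M)"
          and k: "k \<le> 17 * length ch + length ch * (5 * (t + 1) + 11) +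
            (9 * length adj + 7 * length (concat adj)) + (14 * r * K ^ r + 2 * K ^ r * (3 * N + 7)) +
            length ch * (N * (cost (Step F r) N + 4) + 18) + cost (Answer r) N + 27"
          and R0: "R 0 = (if 1 < length adj \<and> (\<exists>\<chi>::nat \<Rightarrow> nat. (\<forall>x. \<chi> x < 2) \<and>
              (\<forall>c<2. \<not> has_copy F (\<lambda>u v. (u, v) \<in> parcs G) r {x \<in> W \<rho>. \<chi> x = c})) then 1 else 0)"
          unfolding run_def by (simp only: prod.collapse add_0) blast
        have ans: "R 0 = (if has_induced_free_bipartition (with_proj G) (with_proj H) then 1 else 0)"
          unfolding R0 has_induced_free_bipartition_iff[OF G assms(1) \<eta>] W(2) F_def using n nV by simp
        \<comment> \<open>\<open>K\<close> is at most \<open>t + 3\<close>: bags have up to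
          \<open>t + 1\<close> vertices and there are two extra digits. So
          \<open>N \<le> 2 ^ L\<close>, and the additional factor \<open>2\<close> in
          \<open>Z\<close> makes room for \<open>N + 1\<close>.\<close>
        define L where "L = 2 * (t + 3) ^ r"
        define Z where "Z = (2::nat) ^ (L + 1)"
        have "2 * K ^ r \<le> L" unfolding L_def using K(2) by (intro mult_le_mono2 power_mono) auto
        then have "N \<le> 2 ^ L" unfolding K(3) by (intro power_increasing) auto
        moreover have "1 \<le> (2::nat) ^ L" by simp
        ultimately have NZ: "N + 1 \<le> Z" unfolding Z_def power_add power_one_right by linarith
        have "(t + 3) ^ 1 \<le> (t + 3) ^ r" using r by (intro power_increasing) auto
        then have "t + 1 \<le> L" by (simp add: L_def)
        moreover have "L < 2 ^ L" by (rule less_exp)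
        ultimately have tZ: "t + 1 \<le> Z" unfolding Z_def power_add power_one_right by linarith
        have KN: "2 * K ^ r \<le> N" unfolding K(3) by (rule less_imp_le[OF less_exp])
        have "k \<le> B * (n * Z ^ D)"
          using k cost_bound[OF \<open>1 \<le> n\<close> nI m tZ KN NZ s1 s2] unfolding B_def D_def nV by (rule order_trans)
        then have "real k \<le> real B * (real n * real Z ^ D)"
          by (metis of_nat_le_iff of_nat_mult of_nat_power)
        also have "real Z ^ D = 2 powr (real D * (2 * (real t + 3) ^ r + 1))"
        proof -
          define y where "y = 2 * (real t + 3) ^ r + 1"
          have "real Z = 2 ^ (L + 1)" by (simp add: Z_def)
          also have "\<dots> = 2 powr real (L + 1)" by (rule powr_realpow[symmetric]) simp
          also have "real (L + 1) = y" by (simp add: L_def y_def)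
          finally have "real Z ^ D = (2 powr y) powr real D" by (simp add: powr_realpow)
          also have "\<dots> = 2 powr (real D * y)" by (simp add: powr_powr mult.commute)
          finally show ?thesis by (simp only: y_def)
        qed
        also have "real B * (real n * 2 powr (real D * (2 * (real t + 3) ^ r + 1))) = 2 powr f t * real n"
        proof -
          have "0 < B" by (simp add: B_def)
          then have "2 powr log 2 (real B) = real B" by simp
          then show ?thesis by (simp add: f_def powr_add)
        qed
        finally show ?thesis using ex ans by blast
      qed
      ultimately show "\<exists>f :: nat \<Rightarrow> real. f \<in> O(\<lambda>t. real t ^ r) \<and>
        (\<forall>(G :: nat pair_pre_digraph) (T :: nat pair_pre_digraph) \<rho> X (n :: nat) (t :: nat) s.
       pair_graph G \<and> card (pverts G) = n \<and> treewidth G \<le> int t \<and>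
       nice_tree_decomposition G T \<rho> X \<and> width T X \<le> int t \<and> card (pverts T) \<le> c * n \<and>
       encodes G T \<rho> X s \<longrightarrow>
       (\<exists>k R M. exec (Algorithm F r) s k (R, M) \<and>
          R 0 = (if has_induced_free_bipartition (with_proj G) (with_proj H) then 1 else 0) \<and>
          real k \<le> 2 powr f t * real n))"
        by blast
    qed
  qed
qed

end
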